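(* Let $\mathcal{M}$, $\mathcal{X}$, $D$, $K_{\min},K_{\max}$, $C_1,C_2,C_3,C_4$, $W=[w_{ij}]\in\mathbb{R}^{n\times n}$, $f_1,\dots,f_n$, $\delta$, $\sigma$, $G$ satisfy the network, manifold, bounded-gradient and unbiased-estimator assumptions stated in the context. Let $T\ge 1$, $\eta_0:=\min\{1,D/G\}$, $\eta_t:=\eta_0/\sqrt{t}$ and $s:=C_2/(2C_1)$. Let the iterates be generated, for $i=1,\dots,n$ and $t=1,\dots,T$, by $$y_i^{t+1}=\exp_{x_i^t}\bigl(-\eta_t\,\widehat{\mathrm{grad}} f_i(x_i^t)\bigr),\qquad x_i^{t+1}=\exp_{y_i^{t+1}}\Bigl(s\sum_{j=1}^n w_{ij}\log_{y_i^{t+1}}(y_j^{t+1})\Bigr),$$ with common initialization $x_i^1=x^1\in\mathcal{X}$ for all $i$. Assume that all iterates $x_i^t$ and $y_i^t$ lie in $\mathcal{X}$. Let $\bar{x}^t$ denote the Fréchet mean of $x_1^t,\dots,x_n^t$. Define $$\xi=\frac{C_2^3(1-\sigma_2(W))}{4C_1(1+C_4D^2)^2},\qquad C(\xi)=\frac{1+\xi^2}{\xi^4},\qquad B=(1-\xi)\bigl(2C_1(\sigma^2+\delta^2)+\xi^{-1}\delta^2\bigr).$$ Then for each $t\in\{1,\dots,T+1\}$, $$\sum_{i=1}^n\mathbb{E}\bigl[d^2(x_i^t,\bar{x}^t)\bigr]\le\frac{\eta_0^2\,C(\xi)\,nB}{t}.$$ In particular the left-hand side is $\mathcal{O}(1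/t)$.
   Context: Setting and notation. $\mathcal{M}$ is a finite-dimensional Riemannian manifold with Riemannian distance $d$; $\exp_x$ is the exponential map at $x$, $\log_x$ its inverse (logarithmic map), so that $\|\log_x(y)\|=d(x,y)$ where it is defined; $\mathrm{grad}$ is the Riemannian gradient; $\mathrm{inj}_{\mathcal{M}}(x)$ is the injectivity radius at $x$, and $\mathrm{inj}(\mathcal{X})=\inf_{x\in\mathcal{X}}\mathrm{inj}_{\mathcal{M}}(x)$. There are $n$ agents; agent $i$ has a local objective $f_i:\mathcal{X}\to\mathbb{R}$ of the form $f_i(x)=\mathbb{E}_{\xi_i\sim D_i}[F_i(x,\xi_i)]$. Network assumption. The network (a graph on the $n$ agents) is connected, and $W=[w_{ij}]\in\mathbb{R}^{n\times n}$ is symmetric, doubly stochastic, entrywise nonnegative, has positive diagonal entries, and $w_{ij}=0$ whenever agents $i\neq j$ are not connected. $\sigma_2(W)$ is the second largest singular value of $W$; under these conditions $\sigma_2(W)\in[0,1)$ (in particular the graph is that for which $W$ mixes, as is understood in this assumption). Manifold assumption. $\mathcal{X}\subset\mathcal{M}$ is geodesically convex (the minimizing geodesic between any two of its points lies in $\mathcal{X}$). The sectional curvature $K$ inside $\mathcal{X}$ satisfies $K_{\min}\le K\le K_{\max}$. The diameter of $\mathcal{X}$ is bounded by $D>0$ with $D<\mathrm{inj}(\mathcal{X})$; if $K_{\max}>0$, also $D<\pi/(2\sqrt{K_{\max}})$. Thus $\log_x(y)$ exists uniquely for all $x,y\in\mathcal{X}$. The geometric constants $C_1\ge 1$, $0<C_2\le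 1$, $C_3\ge 0$, $C_4\ge 0$, depending only on the curvature bounds and $D$, are fixed constants for which the following comparison inequalities hold: for all $a,b,c\in\mathcal{X}$, $$C_2d^2(b,c)+d^2(a,b)-2\langle\log_b(a),\log_b(c)\rangle\le d^2(a,c)\le C_1d^2(b,c)+d^2(a,b)-2\langle\log_b(a),\log_b(c)\rangle,$$ and for all $x,y,z\in\mathcal{X}$, $$(1+C_3D^2)^{-1}d(y,z)\le\|\log_x(y)-\log_x(z)\|\le(1+C_4D^2)d(y,z).$$ Bounded-gradient assumption. Each $f_i$ is continuously differentiable on $\mathcal{X}$ and there is $\delta>0$ with $\|\mathrm{grad} f_i(x)\|\le\delta$ for all $x\in\mathcal{X}$ and all $i$ (consequently each $f_i$ is $\delta$-Lipschitz on $\mathcal{X}$). Unbiased-estimator assumption. $\widehat{\mathrm{grad}} f_i(x_i^t)\in T_{x_i^t}\mathcal{M}$ is a random (stochastic gradient) tangent vector. With $\mathcal{F}_t$ the filtration generated by the iterates $\{(x_1^k,\dots,x_n^k)\}_{k=1}^t$, for each $i,t$: (i) $\mathbb{E}[\widehat{\mathrm{grad}} f_i(x_i^t)\mid\mathcal{F}_t]=\mathrm{grad} f_i(x_i^t)$; (ii) $\mathbb{E}[\|\widehat{\mathrm{grad}} f_i(x_i^t)-\mathrm{grad} f_i(x_i^t)\|^2\mid\mathcal{F}_t]\le\sigma^2$; (iii) there is $G>0$ with $\|\widehat{\mathrm{grad}} f_i(x_i^t)\|\le G$ almost surely. Fréchet mean. For $\{x_i\}_{i=1}^n\subset\mathcal{X}$,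 the Fréchet mean is $\bar{x}\in\arg\min_{x\in\mathcal{X}}\frac1n\sum_{i=1}^n d^2(x_i,x)$. Under the manifold assumption it exists uniquely and lies in $\mathcal{X}$ (a known fact the paper relies on). *)

theory Defs
  imports
    "HOL-Analysis.Analysis"
    "HOL-Probability.Probability"
    "HOL-Library.Multiset"
    "HOL-Library.Landau_Symbols"
begin

section \<open>Riemannian manifolds\<close>

text \<open>Continuous differentiability on an open set, via iterated directional derivatives.\<close>

primrec Ck_on ::
  "nat \<Rightarrow> 'e::euclidean_space set \<Rightarrow> ('e \<Rightarrow> 'f::real_normed_vector) \<Rightarrow> bool" where
  "Ck_on 0 S f \<longleftrightarrow> continuous_on S f"
| "Ck_on (Suc k) S f \<longleftrightarrow>
     f differentiable_on S \<and> (\<forall>v. Ck_on k S (\<lambda>x. frechet_derivative f (at x) v))"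

definition smooth_on ::
  "'e::euclidean_space set \<Rightarrow> ('e \<Rightarrow> 'f::real_normed_vector) \<Rightarrow> bool" where
  "smooth_on S f \<longleftrightarrow> (\<forall>k. Ck_on k S f)"

text \<open>A chart \<open>(U, \<phi>)\<close> is an open set together with its coordinate map into the model space
  \<open>'e\<close>, whose dimension is that of the manifold. The field \<open>gram\<close> gives the metric
  in coordinates: \<open>gram R c p u v\<close> is the inner product, at the point with coordinates \<open>p\<close> in the
  chart \<open>c\<close>, of the vectors with components \<open>u\<close> and \<open>v\<close>.\<close>

type_synonym ('a, 'e) chart = "'a set \<times> ('a \<Rightarrow> 'e)"

record ('a, 'e) riemannian =
  atlas :: "('a, 'e) chart set"
  gram :: "('a, 'e) chart \<Rightarrow> 'e \<Rightarrow> 'e \<Rightarrow> 'e \<Rightarrow> real"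

abbreviation chart_dom :: "('a, 'e) chart \<Rightarrow> 'a set" where
  "chart_dom c \<equiv> fst c"

abbreviation chart_map :: "('a, 'e) chart \<Rightarrow> 'a \<Rightarrow> 'e" where
  "chart_map c \<equiv> snd c"

definition chart_inv :: "('a, 'e) chart \<Rightarrow> 'e \<Rightarrow> 'a" where
  "chart_inv c = inv_into (chart_dom c) (chart_map c)"

definition transition :: "('a, 'e) chart \<Rightarrow> ('a, 'e) chart \<Rightarrow> 'e \<Rightarrow> 'e" where
  "transition c c' = (\<lambda>p. chart_map c' (chart_inv c p))"

definition manifold_carrier :: "('a, 'e) riemannian \<Rightarrow> 'a set" where
  "manifold_carrier R = (\<Union>c\<in>atlas R. chart_dom c)"

definition charts_at :: "('a, 'e) riemannian \<Rightarrow> 'a \<Rightarrow> ('a, 'e) chart set" where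
  "charts_at R x = {c \<in> atlas R. x \<in> chart_dom c}"

definition chart_at :: "('a, 'e) riemannian \<Rightarrow> 'a \<Rightarrow> ('a, 'e) chart" where
  "chart_at R x = (SOME c. c \<in> charts_at R x)"

definition riemannian_manifold ::
  "('a::{second_countable_topology, t2_space}, 'e::euclidean_space) riemannian \<Rightarrow> bool" where
  "riemannian_manifold R \<longleftrightarrow>
     (\<forall>c\<in>atlas R. open (chart_dom c) \<and> open (chart_map c ` chart_dom c) \<and>
        homeomorphism (chart_dom c) (chart_map c ` chart_dom c) (chart_map c) (chart_inv c)) \<and>
     (\<forall>c\<in>atlas R. \<forall>c'\<in>atlas R.
        smooth_on (chart_map c ` (chart_dom c \<inter> chart_dom c')) (transition c c')) \<and>
     (\<forall>c\<in>atlas R. \<forall>u v. smooth_on (chart_map c ` chart_dom c) (\<lambda>p. gram R c p u v)) \<and>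
     (\<forall>c\<in>atlas R. \<forall>p\<in>chart_map c ` chart_dom c.
        bilinear (gram R c p) \<and> (\<forall>u v. gram R c p u v = gram R c p v u) \<and>
        (\<forall>u. u \<noteq> 0 \<longrightarrow> gram R c p u u > 0)) \<and>
     (\<forall>c\<in>atlas R. \<forall>c'\<in>atlas R. \<forall>x\<in>chart_dom c \<inter> chart_dom c'. \<forall>u v.
        gram R c (chart_map c x) u v =
        gram R c' (chart_map c' x)
          (frechet_derivative (transition c c') (at (chart_map c x)) u)
          (frechet_derivative (transition c c') (at (chart_map c x)) v))"

text \<open>A tangent vector at \<open>x\<close> is the family of its components in all charts around \<open>x\<close>, related
  by the Jacobians of the transition maps; the entries at all other charts are set to \<open>0\<close>.
  The linear operations are pointwise in the chart.\<close>

type_synonym ('a, 'e) tangent_vector = "('a, 'e) chart \<Rightarrow> 'e"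

definition tangent_space ::
  "('a, 'e::euclidean_space) riemannian \<Rightarrow> 'a \<Rightarrow> ('a, 'e) tangent_vector set" where
  "tangent_space R x = {v.
     (\<forall>c. c \<notin> charts_at R x \<longrightarrow> v c = 0) \<and>
     (\<forall>c\<in>charts_at R x. \<forall>c'\<in>charts_at R x.
        v c' = frechet_derivative (transition c c') (at (chart_map c x)) (v c))}"

text \<open>The tangent vector at \<open>x\<close> whose component in the chart \<open>c\<close> is \<open>a\<close>.\<close>

definition tangent_of ::
  "('a, 'e::euclidean_space) riemannian \<Rightarrow> 'a \<Rightarrow> ('a, 'e) chart \<Rightarrow> 'e \<Rightarrow> ('a, 'e) tangent_vector" where
  "tangent_of R x c a = (\<lambda>c'. if c' \<in> charts_at R x
     then frechet_derivative (transition c c') (at (chart_map c x)) a else 0)"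

text \<open>By the compatibility of \<open>gram\<close> the value does not depend on the chart chosen.\<close>

definition rinner ::
  "('a, 'e) riemannian \<Rightarrow> 'a \<Rightarrow> ('a, 'e) tangent_vector \<Rightarrow> ('a, 'e) tangent_vector \<Rightarrow> real" where
  "rinner R x u v = (let c = chart_at R x in gram R c (chart_map c x) (u c) (v c))"

definition rnorm :: "('a, 'e) riemannian \<Rightarrow> 'a \<Rightarrow> ('a, 'e) tangent_vector \<Rightarrow> real" where
  "rnorm R x v = sqrt (rinner R x v v)"

text \<open>The derivative is taken within the parameter interval \<open>I\<close>, hence one-sided at its
  end points.\<close>

definition velocity ::
  "('a, 'e::euclidean_space) riemannian \<Rightarrow> real set \<Rightarrow> (real \<Rightarrow> 'a) \<Rightarrow> real \<Rightarrow> ('a, 'e) tangent_vector" where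
  "velocity R I \<gamma> t = (\<lambda>c. if c \<in> charts_at R (\<gamma> t)
     then vector_derivative (\<lambda>s. chart_map c (\<gamma> s)) (at t within I) else 0)"

definition C1_curve ::
  "('a::topological_space, 'e::euclidean_space) riemannian \<Rightarrow> real set \<Rightarrow> (real \<Rightarrow> 'a) \<Rightarrow> bool" where
  "C1_curve R I \<gamma> \<longleftrightarrow>
     \<gamma> ` I \<subseteq> manifold_carrier R \<and> continuous_on I \<gamma> \<and>
     (\<forall>c\<in>atlas R.
        (\<forall>t\<in>I. \<gamma> t \<in> chart_dom c \<longrightarrow> (\<lambda>s. chart_map c (\<gamma> s)) differentiable (at t within I)) \<and>
        continuous_on {t\<in>I. \<gamma> t \<in> chart_dom c} (\<lambda>t. velocity R I \<gamma> t c))"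

definition curve_length ::
  "('a, 'e::euclidean_space) riemannian \<Rightarrow> real set \<Rightarrow> (real \<Rightarrow> 'a) \<Rightarrow> real" where
  "curve_length R I \<gamma> = integral I (\<lambda>t. rnorm R (\<gamma> t) (velocity R I \<gamma> t))"

text \<open>\<open>joined R x y L\<close>: some piecewise continuously differentiable curve from \<open>x\<close> to \<open>y\<close>, that is,
  a finite concatenation of continuously differentiable curves, has length \<open>L\<close>.\<close>

inductive joined ::
  "('a::topological_space, 'e::euclidean_space) riemannian \<Rightarrow> 'a \<Rightarrow> 'a \<Rightarrow> real \<Rightarrow> bool"
  for R where
  curve: "a < b \<Longrightarrow> C1_curve R {a..b} \<gamma> \<Longrightarrow> joined R (\<gamma> a) (\<gamma> b) (curve_length R {a..b} \<gamma>)"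
| concat: "joined R x y L \<Longrightarrow> joined R y z L' \<Longrightarrow> joined R x z (L + L')"

definition rdist ::
  "('a::topological_space, 'e::euclidean_space) riemannian \<Rightarrow> 'a \<Rightarrow> 'a \<Rightarrow> real" where
  "rdist R x y = Inf {L. joined R x y L}"

text \<open>The Christoffel map of the Levi-Civita connection, given by the Koszul formula for
  coordinate fields.\<close>

definition christoffel ::
  "('a, 'e::euclidean_space) riemannian \<Rightarrow> ('a, 'e) chart \<Rightarrow> 'e \<Rightarrow> 'e \<Rightarrow> 'e \<Rightarrow> 'e" where
  "christoffel R c p u v = (THE z. \<forall>w. gram R c p z w =
     (frechet_derivative (\<lambda>q. gram R c q v w) (at p) u
      + frechet_derivative (\<lambda>q. gram R c q u w) (at p) v
      - frechet_derivative (\<lambda>q. gram R c q u v) (at p) w) / 2)"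

definition geodesic ::
  "('a::topological_space, 'e::euclidean_space) riemannian \<Rightarrow> real set \<Rightarrow> (real \<Rightarrow> 'a) \<Rightarrow> bool" where
  "geodesic R I \<gamma> \<longleftrightarrow>
     \<gamma> ` I \<subseteq> manifold_carrier R \<and> continuous_on I \<gamma> \<and>
     (\<forall>t\<in>I. \<forall>c\<in>charts_at R (\<gamma> t).
        ((\<lambda>s. chart_map c (\<gamma> s)) has_vector_derivative velocity R I \<gamma> t c) (at t within I) \<and>
        ((\<lambda>s. velocity R I \<gamma> s c) has_vector_derivative
           - christoffel R c (chart_map c (\<gamma> t)) (velocity R I \<gamma> t c) (velocity R I \<gamma> t c))
          (at t within I))"

definition minimizing_geodesic ::
  "('a::topological_space, 'e::euclidean_space) riemannian \<Rightarrow> 'a \<Rightarrow> 'a \<Rightarrow> (real \<Rightarrow> 'a) \<Rightarrow> bool" where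
  "minimizing_geodesic R x y \<gamma> \<longleftrightarrow>
     geodesic R {0..1} \<gamma> \<and> \<gamma> 0 = x \<and> \<gamma> 1 = y \<and> curve_length R {0..1} \<gamma> = rdist R x y"

definition geodesically_convex ::
  "('a::topological_space, 'e::euclidean_space) riemannian \<Rightarrow> 'a set \<Rightarrow> bool" where
  "geodesically_convex R X \<longleftrightarrow>
     (\<forall>x\<in>X. \<forall>y\<in>X. (\<exists>\<gamma>. minimizing_geodesic R x y \<gamma>) \<and>
        (\<forall>\<gamma>. minimizing_geodesic R x y \<gamma> \<longrightarrow> \<gamma> ` {0..1} \<subseteq> X))"

text \<open>The manifold need not be complete, so the exponential map has a domain.\<close>

definition exp_dom ::
  "('a::topological_space, 'e::euclidean_space) riemannian \<Rightarrow> 'a \<Rightarrow> ('a, 'e) tangent_vector set" where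
  "exp_dom R x = {v. \<exists>\<gamma>. geodesic R {0..1} \<gamma> \<and> \<gamma> 0 = x \<and> velocity R {0..1} \<gamma> 0 = v}"

definition rexp ::
  "('a::topological_space, 'e::euclidean_space) riemannian \<Rightarrow> 'a \<Rightarrow> ('a, 'e) tangent_vector \<Rightarrow> 'a" where
  "rexp R x v = (THE y. \<exists>\<gamma>. geodesic R {0..1} \<gamma> \<and> \<gamma> 0 = x \<and> velocity R {0..1} \<gamma> 0 = v \<and> \<gamma> 1 = y)"

text \<open>\<open>h\<close> restricts to a diffeomorphism from the open set \<open>S\<close> of the model space onto an open
  subset of the manifold.\<close>

definition diffeomorphic_onto_image ::
  "('a::topological_space, 'e::euclidean_space) riemannian \<Rightarrow> 'e set \<Rightarrow> ('e \<Rightarrow> 'a) \<Rightarrow> bool" where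
  "diffeomorphic_onto_image R S h \<longleftrightarrow>
     h ` S \<subseteq> manifold_carrier R \<and> open (h ` S) \<and> inj_on h S \<and> continuous_on S h \<and>
     (\<forall>c\<in>atlas R.
        smooth_on {a\<in>S. h a \<in> chart_dom c} (\<lambda>a. chart_map c (h a)) \<and>
        smooth_on (chart_map c ` (h ` S \<inter> chart_dom c)) (\<lambda>p. inv_into S h (chart_inv c p)))"

text \<open>The injectivity radius at \<open>x\<close> is the supremum of all \<open>r > 0\<close> such that the exponential map
  is defined and a diffeomorphism onto its image on the open ball of radius \<open>r\<close> in the tangent
  space, the latter being identified with the model space through a chart at \<open>x\<close>.\<close>

definition inj_radius ::
  "('a::topological_space, 'e::euclidean_space) riemannian \<Rightarrow> 'a \<Rightarrow> ereal" where
  "inj_radius R x = Sup {ereal r | r. 0 < r \<and>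
     (let c = chart_at R x; S = {a. rnorm R x (tangent_of R x c a) < r} in
        (\<forall>a\<in>S. tangent_of R x c a \<in> exp_dom R x) \<and>
        diffeomorphic_onto_image R S (\<lambda>a. rexp R x (tangent_of R x c a)))}"

text \<open>The inverse of the exponential map on the ball given by the injectivity radius.\<close>

definition rlog ::
  "('a::topological_space, 'e::euclidean_space) riemannian \<Rightarrow> 'a \<Rightarrow> 'a \<Rightarrow> ('a, 'e) tangent_vector" where
  "rlog R x y = (THE v. v \<in> exp_dom R x \<and> ereal (rnorm R x v) < inj_radius R x \<and> rexp R x v = y)"

text \<open>With \<open>\<Gamma>\<close> the Christoffel map, this is
  \<open>\<nabla>\<^sub>u \<nabla>\<^sub>v w - \<nabla>\<^sub>v \<nabla>\<^sub>u w\<close> for constant coordinate fields \<open>u, v, w\<close>.\<close>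

definition curvature ::
  "('a, 'e::euclidean_space) riemannian \<Rightarrow> ('a, 'e) chart \<Rightarrow> 'e \<Rightarrow> 'e \<Rightarrow> 'e \<Rightarrow> 'e \<Rightarrow> 'e" where
  "curvature R c p u v w =
     frechet_derivative (\<lambda>q. christoffel R c q v w) (at p) u
     - frechet_derivative (\<lambda>q. christoffel R c q u w) (at p) v
     + christoffel R c p u (christoffel R c p v w)
     - christoffel R c p v (christoffel R c p u w)"

definition sectional_curvature ::
  "('a, 'e::euclidean_space) riemannian \<Rightarrow> 'a \<Rightarrow> ('a, 'e) tangent_vector \<Rightarrow> ('a, 'e) tangent_vector \<Rightarrow> real" where
  "sectional_curvature R x u v =
     (let c = chart_at R x; p = chart_map c x in
        gram R c p (curvature R c p (u c) (v c) (v c)) (u c)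
        / (rinner R x u u * rinner R x v v - (rinner R x u v)\<^sup>2))"

text \<open>\<open>has_rgradient R X f x v\<close>: the tangent vector \<open>v\<close> at \<open>x\<close> is a Riemannian gradient of
  \<open>f : X \<rightarrow> \<real>\<close> at \<open>x\<close>. As with \<open>has_derivative\<close>, differentiation is within \<open>X\<close>, so that only
  the values of \<open>f\<close> on \<open>X\<close> matter. It is the ordinary gradient at interior points of \<open>X\<close>, and the
  ordinary gradient of any differentiable extension of \<open>f\<close> qualifies at the remaining points.\<close>

definition has_rgradient ::
  "('a, 'e::euclidean_space) riemannian \<Rightarrow> 'a set \<Rightarrow> ('a \<Rightarrow> real) \<Rightarrow> 'a \<Rightarrow> ('a, 'e) tangent_vector \<Rightarrow> bool" where
  "has_rgradient R X f x v \<longleftrightarrow> v \<in> tangent_space R x \<and>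
     (\<forall>c\<in>charts_at R x.
        ((\<lambda>p. f (chart_inv c p)) has_derivative (\<lambda>a. gram R c (chart_map c x) (v c) a))
          (at (chart_map c x) within chart_map c ` (X \<inter> chart_dom c)))"

definition is_frechet_mean ::
  "('a::topological_space, 'e::euclidean_space) riemannian \<Rightarrow> 'a set \<Rightarrow> ('n::finite \<Rightarrow> 'a) \<Rightarrow> 'a \<Rightarrow> bool" where
  "is_frechet_mean R X p z \<longleftrightarrow>
     is_arg_min (\<lambda>q. (\<Sum>i\<in>UNIV. (rdist R (p i) q)\<^sup>2) / real CARD('n)) (\<lambda>q. q \<in> X) z"


section \<open>The network\<close>

text \<open>Singular values are the square roots of the eigenvalues of \<open>W\<^sup>T W\<close>, counted with
  multiplicity (geometric, as this matrix is symmetric).\<close>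

definition gram_eigenspace :: "real ^ 'n ^ 'n \<Rightarrow> real \<Rightarrow> (real ^ 'n) set" where
  "gram_eigenspace W r = {v. (transpose W ** W) *v v = r\<^sup>2 *\<^sub>R v}"

definition singular_values :: "real ^ 'n ^ 'n \<Rightarrow> real multiset" where
  "singular_values W =
     (\<Sum>r\<in>{r. r \<ge> 0 \<and> (\<exists>v\<in>gram_eigenspace W r. v \<noteq> 0)}. replicate_mset (dim (gram_eigenspace W r)) r)"

text \<open>A \<open>1 \<times> 1\<close> matrix has no second singular value; the value is then \<open>0\<close> by convention.\<close>

definition sigma2 :: "real ^ 'n ^ 'n \<Rightarrow> real" where
  "sigma2 W = (if CARD('n) \<ge> 2
     then Max_mset (singular_values W - {# Max_mset (singular_values W) #}) else 0)"

definition network_assumption :: "('n \<Rightarrow> 'n \<Rightarrow> bool) \<Rightarrow> real ^ 'n ^ 'n \<Rightarrow> bool" where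
  "network_assumption E W \<longleftrightarrow>
     (\<forall>i j. E i j \<longrightarrow> E j i) \<and> (\<forall>i. \<not> E i i) \<and> (\<forall>i j. E\<^sup>*\<^sup>* i j) \<and>
     transpose W = W \<and>
     (\<forall>i. (\<Sum>j\<in>UNIV. W $ i $ j) = 1) \<and> (\<forall>j. (\<Sum>i\<in>UNIV. W $ i $ j) = 1) \<and>
     (\<forall>i j. W $ i $ j \<ge> 0) \<and> (\<forall>i. W $ i $ i > 0) \<and>
     (\<forall>i j. i \<noteq> j \<and> \<not> E i j \<longrightarrow> W $ i $ j = 0) \<and>
     (\<forall>i j. E i j \<longrightarrow> W $ i $ j > 0)"


section \<open>Standing assumptions and the algorithm\<close>

definition manifold_assumption ::
  "('a::topological_space, 'e::euclidean_space) riemannian \<Rightarrow> 'a set \<Rightarrow> real \<Rightarrow> real \<Rightarrow> real \<Rightarrow> bool" where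
  "manifold_assumption R X Kmin Kmax D \<longleftrightarrow>
     X \<subseteq> manifold_carrier R \<and> geodesically_convex R X \<and>
     (\<forall>x\<in>X. \<forall>u\<in>tangent_space R x. \<forall>v\<in>tangent_space R x.
        u \<noteq> v \<and> independent {u (chart_at R x), v (chart_at R x)} \<longrightarrow>
        Kmin \<le> sectional_curvature R x u v \<and> sectional_curvature R x u v \<le> Kmax) \<and>
     D > 0 \<and> (\<forall>x\<in>X. \<forall>y\<in>X. rdist R x y \<le> D) \<and>
     ereal D < (INF x\<in>X. inj_radius R x) \<and>
     (Kmax > 0 \<longrightarrow> D < pi / (2 * sqrt Kmax))"

definition comparison_constants ::
  "('a::topological_space, 'e::euclidean_space) riemannian \<Rightarrow> 'a set \<Rightarrow> real \<Rightarrow>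
   real \<Rightarrow> real \<Rightarrow> real \<Rightarrow> real \<Rightarrow> bool" where
  "comparison_constants R X D C1 C2 C3 C4 \<longleftrightarrow>
     C1 \<ge> 1 \<and> 0 < C2 \<and> C2 \<le> 1 \<and> C3 \<ge> 0 \<and> C4 \<ge> 0 \<and>
     (\<forall>a\<in>X. \<forall>b\<in>X. \<forall>c\<in>X.
        C2 * (rdist R b c)\<^sup>2 + (rdist R a b)\<^sup>2 - 2 * rinner R b (rlog R b a) (rlog R b c)
          \<le> (rdist R a c)\<^sup>2 \<and>
        (rdist R a c)\<^sup>2
          \<le> C1 * (rdist R b c)\<^sup>2 + (rdist R a b)\<^sup>2 - 2 * rinner R b (rlog R b a) (rlog R b c)) \<and>
     (\<forall>x\<in>X. \<forall>y\<in>X. \<forall>z\<in>X.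
        inverse (1 + C3 * D\<^sup>2) * rdist R y z \<le> rnorm R x (\<lambda>c. rlog R x y c - rlog R x z c) \<and>
        rnorm R x (\<lambda>c. rlog R x y c - rlog R x z c) \<le> (1 + C4 * D\<^sup>2) * rdist R y z)"

definition expected_objective ::
  "'a set \<Rightarrow> ('n \<Rightarrow> 'b measure) \<Rightarrow> ('n \<Rightarrow> 'a \<Rightarrow> 'b \<Rightarrow> real) \<Rightarrow> ('n \<Rightarrow> 'a \<Rightarrow> real) \<Rightarrow> bool" where
  "expected_objective X Dist F f \<longleftrightarrow>
     (\<forall>i. prob_space (Dist i) \<and>
        (\<forall>p\<in>X. integrable (Dist i) (F i p) \<and> f i p = (\<integral>\<xi>. F i p \<xi> \<partial>Dist i)))"

definition bounded_gradient_assumption ::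
  "('a::topological_space, 'e::euclidean_space) riemannian \<Rightarrow> 'a set \<Rightarrow> ('n \<Rightarrow> 'a \<Rightarrow> real) \<Rightarrow>
   ('n \<Rightarrow> 'a \<Rightarrow> ('a, 'e) tangent_vector) \<Rightarrow> real \<Rightarrow> bool" where
  "bounded_gradient_assumption R X f gradf \<delta> \<longleftrightarrow>
     \<delta> > 0 \<and>
     (\<forall>i. (\<forall>p\<in>X. has_rgradient R X (f i) p (gradf i p)) \<and>
        (\<forall>c\<in>atlas R. continuous_on (X \<inter> chart_dom c) (\<lambda>p. gradf i p c)) \<and>
        (\<forall>p\<in>X. rnorm R p (gradf i p) \<le> \<delta>))"

text \<open>The filtration generated by the iterates \<open>x i k\<close>, for all agents \<open>i\<close> and all
  \<open>k \<in> {1..t}\<close>.\<close>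

definition iterate_filtration ::
  "'w measure \<Rightarrow> ('n \<Rightarrow> nat \<Rightarrow> 'w \<Rightarrow> 'a::topological_space) \<Rightarrow> nat \<Rightarrow> 'w measure" where
  "iterate_filtration P x t =
     sigma (space P) {x i k -` A \<inter> space P | i k A. k \<in> {1..t} \<and> A \<in> sets borel}"

text \<open>Conditional expectations of random tangent vectors are taken componentwise in each chart.
  The base point \<open>x i t\<close> is measurable for the conditioning \<sigma>-algebra, so this does not
  depend on coordinates. A component need not be integrable, but under the almost sure bound \<open>G\<close>
  its absolute value is at most a finite function of the base point, so that the conditional
  expectations of its positive and negative parts, from which \<open>real_cond_exp\<close> is built, are almost
  surely finite.\<close>

definition unbiased_estimator_assumption ::
  "('a::topological_space, 'e::euclidean_space) riemannian \<Rightarrow> 'w measure \<Rightarrow>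
   ('n \<Rightarrow> nat \<Rightarrow> 'w \<Rightarrow> 'a) \<Rightarrow> ('n \<Rightarrow> 'a \<Rightarrow> ('a, 'e) tangent_vector) \<Rightarrow>
   ('n \<Rightarrow> nat \<Rightarrow> 'w \<Rightarrow> ('a, 'e) tangent_vector) \<Rightarrow> real \<Rightarrow> real \<Rightarrow> nat \<Rightarrow> bool" where
  "unbiased_estimator_assumption R P x gradf ghat \<sigma> G T \<longleftrightarrow>
     G > 0 \<and>
     (\<forall>i. \<forall>t\<in>{1..T}.
        (\<forall>\<omega>\<in>space P. ghat i t \<omega> \<in> tangent_space R (x i t \<omega>)) \<and>
        (\<forall>c\<in>atlas R. (\<lambda>\<omega>. ghat i t \<omega> c) \<in> borel_measurable P) \<and>
        (\<forall>c\<in>atlas R. \<forall>b\<in>Basis. AE \<omega> in P.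
           real_cond_exp P (iterate_filtration P x t) (\<lambda>\<omega>. ghat i t \<omega> c \<bullet> b) \<omega>
             = gradf i (x i t \<omega>) c \<bullet> b) \<and>
        (AE \<omega> in P.
           real_cond_exp P (iterate_filtration P x t)
             (\<lambda>\<omega>. (rnorm R (x i t \<omega>) (\<lambda>c. ghat i t \<omega> c - gradf i (x i t \<omega>) c))\<^sup>2) \<omega> \<le> \<sigma>\<^sup>2) \<and>
        (AE \<omega> in P. rnorm R (x i t \<omega>) (ghat i t \<omega>) \<le> G))"

definition decentralized_iterates ::
  "('a::topological_space, 'e::euclidean_space) riemannian \<Rightarrow> 'a set \<Rightarrow> 'w measure \<Rightarrow> real ^ 'n ^ 'n \<Rightarrow>
   real \<Rightarrow> (nat \<Rightarrow> real) \<Rightarrow> 'a \<Rightarrow> ('n \<Rightarrow> nat \<Rightarrow> 'w \<Rightarrow> ('a, 'e) tangent_vector) \<Rightarrow>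
   ('n \<Rightarrow> nat \<Rightarrow> 'w \<Rightarrow> 'a) \<Rightarrow> ('n \<Rightarrow> nat \<Rightarrow> 'w \<Rightarrow> 'a) \<Rightarrow> nat \<Rightarrow> bool" where
  "decentralized_iterates R X P W s \<eta> x1 ghat x y T \<longleftrightarrow>
     x1 \<in> X \<and>
     (\<forall>i. \<forall>t\<in>{1..T+1}. x i t \<in> measurable P borel) \<and>
     (\<forall>\<omega>\<in>space P. \<forall>i.
        x i 1 \<omega> = x1 \<and>
        (\<forall>t\<in>{1..T}.
           y i (t+1) \<omega> = rexp R (x i t \<omega>) (\<lambda>c. - \<eta> t *\<^sub>R ghat i t \<omega> c) \<and>
           x i (t+1) \<omega> = rexp R (y i (t+1) \<omega>)
             (\<lambda>c. s *\<^sub>R (\<Sum>j\<in>UNIV. W $ i $ j *\<^sub>R rlog R (y i (t+1) \<omega>) (y j (t+1) \<omega>) c)) \<and>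
           y i (t+1) \<omega> \<in> X \<and> x i (t+1) \<omega> \<in> X))"

definition frechet_means ::
  "('a::topological_space, 'e::euclidean_space) riemannian \<Rightarrow> 'a set \<Rightarrow> 'w measure \<Rightarrow>
   ('n::finite \<Rightarrow> nat \<Rightarrow> 'w \<Rightarrow> 'a) \<Rightarrow> (nat \<Rightarrow> 'w \<Rightarrow> 'a) \<Rightarrow> nat \<Rightarrow> bool" where
  "frechet_means R X P x xbar T \<longleftrightarrow>
     (\<forall>t\<in>{1..T+1}. \<forall>\<omega>\<in>space P. is_frechet_mean R X (\<lambda>i. x i t \<omega>) (xbar t \<omega>))"

end

theory Submission
  imports Defs
begin

text \<open>Write \<open>V t\<close> for the expected sum of squared distances of the agents to their mean at time \<open>t\<close>,
  \<open>d\<close> for the distance, and \<open>n\<close> for the number of agents. The bound follows from the recursion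
  \<open>V (t + 1) \<le> (1 - \<xi>\<^sup>2) * V t + \<eta>0\<^sup>2 * n * B / t\<close> with \<open>V 1 = 0\<close>: its solutions decay like \<open>1 / t\<close> because
  the contraction beats the slow decay of the forcing term.

  Each step of the recursion has two halves. In the consensus half the agents move from \<open>y\<close> to \<open>x\<close>. For
  any point \<open>z\<close>, the two comparison inequalities at the vertices \<open>y i\<close>, summed with the doubly stochastic
  weights, show that the spread around \<open>z\<close> drops by a multiple of the weighted disagreement
  \<open>\<Sum>i j. W i j * d (y i) (y j)\<^sup>2\<close>. If \<open>z\<close> almost minimizes the spread of \<open>y\<close>, the logarithms of the agents
  at \<open>z\<close> almost sum to zero, and the spectral gap of \<open>W\<close> in the tangent space at \<open>z\<close> bounds the
  disagreement from below by a multiple of the spread. This gives a contraction by \<open>1 - \<xi>\<close>. In the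
  gradient half, the upper comparison inequality at \<open>x i\<close> against the old mean produces a quadratic term,
  controlled by the second moment of the estimator, and a linear term, in which the estimator may be
  replaced by the gradient since the logarithm of the mean is known at time \<open>t\<close>. Young's inequality turns
  the linear term into a factor \<open>1 + \<xi>\<close> and a constant.

  Two kinds of groundwork enter. First, logarithms have to be what their name says: the initial velocity
  of a minimizing geodesic is the logarithm of the end point and has length \<open>d\<close>. This rests on the
  uniqueness of geodesics (\<open>geodesic_unique\<close>), a Gronwall argument in charts, on their constant
  speed, and on the bound of all distances by less than the injectivity radius. Secondly, the mean and
  its logarithms have to be measurable with respect to the past. Here a lower comparison inequality yields
  strong convexity of the dispersion at a mean, hence continuous dependence of the mean on the
  configuration (\<open>barycenter_continuous\<close>). Points on geodesics are weighted means of the end points,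
  so they depend continuously on them as well, and logarithms are limits of difference quotients
  along such geodesics (\<open>rlog_measurable\<close>).\<close>

section \<open>Calculus in charts\<close>

text \<open>Gronwall's inequality in the two-sided form needed for uniqueness of solutions: after
  multiplication by \<open>exp (- K * t)\<close> the function decreases to the right of \<open>t0\<close>, and after
  multiplication by \<open>exp (K * t)\<close> it increases to the left of \<open>t0\<close>.\<close>

lemma Gronwall_zero:
  fixes \<phi> :: "real \<Rightarrow> real"
  assumes der: "\<And>t. t \<in> {a..b} \<Longrightarrow> (\<phi> has_real_derivative \<phi>' t) (at t within {a..b})"
    and bd: "\<And>t. t \<in> {a..b} \<Longrightarrow> \<bar>\<phi>' t\<bar> \<le> K * \<phi> t"
    and t0: "t0 \<in> {a..b}" "\<phi> t0 = 0" and t: "t \<in> {a..b}"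
  shows "\<phi> t \<le> 0"
proof -
  have weighted: "((\<lambda>s. \<phi> s * exp (k * s)) has_derivative (\<lambda>h. h * ((\<phi>' u + k * \<phi> u) * exp (k * u))))
      (at u within {c..d})" if "u \<in> {c..d}" "{c..d} \<subseteq> {a..b}" for u c d k
  proof -
    have "(\<phi> has_real_derivative \<phi>' u) (at u within {c..d})"
      using that by (meson der has_field_derivative_subset subsetD)
    then have "((\<lambda>s. \<phi> s * exp (k * s)) has_real_derivative ((\<phi>' u + k * \<phi> u) * exp (k * u)))
        (at u within {c..d})"
      by (auto intro!: derivative_eq_intros simp: algebra_simps)
    then show ?thesis
      by (simp add: has_field_derivative_def mult_commute_abs)
  qed
  show ?thesis
  proof (cases "t0 \<le> t")
    case True
    then have sub: "{t0..t} \<subseteq> {a..b}"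
      using t0 t by auto
    have "\<exists>u\<in>{t0..t}. \<phi> t * exp (- K * t) - \<phi> t0 * exp (- K * t0)
        = (t - t0) * ((\<phi>' u + - K * \<phi> u) * exp (- K * u))"
      by (rule mvt_very_simple[OF True, where f = "\<lambda>s. \<phi> s * exp (- K * s)"])
         (rule weighted[OF _ sub], simp)
    then obtain u where u: "u \<in> {t0..t}"
      "\<phi> t * exp (- K * t) - \<phi> t0 * exp (- K * t0) = (t - t0) * ((\<phi>' u + - K * \<phi> u) * exp (- K * u))"
      by blast
    have "\<phi>' u + - K * \<phi> u \<le> 0"
      using bd[of u] u(1) sub by auto
    then have "(t - t0) * ((\<phi>' u + - K * \<phi> u) * exp (- K * u)) \<le> 0"
      using True by (intro mult_nonneg_nonpos mult_nonpos_nonneg) auto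
    then have "\<phi> t * exp (- K * t) \<le> 0"
      using u(2) t0(2) by simp
    then show ?thesis
      by (simp add: mult_le_0_iff)
  next
    case False
    then have le: "t \<le> t0" and sub: "{t..t0} \<subseteq> {a..b}"
      using t0 t by auto
    have "\<exists>u\<in>{t..t0}. \<phi> t0 * exp (K * t0) - \<phi> t * exp (K * t)
        = (t0 - t) * ((\<phi>' u + K * \<phi> u) * exp (K * u))"
      by (rule mvt_very_simple[OF le, where f = "\<lambda>s. \<phi> s * exp (K * s)"])
         (rule weighted[OF _ sub], simp)
    then obtain u where u: "u \<in> {t..t0}"
      "\<phi> t0 * exp (K * t0) - \<phi> t * exp (K * t) = (t0 - t) * ((\<phi>' u + K * \<phi> u) * exp (K * u))"
      by blast
    have "0 \<le> \<phi>' u + K * \<phi> u"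
      using bd[of u] u(1) sub by auto
    then have "0 \<le> (t0 - t) * ((\<phi>' u + K * \<phi> u) * exp (K * u))"
      using le by (intro mult_nonneg_nonneg) auto
    then have "\<phi> t * exp (K * t) \<le> 0"
      using u(2) t0(2) by simp
    then show ?thesis
      by (simp add: mult_le_0_iff)
  qed
qed

lemma smooth_on_Ck: "smooth_on S f \<Longrightarrow> Ck_on k S f"
  by (simp add: smooth_on_def)

lemma smooth_on_continuous: "smooth_on S f \<Longrightarrow> continuous_on S f"
  using smooth_on_Ck[of S f 0] by simp

lemma smooth_on_frechet_derivative:
  "smooth_on S f \<Longrightarrow> smooth_on S (\<lambda>x. frechet_derivative f (at x) v)"
  unfolding smooth_on_def by (metis Ck_on.simps(2))

lemma smooth_on_has_derivative:
  assumes "smooth_on S f" "open S" "x \<in> S"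
  shows "(f has_derivative frechet_derivative f (at x)) (at x)"
  using smooth_on_Ck[OF assms(1), of 1] assms(2,3)
  by (metis Ck_on.simps(2) One_nat_def at_within_open differentiable_on_def frechet_derivative_works)

lemma C1_Lipschitz_on_cball:
  fixes f :: "'e::euclidean_space \<Rightarrow> real"
  assumes f: "smooth_on U f" and U: "open U" and sub: "cball p r \<subseteq> U"
  shows "\<exists>L\<ge>0. \<forall>x\<in>cball p r. \<forall>y\<in>cball p r. \<bar>f x - f y\<bar> \<le> L * norm (x - y)"
proof -
  have "\<exists>M. \<forall>x\<in>cball p r. \<bar>frechet_derivative f (at x) b\<bar> \<le> M" for b
  proof -
    have "continuous_on (cball p r) (\<lambda>x. frechet_derivative f (at x) b)"
      using smooth_on_continuous[OF smooth_on_frechet_derivative[OF f]] sub continuous_on_subset by blast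
    then have "bounded ((\<lambda>x. frechet_derivative f (at x) b) ` cball p r)"
      by (intro compact_imp_bounded compact_continuous_image) auto
    then show ?thesis
      by (auto simp: bounded_iff)
  qed
  then obtain M where M: "\<And>b x. x \<in> cball p r \<Longrightarrow> \<bar>frechet_derivative f (at x) b\<bar> \<le> M b"
    by metis
  define L where "L = (\<Sum>b\<in>Basis. \<bar>M b\<bar>)"
  have "\<bar>f x - f y\<bar> \<le> L * norm (x - y)" if xy: "x \<in> cball p r" "y \<in> cball p r" for x y
  proof -
    have der: "(f has_derivative frechet_derivative f (at z)) (at z within cball p r)" if "z \<in> cball p r" for z
      using smooth_on_has_derivative[OF f U] sub that has_derivative_at_withinI by blast
    have bd: "onorm (frechet_derivative f (at z)) \<le> L" if z: "z \<in> cball p r" for z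
    proof (rule onorm_le)
      fix h :: 'e
      have lin: "linear (frechet_derivative f (at z))"
        using der[OF z] has_derivative_linear by blast
      have "frechet_derivative f (at z) h = (\<Sum>b\<in>Basis. (h \<bullet> b) * frechet_derivative f (at z) b)"
        by (subst euclidean_representation[symmetric, of h])
           (simp only: linear_sum[OF lin] linear_scale[OF lin] real_scaleR_def)
      also have "\<bar>\<dots>\<bar> \<le> (\<Sum>b\<in>Basis. norm h * \<bar>M b\<bar>)"
      proof (intro order_trans[OF sum_abs] sum_mono)
        fix b :: 'e assume b: "b \<in> Basis"
        have "\<bar>frechet_derivative f (at z) b\<bar> \<le> \<bar>M b\<bar>"
          using M[OF z, of b] by linarith
        then show "\<bar>h \<bullet> b * frechet_derivative f (at z) b\<bar> \<le> norm h * \<bar>M b\<bar>"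
          unfolding abs_mult using Basis_le_norm[OF b, of h] by (intro mult_mono) auto
      qed
      finally show "norm (frechet_derivative f (at z) h) \<le> L * norm h"
        by (simp add: L_def sum_distrib_left[symmetric] mult.commute)
    qed
    show ?thesis
      using differentiable_bound[OF convex_cball der bd xy] by (simp add: norm_minus_commute)
  qed
  moreover have "L \<ge> 0"
    by (simp add: L_def sum_nonneg)
  ultimately show ?thesis
    by blast
qed

text \<open>A family of multilinear forms that depends smoothly on a point is a finite sum of smooth
  coefficient functions of the point times products of coordinates of the arguments. Bounds for the
  coefficients therefore give bounds and Lipschitz estimates that are uniform in the arguments.
  The argument tuple is \<open>z\<close>, and \<open>N z\<close> plays the role of the product of its norms.\<close>

lemma expansion_Lipschitz_on_cball:
  fixes T :: "'e::euclidean_space \<Rightarrow> 'z \<Rightarrow> real"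
  assumes I: "finite I" and f: "\<And>i. i \<in> I \<Longrightarrow> smooth_on U (f i)"
    and U: "open U" and sub: "cball p r \<subseteq> U"
    and T: "\<And>q z. q \<in> U \<Longrightarrow> T q z = (\<Sum>i\<in>I. \<kappa> i z * f i q)"
    and \<kappa>: "\<And>i z. i \<in> I \<Longrightarrow> \<bar>\<kappa> i z\<bar> \<le> N z"
  shows "\<exists>L\<ge>0. \<forall>q\<in>cball p r. \<forall>z. \<bar>T q z\<bar> \<le> L * N z \<and>
    (\<forall>q'\<in>cball p r. \<bar>T q z - T q' z\<bar> \<le> L * norm (q - q') * N z)"
proof -
  have "\<forall>i\<in>I. \<exists>L\<ge>0. \<forall>x\<in>cball p r. \<bar>f i x\<bar> \<le> L \<and> (\<forall>y\<in>cball p r. \<bar>f i x - f i y\<bar> \<le> L * norm (x - y))"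
  proof
    fix i assume i: "i \<in> I"
    obtain L where L: "L \<ge> 0" "\<forall>x\<in>cball p r. \<forall>y\<in>cball p r. \<bar>f i x - f i y\<bar> \<le> L * norm (x - y)"
      using C1_Lipschitz_on_cball[OF f[OF i] U sub] by blast
    have "continuous_on (cball p r) (f i)"
      using smooth_on_continuous[OF f[OF i]] sub continuous_on_subset by blast
    then have "bounded (f i ` cball p r)"
      by (intro compact_imp_bounded compact_continuous_image) auto
    then obtain M where M: "\<forall>x\<in>cball p r. \<bar>f i x\<bar> \<le> M"
      by (auto simp: bounded_iff)
    have "\<bar>f i x - f i y\<bar> \<le> max L M * norm (x - y)" if "x \<in> cball p r" "y \<in> cball p r" for x y
      using L(2) that by (meson max.cobounded1 mult_right_mono norm_ge_zero order_trans)
    moreover have "\<bar>f i x\<bar> \<le> max L M" if "x \<in> cball p r" for x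
      using M that by (meson max.cobounded2 order_trans)
    ultimately show "\<exists>L\<ge>0. \<forall>x\<in>cball p r. \<bar>f i x\<bar> \<le> L \<and> (\<forall>y\<in>cball p r. \<bar>f i x - f i y\<bar> \<le> L * norm (x - y))"
      using L(1) by (intro exI[of _ "max L M"]) auto
  qed
  then obtain L where L: "\<And>i. i \<in> I \<Longrightarrow> L i \<ge> 0"
    "\<And>i x. i \<in> I \<Longrightarrow> x \<in> cball p r \<Longrightarrow> \<bar>f i x\<bar> \<le> L i"
    "\<And>i x y. i \<in> I \<Longrightarrow> x \<in> cball p r \<Longrightarrow> y \<in> cball p r \<Longrightarrow> \<bar>f i x - f i y\<bar> \<le> L i * norm (x - y)"
    by metis
  have Nn: "N z \<ge> 0" if "i \<in> I" for i z
    using \<kappa>[OF that, of z] by linarith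
  have bound: "\<bar>T q z\<bar> \<le> (\<Sum>i\<in>I. L i) * N z" if q: "q \<in> cball p r" for q z
  proof -
    have "T q z = (\<Sum>i\<in>I. \<kappa> i z * f i q)"
      using T sub q by blast
    then have "\<bar>T q z\<bar> \<le> (\<Sum>i\<in>I. \<bar>\<kappa> i z * f i q\<bar>)"
      by (simp only: sum_abs)
    also have "\<dots> \<le> (\<Sum>i\<in>I. N z * L i)"
      unfolding abs_mult using \<kappa> L(2)[OF _ q] Nn by (intro sum_mono mult_mono) auto
    finally show ?thesis
      by (simp add: sum_distrib_right mult.commute[of "N z"])
  qed
  have lip: "\<bar>T q z - T q' z\<bar> \<le> (\<Sum>i\<in>I. L i) * norm (q - q') * N z"
    if q: "q \<in> cball p r" and q': "q' \<in> cball p r" for q q' z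
  proof -
    have "T q z - T q' z = (\<Sum>i\<in>I. \<kappa> i z * (f i q - f i q'))"
      using T sub q q' by (simp add: subset_iff sum_subtractf right_diff_distrib)
    then have "\<bar>T q z - T q' z\<bar> \<le> (\<Sum>i\<in>I. \<bar>\<kappa> i z * (f i q - f i q')\<bar>)"
      by (simp only: sum_abs)
    also have "\<dots> \<le> (\<Sum>i\<in>I. N z * (L i * norm (q - q')))"
      unfolding abs_mult using \<kappa> L(3)[OF _ q q'] Nn by (intro sum_mono mult_mono) auto
    finally show ?thesis
      by (simp add: sum_distrib_right sum_distrib_left algebra_simps)
  qed
  show ?thesis
    using bound lip L(1) by (intro exI[of _ "\<Sum>i\<in>I. L i"]) (auto intro: sum_nonneg)
qed

lemma linear_Basis_expansion:
  fixes f :: "'e::euclidean_space \<Rightarrow> real"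
  assumes "linear f"
  shows "f u = (\<Sum>b\<in>Basis. (u \<bullet> b) * f b)"
  by (subst euclidean_representation[symmetric, of u])
     (simp only: linear_sum[OF assms] linear_scale[OF assms] real_scaleR_def)

section \<open>The metric in a chart\<close>

definition chart_image :: "('a, 'e) chart \<Rightarrow> 'e set" where
  "chart_image c = chart_map c ` chart_dom c"

text \<open>The right-hand side of the Koszul formula, which determines the Christoffel map.\<close>

definition koszul ::
  "('a, 'e::euclidean_space) riemannian \<Rightarrow> ('a, 'e) chart \<Rightarrow> 'e \<Rightarrow> 'e \<Rightarrow> 'e \<Rightarrow> 'e \<Rightarrow> real" where
  "koszul R c p u v w =
     (frechet_derivative (\<lambda>q. gram R c q v w) (at p) u
      + frechet_derivative (\<lambda>q. gram R c q u w) (at p) v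
      - frechet_derivative (\<lambda>q. gram R c q u v) (at p) w) / 2"

locale riemannian =
  fixes R :: "('a::{second_countable_topology, t2_space}, 'e::euclidean_space) riemannian"
  assumes riem: "riemannian_manifold R"
begin

abbreviation Dgram :: "('a, 'e) chart \<Rightarrow> 'e \<Rightarrow> 'e \<Rightarrow> 'e \<Rightarrow> 'e \<Rightarrow> real" where
  "Dgram c p u v h \<equiv> frechet_derivative (\<lambda>q. gram R c q u v) (at p) h"

lemma open_chart_dom: "c \<in> atlas R \<Longrightarrow> open (chart_dom c)"
  and open_chart_image: "c \<in> atlas R \<Longrightarrow> open (chart_image c)"
  and chart_homeomorphism:
    "c \<in> atlas R \<Longrightarrow> homeomorphism (chart_dom c) (chart_image c) (chart_map c) (chart_inv c)"
  using riem unfolding riemannian_manifold_def chart_image_def by auto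

lemma chart_map_in: "x \<in> chart_dom c \<Longrightarrow> chart_map c x \<in> chart_image c"
  by (simp add: chart_image_def)

lemma chart_inv_map: "c \<in> atlas R \<Longrightarrow> x \<in> chart_dom c \<Longrightarrow> chart_inv c (chart_map c x) = x"
  by (rule homeomorphism_apply1[OF chart_homeomorphism])

lemma chart_map_inj: "c \<in> atlas R \<Longrightarrow> x \<in> chart_dom c \<Longrightarrow> y \<in> chart_dom c \<Longrightarrow>
   chart_map c x = chart_map c y \<Longrightarrow> x = y"
  using chart_inv_map by metis

lemma continuous_chart_map: "c \<in> atlas R \<Longrightarrow> continuous_on (chart_dom c) (chart_map c)"
  using chart_homeomorphism homeomorphism_def by blast

lemma continuous_chart_inv: "c \<in> atlas R \<Longrightarrow> continuous_on (chart_image c) (chart_inv c)"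
  using chart_homeomorphism homeomorphism_def by blast

lemma open_chart_map_image:
  assumes c: "c \<in> atlas R" and S: "open S"
  shows "open (chart_map c ` (chart_dom c \<inter> S))"
proof -
  have "chart_map c ` (chart_dom c \<inter> S) = chart_inv c -` S \<inter> chart_image c"
    using chart_inv_map[OF c] by (auto simp: chart_image_def)
  then show ?thesis
    using continuous_open_preimage[OF continuous_chart_inv[OF c] open_chart_image[OF c] S]
    by (simp add: Int_commute)
qed

lemma smooth_gram: "c \<in> atlas R \<Longrightarrow> smooth_on (chart_image c) (\<lambda>p. gram R c p u v)"
  using riem unfolding riemannian_manifold_def chart_image_def by blast

context
  fixes c p
  assumes c: "c \<in> atlas R" and p: "p \<in> chart_image c"
begin

lemma bilinear_gram: "bilinear (gram R c p)"
  and gram_sym: "gram R c p u v = gram R c p v u"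
  and gram_pos: "u \<noteq> 0 \<Longrightarrow> gram R c p u u > 0"
  using riem c p unfolding riemannian_manifold_def chart_image_def by blast+

lemma linear_gram_left: "linear (\<lambda>u. gram R c p u v)"
  and linear_gram_right: "linear (gram R c p u)"
  using bilinear_gram by (auto simp: bilinear_def)

lemma gram_nonneg: "gram R c p u u \<ge> 0"
  using gram_pos[of u] linear_0[OF linear_gram_left] by (cases "u = 0") (auto simp: less_imp_le)

lemmas gram_simps =
  linear_add[OF linear_gram_left] linear_add[OF linear_gram_right]
  linear_diff[OF linear_gram_left] linear_diff[OF linear_gram_right]
  linear_cmul[OF linear_gram_left] linear_cmul[OF linear_gram_right]
  linear_0[OF linear_gram_left] linear_0[OF linear_gram_right]
  linear_neg[OF linear_gram_left] linear_neg[OF linear_gram_right]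

lemma gram_eqI:
  assumes "\<And>w. gram R c p z w = gram R c p z' w"
  shows "z = z'"
proof (rule ccontr)
  assume "z \<noteq> z'"
  then have "gram R c p (z - z') (z - z') > 0"
    by (simp add: gram_pos)
  then show False
    using assms[of "z - z'"] by (simp add: gram_simps)
qed

text \<open>The matrix of a positive definite form is injective, hence surjective.\<close>

lemma gram_Riesz:
  assumes "linear \<phi>"
  shows "\<exists>z. \<forall>w. gram R c p z w = \<phi> w"
proof -
  define A where "A z = (\<Sum>b\<in>Basis. gram R c p z b *\<^sub>R b)" for z
  have A: "A z \<bullet> b = gram R c p z b" if "b \<in> Basis" for z b
    using that by (simp add: A_def inner_sum_left inner_Basis if_distrib sum.delta cong: if_cong)
  have "linear A"
    unfolding A_def by (rule linearI) (simp_all add: gram_simps scaleR_add_left sum.distrib scaleR_sum_right)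
  moreover have "inj A"
  proof (rule injI)
    fix z z' assume "A z = A z'"
    then have "gram R c p z b = gram R c p z' b" if "b \<in> Basis" for b
      using A[OF that] by metis
    then have "gram R c p z w = gram R c p z' w" for w
      by (simp add: linear_Basis_expansion[OF linear_gram_right, where u = w])
    then show "z = z'"
      by (rule gram_eqI)
  qed
  ultimately have "surj A"
    by (rule linear_inj_imp_surj)
  then obtain z where z: "A z = (\<Sum>b\<in>Basis. \<phi> b *\<^sub>R b)"
    by (metis surjD)
  have "gram R c p z b = \<phi> b" if "b \<in> Basis" for b
    using A[OF that, of z] that unfolding z
    by (simp add: inner_sum_left inner_Basis if_distrib sum.delta cong: if_cong)
  then have "gram R c p z w = \<phi> w" for w
    by (simp add: linear_Basis_expansion[OF linear_gram_right, where u = w]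
        linear_Basis_expansion[OF assms, where u = w])
  then show ?thesis
    by blast
qed

lemma gram_has_derivative: "((\<lambda>q. gram R c q u v) has_derivative Dgram c p u v) (at p)"
  using smooth_on_has_derivative[OF smooth_gram[OF c] open_chart_image[OF c] p] .

lemma linear_Dgram_direction: "linear (Dgram c p u v)"
  using gram_has_derivative has_derivative_linear by blast

end

text \<open>Linearity and symmetry of the derivative of the metric in its two arguments are inherited from
  the metric by uniqueness of derivatives; the identities hold on the chart image only, which is
  open.\<close>

lemma Dgram_eqI:
  assumes c: "c \<in> atlas R" and p: "p \<in> chart_image c"
    and eq: "\<And>q. q \<in> chart_image c \<Longrightarrow> gram R c q u v = f q" and f: "(f has_derivative f') (at p)"
  shows "Dgram c p u v h = f' h"
proof -
  have "((\<lambda>q. gram R c q u v) has_derivative f') (at p)"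
    using has_derivative_transform_within_open[OF f open_chart_image[OF c] p] eq by metis
  then show ?thesis
    by (metis frechet_derivative_at)
qed

context
  fixes c p
  assumes c: "c \<in> atlas R" and p: "p \<in> chart_image c"
begin

lemma linear_Dgram_left: "linear (\<lambda>u. Dgram c p u v h)"
proof (rule linearI)
  fix u u' :: 'e and r :: real
  show "Dgram c p (u + u') v h = Dgram c p u v h + Dgram c p u' v h"
    by (rule Dgram_eqI[OF c p]) (auto intro!: derivative_intros gram_has_derivative[OF c p] simp: gram_simps[OF c])
  show "Dgram c p (r *\<^sub>R u) v h = r *\<^sub>R Dgram c p u v h"
    by (rule Dgram_eqI[OF c p, where f' = "\<lambda>h. r *\<^sub>R Dgram c p u v h"])
       (auto intro!: derivative_eq_intros gram_has_derivative[OF c p] simp: gram_simps[OF c])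
qed

lemma Dgram_sym: "Dgram c p u v h = Dgram c p v u h"
  by (rule Dgram_eqI[OF c p gram_sym[OF c] gram_has_derivative[OF c p]])

lemma linear_Dgram_right: "linear (\<lambda>v. Dgram c p u v h)"
  by (subst Dgram_sym) (rule linear_Dgram_left)

lemma linear_koszul: "linear (\<lambda>u. koszul R c p u v w)" "linear (\<lambda>v. koszul R c p u v w)" "linear (koszul R c p u v)"
  unfolding koszul_def
  by (rule linearI; simp add: linear_add[OF linear_Dgram_left] linear_add[OF linear_Dgram_right]
      linear_add[OF linear_Dgram_direction[OF c p]] linear_cmul[OF linear_Dgram_left]
      linear_cmul[OF linear_Dgram_right] linear_cmul[OF linear_Dgram_direction[OF c p]]
      field_simps)+

text \<open>The unique existence behind the definite description in the definition of the Christoffel map.\<close>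

lemma gram_christoffel: "gram R c p (christoffel R c p u v) w = koszul R c p u v w"
proof -
  obtain z where z: "\<forall>w. gram R c p z w = koszul R c p u v w"
    using gram_Riesz[OF c p linear_koszul(3)] by blast
  have "(THE z. \<forall>w. gram R c p z w = koszul R c p u v w) = z"
    using z by (intro the_equality gram_eqI[OF c p]) simp_all
  then have "christoffel R c p u v = z"
    unfolding christoffel_def koszul_def .
  then show ?thesis
    using z by simp
qed

lemma christoffel_scale: "christoffel R c p (r *\<^sub>R u) (r *\<^sub>R u) = (r * r) *\<^sub>R christoffel R c p u u"
  by (rule gram_eqI[OF c p])
     (simp add: gram_christoffel gram_simps[OF c p] linear_cmul[OF linear_koszul(1)] linear_cmul[OF linear_koszul(2)])

end

end


context riemannian begin

section \<open>Tangent vectors\<close>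

lemma charts_at_iff: "c \<in> charts_at R x \<longleftrightarrow> c \<in> atlas R \<and> x \<in> chart_dom c"
  by (simp add: charts_at_def)

lemma chart_at_in: "x \<in> manifold_carrier R \<Longrightarrow> chart_at R x \<in> charts_at R x"
  unfolding chart_at_def by (rule someI_ex) (auto simp: manifold_carrier_def charts_at_iff)

lemma chart_at_props:
  assumes "x \<in> manifold_carrier R"
  shows "chart_at R x \<in> atlas R" "x \<in> chart_dom (chart_at R x)"
    "chart_map (chart_at R x) x \<in> chart_image (chart_at R x)"
  using chart_at_in[OF assms] chart_map_in[of x "chart_at R x"] by (simp_all add: charts_at_iff)

lemma charts_at_image: "c \<in> charts_at R x \<Longrightarrow> chart_map c x \<in> chart_image c"
  using chart_map_in[of x c] by (simp add: charts_at_iff)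

lemma transition_has_derivative:
  assumes "c \<in> charts_at R x" "c' \<in> charts_at R x"
  shows "(transition c c' has_derivative frechet_derivative (transition c c') (at (chart_map c x))) (at (chart_map c x))"
proof (rule smooth_on_has_derivative)
  show "smooth_on (chart_map c ` (chart_dom c \<inter> chart_dom c')) (transition c c')"
    using riem assms unfolding riemannian_manifold_def charts_at_iff by blast
  show "open (chart_map c ` (chart_dom c \<inter> chart_dom c'))"
    using assms open_chart_map_image open_chart_dom by (auto simp: charts_at_iff)
qed (use assms in \<open>auto simp: charts_at_iff\<close>)

lemma linear_transition_derivative:
  "c \<in> charts_at R x \<Longrightarrow> c' \<in> charts_at R x \<Longrightarrow> linear (frechet_derivative (transition c c') (at (chart_map c x)))"
  using transition_has_derivative has_derivative_linear by blast

lemma tangent_spaceI: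
  assumes "\<And>c. c \<notin> charts_at R x \<Longrightarrow> v c = 0"
    and "\<And>c c'. c \<in> charts_at R x \<Longrightarrow> c' \<in> charts_at R x \<Longrightarrow>
      v c' = frechet_derivative (transition c c') (at (chart_map c x)) (v c)"
  shows "v \<in> tangent_space R x"
  using assms unfolding tangent_space_def by blast

lemma tangent_space_off_chart: "v \<in> tangent_space R x \<Longrightarrow> c \<notin> charts_at R x \<Longrightarrow> v c = 0"
  unfolding tangent_space_def by blast

lemma tangent_space_transition:
  "v \<in> tangent_space R x \<Longrightarrow> c \<in> charts_at R x \<Longrightarrow> c' \<in> charts_at R x \<Longrightarrow>
    frechet_derivative (transition c c') (at (chart_map c x)) (v c) = v c'"
  unfolding tangent_space_def by (rule sym) blast

lemma tangent_space_zero: "(\<lambda>c. 0) \<in> tangent_space R x"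
  by (rule tangent_spaceI) (simp_all only: linear_0[OF linear_transition_derivative])

lemma tangent_space_scale:
  assumes "v \<in> tangent_space R x"
  shows "(\<lambda>c. r *\<^sub>R v c) \<in> tangent_space R x"
  by (rule tangent_spaceI)
     (simp_all add: linear_cmul[OF linear_transition_derivative] tangent_space_transition[OF assms]
       tangent_space_off_chart[OF assms])

lemma tangent_space_add:
  assumes "v \<in> tangent_space R x" "w \<in> tangent_space R x"
  shows "(\<lambda>c. v c + w c) \<in> tangent_space R x"
  by (rule tangent_spaceI)
     (simp_all add: linear_add[OF linear_transition_derivative] tangent_space_transition[OF assms(1)]
       tangent_space_transition[OF assms(2)] tangent_space_off_chart[OF assms(1)]
       tangent_space_off_chart[OF assms(2)])

lemma tangent_space_diff:
  assumes "v \<in> tangent_space R x" "w \<in> tangent_space R x"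
  shows "(\<lambda>c. v c - w c) \<in> tangent_space R x"
  using tangent_space_add[OF assms(1) tangent_space_scale[OF assms(2), of "- 1"]] by simp

lemma tangent_space_sum:
  "(\<And>i. i \<in> I \<Longrightarrow> v i \<in> tangent_space R x) \<Longrightarrow> (\<lambda>c. \<Sum>i\<in>I. v i c) \<in> tangent_space R x"
  by (induction I rule: infinite_finite_induct)
     (simp_all add: tangent_space_zero tangent_space_add)

lemma tangent_of_component:
  "v \<in> tangent_space R x \<Longrightarrow> c \<in> charts_at R x \<Longrightarrow> tangent_of R x c (v c) = v"
  by (rule ext) (simp add: tangent_of_def tangent_space_transition tangent_space_off_chart)

lemma tangent_vector_eqI:
  "v \<in> tangent_space R x \<Longrightarrow> w \<in> tangent_space R x \<Longrightarrow> c \<in> charts_at R x \<Longrightarrow> v c = w c \<Longrightarrow> v = w"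
  by (metis tangent_of_component)

lemma tangent_of_self:
  assumes "c \<in> charts_at R x"
  shows "tangent_of R x c a c = a"
proof -
  have c: "c \<in> atlas R" "x \<in> chart_dom c"
    using assms by (auto simp: charts_at_iff)
  have "(transition c c has_derivative (\<lambda>h. h)) (at (chart_map c x))"
    by (rule has_derivative_transform_within_open[OF has_derivative_ident open_chart_image[OF c(1)] chart_map_in[OF c(2)]])
       (auto simp: transition_def chart_image_def chart_inv_map[OF c(1)])
  then have "frechet_derivative (transition c c) (at (chart_map c x)) = (\<lambda>h. h)"
    by (metis frechet_derivative_at)
  then show ?thesis
    using assms by (simp add: tangent_of_def)
qed

text \<open>Transition maps are isometries, so any chart may replace the chosen one.\<close>

lemma rinner_chart:
  assumes u: "u \<in> tangent_space R x" and v: "v \<in> tangent_space R x" and c: "c \<in> charts_at R x"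
  shows "rinner R x u v = gram R c (chart_map c x) (u c) (v c)"
proof -
  have x: "chart_at R x \<in> charts_at R x"
    using c chart_at_in by (auto simp: charts_at_iff manifold_carrier_def)
  define c' where "c' = chart_at R x"
  have c': "c' \<in> charts_at R x"
    using x by (simp add: c'_def)
  have "gram R c (chart_map c x) (u c) (v c) = gram R c' (chart_map c' x)
      (frechet_derivative (transition c c') (at (chart_map c x)) (u c))
      (frechet_derivative (transition c c') (at (chart_map c x)) (v c))"
    using riem c c' unfolding riemannian_manifold_def charts_at_iff by blast
  moreover have "u c' = frechet_derivative (transition c c') (at (chart_map c x)) (u c)"
    "v c' = frechet_derivative (transition c c') (at (chart_map c x)) (v c)"
    using tangent_space_transition[OF u c c'] tangent_space_transition[OF v c c'] by simp_all
  ultimately show ?thesis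
    by (simp add: rinner_def Let_def c'_def)
qed

context
  fixes x
  assumes x: "x \<in> manifold_carrier R"
begin

lemmas gram_simps_at = gram_simps[OF chart_at_props(1)[OF x] chart_at_props(3)[OF x]]

lemma rinner_sym: "rinner R x u v = rinner R x v u"
  using gram_sym[OF chart_at_props(1)[OF x] chart_at_props(3)[OF x]] by (simp add: rinner_def Let_def)

lemma rinner_nonneg: "rinner R x u u \<ge> 0"
  using gram_nonneg[OF chart_at_props(1)[OF x] chart_at_props(3)[OF x]] by (simp add: rinner_def Let_def)

lemma rinner_scale_left: "rinner R x (\<lambda>c. r *\<^sub>R u c) v = r * rinner R x u v"
  and rinner_scale_right: "rinner R x u (\<lambda>c. r *\<^sub>R v c) = r * rinner R x u v"
  and rinner_diff_left: "rinner R x (\<lambda>c. u c - w c) v = rinner R x u v - rinner R x w v"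
  and rinner_diff_right: "rinner R x u (\<lambda>c. v c - w c) = rinner R x u v - rinner R x u w"
  and rinner_add_left: "rinner R x (\<lambda>c. u c + w c) v = rinner R x u v + rinner R x w v"
  and rinner_add_right: "rinner R x u (\<lambda>c. v c + w c) = rinner R x u v + rinner R x u w"
  and rinner_zero_left: "rinner R x (\<lambda>c. 0) v = 0"
  and rinner_zero_right: "rinner R x v (\<lambda>c. 0) = 0"
  by (simp_all add: rinner_def Let_def gram_simps_at)

lemma rinner_sum_left: "rinner R x (\<lambda>c. \<Sum>i\<in>I. u i c) v = (\<Sum>i\<in>I. rinner R x (u i) v)"
  by (induction I rule: infinite_finite_induct) (simp_all add: rinner_zero_left rinner_add_left)

lemma rinner_sum_right: "rinner R x v (\<lambda>c. \<Sum>i\<in>I. u i c) = (\<Sum>i\<in>I. rinner R x v (u i))"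
  by (induction I rule: infinite_finite_induct) (simp_all add: rinner_zero_right rinner_add_right)

lemma rnorm_power2: "(rnorm R x u)\<^sup>2 = rinner R x u u"
  using rinner_nonneg by (simp add: rnorm_def)

lemma rnorm_nonneg: "rnorm R x u \<ge> 0"
  using rinner_nonneg by (simp add: rnorm_def)

lemma rnorm_scale: "rnorm R x (\<lambda>c. r *\<^sub>R u c) = \<bar>r\<bar> * rnorm R x u"
  by (simp add: rnorm_def rinner_scale_left rinner_scale_right real_sqrt_mult flip: mult.assoc)

lemma rinner_Cauchy_Schwarz: "\<bar>rinner R x u v\<bar> \<le> rnorm R x u * rnorm R x v"
proof (cases "v (chart_at R x) = 0")
  case True
  then have "rinner R x u v = 0"
    by (simp add: rinner_def Let_def gram_simps_at)
  then show ?thesis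
    by (simp add: rnorm_nonneg)
next
  case False
  have vv: "rinner R x v v > 0"
    using gram_pos[OF chart_at_props(1)[OF x] chart_at_props(3)[OF x] False] by (simp add: rinner_def Let_def)
  define w where "w = (\<lambda>c. rinner R x v v *\<^sub>R u c - rinner R x u v *\<^sub>R v c)"
  have "rinner R x w w = rinner R x v v * (rinner R x v v * rinner R x u u - (rinner R x u v)\<^sup>2)"
    unfolding w_def
    by (simp add: rinner_diff_left rinner_diff_right rinner_scale_left rinner_scale_right rinner_sym[of v u]
        power2_eq_square algebra_simps)
  then have "(rinner R x u v)\<^sup>2 \<le> rinner R x u u * rinner R x v v"
    using rinner_nonneg[of w] vv by (simp add: zero_le_mult_iff mult.commute)
  also have "\<dots> = (rnorm R x u * rnorm R x v)\<^sup>2"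
    by (simp add: power_mult_distrib rnorm_power2)
  finally show ?thesis
    using rnorm_nonneg by (simp add: abs_le_square_iff[symmetric])
qed

lemma rnorm_tangent_of:
  "rnorm R x (tangent_of R x (chart_at R x) a)
    = sqrt (gram R (chart_at R x) (chart_map (chart_at R x) x) a a)"
  by (simp add: rnorm_def rinner_def Let_def tangent_of_self[OF chart_at_in[OF x]])

end

section \<open>Geodesics\<close>

lemma geodesic_in_carrier: "geodesic R I \<gamma> \<Longrightarrow> t \<in> I \<Longrightarrow> \<gamma> t \<in> manifold_carrier R"
  and geodesic_continuous: "geodesic R I \<gamma> \<Longrightarrow> continuous_on I \<gamma>"
  and geodesic_position: "geodesic R I \<gamma> \<Longrightarrow> t \<in> I \<Longrightarrow> c \<in> charts_at R (\<gamma> t) \<Longrightarrow>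
    ((\<lambda>s. chart_map c (\<gamma> s)) has_vector_derivative velocity R I \<gamma> t c) (at t within I)"
  and geodesic_acceleration: "geodesic R I \<gamma> \<Longrightarrow> t \<in> I \<Longrightarrow> c \<in> charts_at R (\<gamma> t) \<Longrightarrow>
    ((\<lambda>s. velocity R I \<gamma> s c) has_vector_derivative
       - christoffel R c (chart_map c (\<gamma> t)) (velocity R I \<gamma> t c) (velocity R I \<gamma> t c)) (at t within I)"
  unfolding geodesic_def by auto

lemma eventually_in_chart:
  assumes "continuous_on I \<gamma>" "t \<in> I" "c \<in> charts_at R (\<gamma> t)"
  shows "\<forall>\<^sub>F s in at t within I. \<gamma> s \<in> chart_dom c"
proof -
  have "open (chart_dom c)" "\<gamma> t \<in> chart_dom c" "(\<gamma> \<longlongrightarrow> \<gamma> t) (at t within I)"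
    using assms open_chart_dom[of c] unfolding charts_at_iff continuous_on_def by blast+
  then show ?thesis
    by (rule topological_tendstoD[rotated])
qed

text \<open>The chain rule for the transition maps.\<close>

lemma velocity_in_tangent_space:
  assumes \<gamma>: "geodesic R {0..1} \<gamma>" and t: "t \<in> {0..1}"
  shows "velocity R {0..1} \<gamma> t \<in> tangent_space R (\<gamma> t)"
proof -
  let ?V = "velocity R {0..1} \<gamma> t"
  have "?V c' = frechet_derivative (transition c c') (at (chart_map c (\<gamma> t))) (?V c)"
    if c: "c \<in> charts_at R (\<gamma> t)" and c': "c' \<in> charts_at R (\<gamma> t)" for c c'
  proof -
    let ?J = "frechet_derivative (transition c c') (at (chart_map c (\<gamma> t)))"
    have "((\<lambda>s. chart_map c (\<gamma> s)) has_derivative (\<lambda>h. h *\<^sub>R ?V c)) (at t within {0..1})"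
      using geodesic_position[OF \<gamma> t c] by (simp add: has_vector_derivative_def)
    then have "((\<lambda>s. transition c c' (chart_map c (\<gamma> s))) has_derivative (\<lambda>h. ?J (h *\<^sub>R ?V c))) (at t within {0..1})"
      by (rule has_derivative_compose[where g = "transition c c'"]) (rule transition_has_derivative[OF c c'])
    moreover have "(\<lambda>h. ?J (h *\<^sub>R ?V c)) = (\<lambda>h. h *\<^sub>R ?J (?V c))"
      by (simp add: linear_cmul[OF linear_transition_derivative[OF c c']])
    ultimately have "((\<lambda>s. transition c c' (chart_map c (\<gamma> s))) has_derivative (\<lambda>h. h *\<^sub>R ?J (?V c))) (at t within {0..1})"
      by simp
    moreover have "\<forall>\<^sub>F s in at t within {0..1}. transition c c' (chart_map c (\<gamma> s)) = chart_map c' (\<gamma> s)"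
      using eventually_in_chart[OF geodesic_continuous[OF \<gamma>] t c] c
      by (auto simp: transition_def chart_inv_map charts_at_iff elim!: eventually_mono)
    moreover have "transition c c' (chart_map c (\<gamma> t)) = chart_map c' (\<gamma> t)"
      using c by (auto simp: transition_def chart_inv_map charts_at_iff)
    ultimately have "((\<lambda>s. chart_map c' (\<gamma> s)) has_derivative (\<lambda>h. h *\<^sub>R ?J (?V c))) (at t within {0..1})"
      using t by (rule has_derivative_transform_eventually)
    then have "((\<lambda>s. chart_map c' (\<gamma> s)) has_vector_derivative ?J (?V c)) (at t within {0..1})"
      by (simp add: has_vector_derivative_def)
    then show ?thesis
      using vector_derivative_unique_within_closed_interval[of 0 1 t "\<lambda>s. chart_map c' (\<gamma> s)"]
        geodesic_position[OF \<gamma> t c'] t by simp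
  qed
  moreover have "?V c = 0" if "c \<notin> charts_at R (\<gamma> t)" for c
    using that by (simp add: velocity_def)
  ultimately show ?thesis
    by (intro tangent_spaceI)
qed

text \<open>The Christoffel map is homogeneous of degree two in the velocity, so affine changes of the
  parameter preserve the geodesic equation. Restriction to subintervals, reversal (\<open>b < 0\<close>) and
  constant curves (\<open>b = 0\<close>) are all instances.\<close>

lemma geodesic_affine:
  assumes \<gamma>: "geodesic R {0..1} \<gamma>" and ab: "a \<in> {0..1}" "a + b \<in> {0..1}"
  shows "geodesic R {0..1} (\<lambda>t. \<gamma> (a + b * t))"
    and "t \<in> {0..1} \<Longrightarrow>
      velocity R {0..1} (\<lambda>t. \<gamma> (a + b * t)) t = (\<lambda>c. b *\<^sub>R velocity R {0..1} \<gamma> (a + b * t) c)"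
proof -
  let ?l = "\<lambda>t. a + b * t"
  have l: "?l t \<in> {0..1}" if t: "t \<in> {0..1}" for t
  proof -
    have "?l t = (1 - t) *\<^sub>R a + t *\<^sub>R (a + b)"
      by (simp add: algebra_simps)
    then show ?thesis
      using convexD[OF convex_real_interval(5) ab, of "1 - t" t] t by simp
  qed
  then have sub: "?l ` {0..1} \<subseteq> {0..1}"
    by auto
  have chain: "((\<lambda>s. h (?l s)) has_vector_derivative b *\<^sub>R d) (at t within {0..1})"
    if "(h has_vector_derivative d) (at (?l t) within {0..1})" for h :: "real \<Rightarrow> 'e" and d t
  proof -
    have "(?l has_vector_derivative b) (at t within {0..1})"
      by (auto intro!: derivative_eq_intros)
    moreover have "(h has_vector_derivative d) (at (?l t) within ?l ` {0..1})"
      using that sub has_vector_derivative_within_subset by blast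
    ultimately show ?thesis
      using vector_diff_chain_within[of ?l b t "{0..1}" h d] by (simp add: o_def)
  qed
  have pos: "((\<lambda>s. chart_map c (\<gamma> (?l s))) has_vector_derivative b *\<^sub>R velocity R {0..1} \<gamma> (?l t) c) (at t within {0..1})"
    if "t \<in> {0..1}" "c \<in> charts_at R (\<gamma> (?l t))" for t c
    using chain[OF geodesic_position[OF \<gamma> l[OF that(1)] that(2)]] .
  have vel: "velocity R {0..1} (\<lambda>t. \<gamma> (?l t)) t = (\<lambda>c. b *\<^sub>R velocity R {0..1} \<gamma> (?l t) c)"
    if t: "t \<in> {0..1}" for t
  proof
    fix c
    show "velocity R {0..1} (\<lambda>t. \<gamma> (?l t)) t c = b *\<^sub>R velocity R {0..1} \<gamma> (?l t) c"
    proof (cases "c \<in> charts_at R (\<gamma> (?l t))")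
      case True
      have "vector_derivative (\<lambda>s. chart_map c (\<gamma> (?l s))) (at t within {0..1}) = b *\<^sub>R velocity R {0..1} \<gamma> (?l t) c"
        using pos[OF t True] t by (intro vector_derivative_within_closed_interval) auto
      then show ?thesis
        using True by (simp add: velocity_def[of _ _ "\<lambda>t. \<gamma> (?l t)"])
    qed (simp add: velocity_def)
  qed
  show "t \<in> {0..1} \<Longrightarrow> velocity R {0..1} (\<lambda>t. \<gamma> (?l t)) t = (\<lambda>c. b *\<^sub>R velocity R {0..1} \<gamma> (?l t) c)"
    by (rule vel)
  show "geodesic R {0..1} (\<lambda>t. \<gamma> (?l t))"
    unfolding geodesic_def
  proof (intro conjI ballI)
    show "(\<lambda>t. \<gamma> (?l t)) ` {0..1} \<subseteq> manifold_carrier R"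
      using geodesic_in_carrier[OF \<gamma> l] by auto
    show "continuous_on {0..1} (\<lambda>t. \<gamma> (?l t))"
      by (rule continuous_on_compose2[OF geodesic_continuous[OF \<gamma>] _ sub]) (intro continuous_intros)
  next
    fix t :: real and c
    assume t: "t \<in> {0..1}" and c: "c \<in> charts_at R (\<gamma> (?l t))"
    let ?V = "velocity R {0..1} \<gamma> (?l t) c"
    show "((\<lambda>s. chart_map c (\<gamma> (?l s))) has_vector_derivative velocity R {0..1} (\<lambda>t. \<gamma> (?l t)) t c) (at t within {0..1})"
      using pos[OF t c] vel[OF t] by simp
    have ca: "c \<in> atlas R" "chart_map c (\<gamma> (?l t)) \<in> chart_image c"
      using c charts_at_image[OF c] by (simp_all add: charts_at_iff)
    have "((\<lambda>s. b *\<^sub>R velocity R {0..1} \<gamma> (?l s) c) has_vector_derivative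
        b *\<^sub>R (b *\<^sub>R - christoffel R c (chart_map c (\<gamma> (?l t))) ?V ?V)) (at t within {0..1})"
      by (rule bounded_linear.has_vector_derivative[OF bounded_linear_scaleR_right])
         (rule chain[OF geodesic_acceleration[OF \<gamma> l[OF t] c]])
    then have "((\<lambda>s. velocity R {0..1} (\<lambda>t. \<gamma> (?l t)) s c) has_vector_derivative
        b *\<^sub>R (b *\<^sub>R - christoffel R c (chart_map c (\<gamma> (?l t))) ?V ?V)) (at t within {0..1})"
      by (rule has_vector_derivative_transform[OF t, rotated]) (simp add: vel)
    then show "((\<lambda>s. velocity R {0..1} (\<lambda>t. \<gamma> (?l t)) s c) has_vector_derivative
        - christoffel R c (chart_map c (\<gamma> (?l t))) (velocity R {0..1} (\<lambda>t. \<gamma> (?l t)) t c)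
            (velocity R {0..1} (\<lambda>t. \<gamma> (?l t)) t c)) (at t within {0..1})"
      by (simp add: vel[OF t] christoffel_scale[OF ca])
  qed
qed

lemma gram_Basis_expansion:
  assumes c: "c \<in> atlas R" and p: "p \<in> chart_image c"
  shows "gram R c p u v = (\<Sum>(a, b)\<in>Basis \<times> Basis. (u \<bullet> a) * (v \<bullet> b) * gram R c p a b)"
proof -
  have "gram R c p u v = (\<Sum>a\<in>Basis. (u \<bullet> a) * (\<Sum>b\<in>Basis. (v \<bullet> b) * gram R c p a b))"
    by (subst linear_Basis_expansion[OF linear_gram_left[OF c p], of u v],
        subst linear_Basis_expansion[OF linear_gram_right[OF c p], where u = v]) (rule refl)
  then show ?thesis
    by (simp add: sum.cartesian_product[symmetric] sum_distrib_left mult.assoc)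
qed

text \<open>The product rule, computed from the expansion of the metric in coordinates.\<close>

lemma gram_along_curve:
  fixes p u :: "real \<Rightarrow> 'e"
  assumes c: "c \<in> atlas R" and ev: "\<forall>\<^sub>F s in at t within I. p s \<in> chart_image c" and pt: "p t \<in> chart_image c"
    and t: "t \<in> I"
    and dp: "(p has_vector_derivative p') (at t within I)"
    and du: "(u has_vector_derivative u') (at t within I)"
  shows "((\<lambda>s. gram R c (p s) (u s) (u s)) has_vector_derivative
     Dgram c (p t) (u t) (u t) p' + 2 * gram R c (p t) u' (u t)) (at t within I)"
proof -
  let ?F = "\<lambda>s. \<Sum>(a, b)\<in>Basis \<times> Basis. (u s \<bullet> a) * (u s \<bullet> b) * gram R c (p s) a b"
  let ?F' = "\<Sum>(a, b)\<in>Basis \<times> Basis. (u t \<bullet> a) * (u t \<bullet> b) * Dgram c (p t) a b p'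
      + ((u' \<bullet> a) * (u t \<bullet> b) + (u t \<bullet> a) * (u' \<bullet> b)) * gram R c (p t) a b"
  have du': "((\<lambda>s. u s \<bullet> a) has_real_derivative u' \<bullet> a) (at t within I)" for a
    using bounded_linear.has_vector_derivative[OF bounded_linear_inner_left du]
    by (simp add: has_real_derivative_iff_has_vector_derivative)
  have dg: "((\<lambda>s. gram R c (p s) a b) has_real_derivative Dgram c (p t) a b p') (at t within I)" for a b
  proof -
    have "((\<lambda>s. gram R c (p s) a b) has_derivative (\<lambda>h. Dgram c (p t) a b (h *\<^sub>R p'))) (at t within I)"
      by (rule has_derivative_compose[where g = "\<lambda>q. gram R c q a b"])
         (use dp gram_has_derivative[OF c pt] in \<open>auto simp: has_vector_derivative_def\<close>)
    then show ?thesis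
      by (simp add: has_field_derivative_def linear_cmul[OF linear_Dgram_direction[OF c pt]] mult_commute_abs)
  qed
  have D: "Dgram c (p t) (u t) (u t) p' = (\<Sum>(a, b)\<in>Basis \<times> Basis. (u t \<bullet> a) * (u t \<bullet> b) * Dgram c (p t) a b p')"
    by (subst linear_Basis_expansion[OF linear_Dgram_left[OF c pt], of "u t"],
        subst linear_Basis_expansion[OF linear_Dgram_right[OF c pt], of _ "u t"])
       (simp add: sum.cartesian_product[symmetric] sum_distrib_left mult.assoc)
  have G: "2 * gram R c (p t) u' (u t)
    = (\<Sum>(a, b)\<in>Basis \<times> Basis. ((u' \<bullet> a) * (u t \<bullet> b) + (u t \<bullet> a) * (u' \<bullet> b)) * gram R c (p t) a b)"
  proof -
    have "2 * gram R c (p t) u' (u t) = gram R c (p t) u' (u t) + gram R c (p t) (u t) u'"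
      using gram_sym[OF c pt] by simp
    also have "\<dots> = (\<Sum>(a, b)\<in>Basis \<times> Basis. (u' \<bullet> a) * (u t \<bullet> b) * gram R c (p t) a b)
        + (\<Sum>(a, b)\<in>Basis \<times> Basis. (u t \<bullet> a) * (u' \<bullet> b) * gram R c (p t) a b)"
      by (simp only: gram_Basis_expansion[OF c pt, of u' "u t"] gram_Basis_expansion[OF c pt, of "u t" u'])
    finally show ?thesis
      by (simp add: sum.distrib[symmetric] case_prod_unfold distrib_right)
  qed
  have "(?F has_real_derivative ?F') (at t within I)"
    unfolding case_prod_unfold
    by (rule DERIV_sum) (auto intro!: derivative_eq_intros du' dg simp: algebra_simps)
  then have "(?F has_vector_derivative ?F') (at t within I)"
    by (simp add: has_real_derivative_iff_has_vector_derivative)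
  then have "((\<lambda>s. gram R c (p s) (u s) (u s)) has_vector_derivative ?F') (at t within I)"
    unfolding has_vector_derivative_def
    by (rule has_derivative_transform_eventually)
       (use ev gram_Basis_expansion[OF c] pt t in \<open>auto elim!: eventually_mono\<close>)
  moreover have "?F' = Dgram c (p t) (u t) (u t) p' + 2 * gram R c (p t) u' (u t)"
    unfolding D G by (simp add: sum.distrib case_prod_unfold)
  ultimately show ?thesis
    by simp
qed

text \<open>Compatibility of the Levi-Civita connection with the metric: inserting the geodesic equation and
  the Koszul formula, the derivative of the squared speed cancels in every chart.\<close>

lemma geodesic_constant_speed:
  assumes \<gamma>: "geodesic R {0..1} \<gamma>" and t: "t \<in> {0..1}"
  shows "rnorm R (\<gamma> t) (velocity R {0..1} \<gamma> t) = rnorm R (\<gamma> 0) (velocity R {0..1} \<gamma> 0)"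
proof -
  let ?V = "velocity R {0..1} \<gamma>"
  let ?E = "\<lambda>t. rinner R (\<gamma> t) (?V t) (?V t)"
  have flat: "(?E has_vector_derivative 0) (at t within {0..1})" if t: "t \<in> {0..1}" for t
  proof -
    obtain c where c: "c \<in> charts_at R (\<gamma> t)"
      using chart_at_in[OF geodesic_in_carrier[OF \<gamma> t]] by blast
    let ?p = "\<lambda>s. chart_map c (\<gamma> s)" and ?u = "\<lambda>s. ?V s c"
    have ca: "c \<in> atlas R" and pt: "?p t \<in> chart_image c"
      using c charts_at_image[OF c] by (simp_all add: charts_at_iff)
    have ev: "\<forall>\<^sub>F s in at t within {0..1}. \<gamma> s \<in> chart_dom c"
      by (rule eventually_in_chart[OF geodesic_continuous[OF \<gamma>] t c])
    let ?G = "christoffel R c (?p t) (?u t) (?u t)"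
    have "((\<lambda>s. gram R c (?p s) (?u s) (?u s)) has_vector_derivative
        Dgram c (?p t) (?u t) (?u t) (?u t) + 2 * gram R c (?p t) (- ?G) (?u t)) (at t within {0..1})"
      by (rule gram_along_curve[OF ca eventually_mono[OF ev chart_map_in] pt t
          geodesic_position[OF \<gamma> t c] geodesic_acceleration[OF \<gamma> t c]])
    moreover have "gram R c (?p t) (- ?G) (?u t) = - (Dgram c (?p t) (?u t) (?u t) (?u t) / 2)"
      by (simp add: gram_simps[OF ca pt] gram_christoffel[OF ca pt] koszul_def)
    ultimately have "((\<lambda>s. gram R c (?p s) (?u s) (?u s)) has_vector_derivative 0) (at t within {0..1})"
      by simp
    moreover have "\<forall>\<^sub>F s in at t within {0..1}. gram R c (?p s) (?u s) (?u s) = ?E s"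
    proof -
      have "\<forall>\<^sub>F s in at t within {0..1}. s \<in> {0..1}"
        by (simp add: eventually_at_filter)
      with ev show ?thesis
      proof eventually_elim
        case (elim s)
        then have "c \<in> charts_at R (\<gamma> s)"
          using ca by (simp add: charts_at_iff)
        then show ?case
          using rinner_chart[OF velocity_in_tangent_space[OF \<gamma>] velocity_in_tangent_space[OF \<gamma>]] elim(2) by simp
      qed
    qed
    moreover have "gram R c (?p t) (?u t) (?u t) = ?E t"
      using rinner_chart[OF velocity_in_tangent_space[OF \<gamma> t] velocity_in_tangent_space[OF \<gamma> t] c] by simp
    ultimately show ?thesis
      unfolding has_vector_derivative_def using t by (rule has_derivative_transform_eventually)
  qed
  obtain e where "\<And>t. t \<in> {0..1} \<Longrightarrow> ?E t = e"
    by (rule has_vector_derivative_zero_constant[OF convex_real_interval(5) flat]) (assumption, erule that)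
  then have "?E t = ?E 0"
    using t by simp
  then show ?thesis
    by (simp add: rnorm_def)
qed

lemma geodesic_length:
  assumes \<gamma>: "geodesic R {0..1} \<gamma>"
  shows "curve_length R {0..1} \<gamma> = rnorm R (\<gamma> 0) (velocity R {0..1} \<gamma> 0)"
proof -
  have "curve_length R {0..1} \<gamma> = integral {0..1::real} (\<lambda>t. rnorm R (\<gamma> 0) (velocity R {0..1} \<gamma> 0))"
    unfolding curve_length_def
    by (rule Henstock_Kurzweil_Integration.integral_cong) (rule geodesic_constant_speed[OF \<gamma>])
  then show ?thesis
    by simp
qed

end


context riemannian begin

section \<open>Uniqueness of geodesics\<close>

lemma continuous_on_gram:
  assumes c: "c \<in> atlas R"
  shows "continuous_on (chart_image c \<times> UNIV) (\<lambda>(p, u). gram R c p u u)"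
proof -
  have "continuous_on (chart_image c \<times> UNIV) (\<lambda>z. gram R c (fst z) a b)" for a b
    by (rule continuous_on_compose2[OF smooth_on_continuous[OF smooth_gram[OF c, of a b]]
          continuous_on_fst[OF continuous_on_id]]) auto
  then have "continuous_on (chart_image c \<times> UNIV)
      (\<lambda>z. \<Sum>(a, b)\<in>Basis \<times> Basis. (snd z \<bullet> a) * (snd z \<bullet> b) * gram R c (fst z) a b)"
    unfolding case_prod_unfold by (intro continuous_intros) auto
  then show ?thesis
    by (rule continuous_on_eq) (auto simp: gram_Basis_expansion[OF c])
qed

text \<open>Compactness of the ball times the unit sphere.\<close>

lemma gram_elliptic_on_cball:
  assumes c: "c \<in> atlas R" and sub: "cball p0 r \<subseteq> chart_image c" and r: "r \<ge> 0"
  shows "\<exists>m>0. \<forall>p\<in>cball p0 r. \<forall>u. m * (norm u)\<^sup>2 \<le> gram R c p u u"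
proof -
  let ?S = "cball p0 r \<times> sphere (0::'e) 1"
  have "compact ?S"
    by (intro compact_Times) auto
  moreover obtain b :: 'e where "b \<in> Basis"
    using nonempty_Basis by blast
  then have "(p0, b) \<in> ?S"
    using r by simp
  then have "?S \<noteq> {}"
    by blast
  moreover have "continuous_on ?S (\<lambda>(p, u). gram R c p u u)"
    by (rule continuous_on_subset[OF continuous_on_gram[OF c]]) (use sub in auto)
  ultimately obtain q w where qw: "(q, w) \<in> ?S" "\<And>z. z \<in> ?S \<Longrightarrow> gram R c q w w \<le> (\<lambda>(p, u). gram R c p u u) z"
    using continuous_attains_inf[of ?S "\<lambda>(p, u). gram R c p u u"] by (auto simp del: mem_cball)
  have pos: "gram R c q w w > 0"
    by (rule gram_pos[OF c]) (use qw(1) sub in auto)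
  have "gram R c q w w * (norm u)\<^sup>2 \<le> gram R c p u u" if p: "p \<in> cball p0 r" for p u
  proof (cases "u = 0")
    case True
    then show ?thesis
      using gram_nonneg[OF c subsetD[OF sub p]] by simp
  next
    case False
    define e where "e = (1 / norm u) *\<^sub>R u"
    have "gram R c q w w \<le> gram R c p e e"
      using qw(2)[of "(p, e)"] p False by (simp add: e_def)
    then have "gram R c q w w * (norm u)\<^sup>2 \<le> gram R c p e e * (norm u)\<^sup>2"
      by (rule mult_right_mono) simp
    also have "gram R c p e e * (norm u)\<^sup>2 = gram R c p (norm u *\<^sub>R e) (norm u *\<^sub>R e)"
      by (simp add: gram_simps[OF c subsetD[OF sub p]] power2_eq_square)
    also have "norm u *\<^sub>R e = u"
      using False by (simp add: e_def)
    finally show ?thesis .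
  qed
  with pos show ?thesis
    by blast
qed

lemma gram_Lipschitz_on_cball:
  assumes c: "c \<in> atlas R" and sub: "cball p0 r \<subseteq> chart_image c"
  shows "\<exists>L\<ge>0. \<forall>p\<in>cball p0 r. \<forall>u v. \<bar>gram R c p u v\<bar> \<le> L * (norm u * norm v) \<and>
    (\<forall>q\<in>cball p0 r. \<bar>gram R c p u v - gram R c q u v\<bar> \<le> L * norm (p - q) * (norm u * norm v))"
proof -
  have "\<exists>L\<ge>0. \<forall>p\<in>cball p0 r. \<forall>z. \<bar>(\<lambda>(u, v). gram R c p u v) z\<bar> \<le> L * (\<lambda>(u, v). norm u * norm v) z \<and>
    (\<forall>q\<in>cball p0 r. \<bar>(\<lambda>(u, v). gram R c p u v) z - (\<lambda>(u, v). gram R c q u v) z\<bar>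
      \<le> L * norm (p - q) * (\<lambda>(u, v). norm u * norm v) z)"
  proof (rule expansion_Lipschitz_on_cball[OF _ _ open_chart_image[OF c] sub])
    show "finite (Basis \<times> Basis :: ('e \<times> 'e) set)"
      by simp
    show "smooth_on (chart_image c) ((\<lambda>(a, b) p. gram R c p a b) i)" for i
      using smooth_gram[OF c] by (simp add: case_prod_unfold)
    show "(\<lambda>(u, v). gram R c q u v) z
      = (\<Sum>i\<in>Basis \<times> Basis. (\<lambda>(a, b) (u, v). (u \<bullet> a) * (v \<bullet> b)) i z * (\<lambda>(a, b) p. gram R c p a b) i q)"
      if "q \<in> chart_image c" for q z
      using gram_Basis_expansion[OF c that, of "fst z" "snd z"] by (simp add: case_prod_unfold)
    show "\<bar>(\<lambda>(a, b) (u, v). (u \<bullet> a) * (v \<bullet> b)) i z\<bar> \<le> (\<lambda>(u, v). norm u * norm v) z"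
      if "i \<in> Basis \<times> Basis" for i and z :: "'e \<times> 'e"
      using that Basis_le_norm by (auto simp: abs_mult case_prod_unfold intro!: mult_mono)
  qed
  then show ?thesis
    by auto
qed

lemma koszul_Basis_expansion:
  assumes c: "c \<in> atlas R" and p: "p \<in> chart_image c"
  shows "koszul R c p u v w = (\<Sum>(a, b, d)\<in>Basis \<times> Basis \<times> Basis.
    (((v \<bullet> a) * (w \<bullet> b) * (u \<bullet> d) + (u \<bullet> a) * (w \<bullet> b) * (v \<bullet> d) - (u \<bullet> a) * (v \<bullet> b) * (w \<bullet> d)) / 2)
      * Dgram c p a b d)"
proof -
  have D: "Dgram c p u v w = (\<Sum>(a, b, d)\<in>Basis \<times> Basis \<times> Basis. (u \<bullet> a) * (v \<bullet> b) * (w \<bullet> d) * Dgram c p a b d)" for u v w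
    by (subst linear_Basis_expansion[OF linear_Dgram_left[OF c p], of u],
        subst linear_Basis_expansion[OF linear_Dgram_right[OF c p], of _ v],
        subst linear_Basis_expansion[OF linear_Dgram_direction[OF c p], where u = w])
       (simp add: sum.cartesian_product[symmetric] sum_distrib_left mult.assoc)
  show ?thesis
    unfolding koszul_def D[of v w u] D[of u w v] D[of u v w] case_prod_unfold sum.distrib[symmetric] sum_subtractf[symmetric] sum_divide_distrib
    by (rule sum.cong[OF refl]) (simp add: left_diff_distrib distrib_right)
qed

lemma koszul_Lipschitz_on_cball:
  assumes c: "c \<in> atlas R" and sub: "cball p0 r \<subseteq> chart_image c"
  shows "\<exists>L\<ge>0. \<forall>p\<in>cball p0 r. \<forall>u v w. \<bar>koszul R c p u v w\<bar> \<le> L * (2 * norm u * norm v * norm w) \<and>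
    (\<forall>q\<in>cball p0 r. \<bar>koszul R c p u v w - koszul R c q u v w\<bar> \<le> L * norm (p - q) * (2 * norm u * norm v * norm w))"
proof -
  let ?K = "\<lambda>p (u, v, w). koszul R c p u v w" and ?N = "\<lambda>(u, v, w). 2 * norm u * norm v * norm w"
  let ?k = "\<lambda>(a, b, d) (u, v, w).
    ((v \<bullet> a) * (w \<bullet> b) * (u \<bullet> d) + (u \<bullet> a) * (w \<bullet> b) * (v \<bullet> d) - (u \<bullet> a) * (v \<bullet> b) * (w \<bullet> d)) / 2"
  have "\<exists>L\<ge>0. \<forall>p\<in>cball p0 r. \<forall>z. \<bar>?K p z\<bar> \<le> L * ?N z \<and>
    (\<forall>q\<in>cball p0 r. \<bar>?K p z - ?K q z\<bar> \<le> L * norm (p - q) * ?N z)"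
  proof (rule expansion_Lipschitz_on_cball[OF _ _ open_chart_image[OF c] sub])
    show "finite (Basis \<times> Basis \<times> Basis :: ('e \<times> 'e \<times> 'e) set)"
      by simp
    show "smooth_on (chart_image c) ((\<lambda>(a, b, d) p. Dgram c p a b d) i)" for i
      using smooth_on_frechet_derivative[OF smooth_gram[OF c]] by (simp add: case_prod_unfold)
    show "?K q z = (\<Sum>i\<in>Basis \<times> Basis \<times> Basis. ?k i z * (\<lambda>(a, b, d) p. Dgram c p a b d) i q)"
      if "q \<in> chart_image c" for q z
      using koszul_Basis_expansion[OF c that, of "fst z" "fst (snd z)" "snd (snd z)"] by (simp add: case_prod_unfold)
    show "\<bar>?k i z\<bar> \<le> ?N z" if i: "i \<in> Basis \<times> Basis \<times> Basis" for i and z :: "'e \<times> 'e \<times> 'e"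
    proof -
      obtain a b d u v w where [simp]: "i = (a, b, d)" "z = (u, v, w)"
        by (metis prod_cases3)
      have ab: "a \<in> Basis" "b \<in> Basis" "d \<in> Basis"
        using i by auto
      have t: "\<bar>x \<bullet> a * (y \<bullet> b) * (z \<bullet> d)\<bar> \<le> norm x * norm y * norm z" for x y z
        unfolding abs_mult using ab by (intro mult_mono Basis_le_norm mult_nonneg_nonneg) auto
      have "\<bar>(r + s - t) / 2\<bar> \<le> (\<bar>r\<bar> + \<bar>s\<bar> + \<bar>t\<bar>) / 2" for r s t :: real
        using abs_ge_self[of r] abs_ge_minus_self[of r] abs_ge_self[of s] abs_ge_minus_self[of s]
          abs_ge_self[of t] abs_ge_minus_self[of t]
        by (intro abs_leI) (simp_all add: field_simps del: abs_ge_self abs_ge_minus_self)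
      then have "\<bar>?k i z\<bar> \<le> (\<bar>v \<bullet> a * (w \<bullet> b) * (u \<bullet> d)\<bar> + \<bar>u \<bullet> a * (w \<bullet> b) * (v \<bullet> d)\<bar> + \<bar>u \<bullet> a * (v \<bullet> b) * (w \<bullet> d)\<bar>) / 2"
        by simp
      also have "\<dots> \<le> (norm v * norm w * norm u + norm u * norm w * norm v + norm u * norm v * norm w) / 2"
        by (intro divide_right_mono add_mono t) auto
      also have "\<dots> \<le> ?N z"
        by (simp add: mult.commute mult.left_commute)
      finally show ?thesis .
    qed
  qed
  then show ?thesis
    by auto
qed

text \<open>Instead of inverting the matrix of the metric, the difference \<open>h\<close> of two values of the Christoffel
  map is tested against itself: ellipticity bounds \<open>m * (norm h)\<^sup>2\<close> by differences of the
  Koszul expression and of the metric, which are Lipschitz and contain \<open>h\<close> only linearly.\<close>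

lemma christoffel_Lipschitz:
  assumes c: "c \<in> atlas R" and sub: "cball p0 r \<subseteq> chart_image c" and r: "r \<ge> 0" and M: "M \<ge> 0"
  shows "\<exists>L\<ge>0. \<forall>p\<in>cball p0 r. \<forall>q\<in>cball p0 r. \<forall>u v. norm u \<le> M \<longrightarrow> norm v \<le> M \<longrightarrow>
    norm (christoffel R c p u u - christoffel R c q v v) \<le> L * (norm (p - q) + norm (u - v))"
proof -
  obtain m where m: "m > 0" "\<And>p u. p \<in> cball p0 r \<Longrightarrow> m * (norm u)\<^sup>2 \<le> gram R c p u u"
    using gram_elliptic_on_cball[OF c sub r] by blast
  obtain G where G: "G \<ge> 0" "\<And>p q u v. p \<in> cball p0 r \<Longrightarrow> q \<in> cball p0 r \<Longrightarrow>
      \<bar>gram R c p u v - gram R c q u v\<bar> \<le> G * norm (p - q) * (norm u * norm v)"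
    using gram_Lipschitz_on_cball[OF c sub] by blast
  obtain K where K: "K \<ge> 0" "\<And>p u v w. p \<in> cball p0 r \<Longrightarrow> \<bar>koszul R c p u v w\<bar> \<le> K * (2 * norm u * norm v * norm w)"
    "\<And>p q u v w. p \<in> cball p0 r \<Longrightarrow> q \<in> cball p0 r \<Longrightarrow>
      \<bar>koszul R c p u v w - koszul R c q u v w\<bar> \<le> K * norm (p - q) * (2 * norm u * norm v * norm w)"
    using koszul_Lipschitz_on_cball[OF c sub] by blast
  define B where "B = K * (2 * M * M) / m"
  define L where "L = (K * (2 * M * M) + 2 * (K * (2 * M)) + G * B) / m"
  have B: "B \<ge> 0"
    using K(1) M m(1) by (simp add: B_def)
  have coercive: "norm z \<le> b / m" if "p \<in> cball p0 r" "gram R c p z z \<le> b * norm z" "b \<ge> 0" for p z b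
  proof (cases "z = 0")
    case False
    have "m * norm z * norm z \<le> b * norm z"
      using m(2)[OF that(1), of z] that(2) by (simp add: power2_eq_square mult.assoc)
    then show ?thesis
      using False m(1) by (simp add: field_simps)
  qed (use that m in simp)
  have chr: "norm (christoffel R c q v v) \<le> B" if q: "q \<in> cball p0 r" and v: "norm v \<le> M" for q v
    unfolding B_def
  proof (rule coercive[OF q])
    let ?z = "christoffel R c q v v"
    have "gram R c q ?z ?z \<le> K * (2 * norm v * norm v * norm ?z)"
      using gram_christoffel[OF c subsetD[OF sub q]] K(2)[OF q, of v v ?z] by simp
    also have "\<dots> \<le> K * (2 * M * M * norm ?z)"
      using K(1) v M by (intro mult_left_mono mult_mono mult_nonneg_nonneg) auto
    finally show "gram R c q ?z ?z \<le> K * (2 * M * M) * norm ?z"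
      by (simp add: mult.assoc)
  qed (use K M in simp)
  have "norm (christoffel R c p u u - christoffel R c q v v) \<le> L * (norm (p - q) + norm (u - v))"
    if p: "p \<in> cball p0 r" and q: "q \<in> cball p0 r" and u: "norm u \<le> M" and v: "norm v \<le> M" for p q u v
  proof -
    let ?z = "christoffel R c q v v"
    define h where "h = christoffel R c p u u - ?z"
    have pi: "p \<in> chart_image c" and qi: "q \<in> chart_image c"
      using p q sub by auto
    have "gram R c p h h = koszul R c p u u h - gram R c p ?z h"
      by (simp add: h_def gram_simps(3)[OF c pi, of "christoffel R c p u u"] gram_christoffel[OF c pi])
    also have "\<dots> = (koszul R c p u u h - koszul R c q u u h) + koszul R c q (u - v) u h
        + koszul R c q v (u - v) h + (gram R c q ?z h - gram R c p ?z h)"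
      by (simp add: gram_christoffel[OF c qi] linear_diff[OF linear_koszul(1)[OF c qi]]
          linear_diff[OF linear_koszul(2)[OF c qi]])
    also have "\<dots> \<le> K * norm (p - q) * (2 * norm u * norm u * norm h) + K * (2 * norm (u - v) * norm u * norm h)
        + K * (2 * norm v * norm (u - v) * norm h) + G * norm (p - q) * (norm ?z * norm h)"
      using K(3)[OF p q, of u u h] K(2)[OF q, of "u - v" u h] K(2)[OF q, of v "u - v" h] G(2)[OF p q, of ?z h]
      by linarith
    also have "\<dots> \<le> K * norm (p - q) * (2 * M * M * norm h) + K * (2 * norm (u - v) * M * norm h)
        + K * (2 * M * norm (u - v) * norm h) + G * norm (p - q) * (B * norm h)"
      using u v K(1) G(1) M chr[OF q v]
      by (intro add_mono mult_left_mono mult_right_mono mult_mono mult_nonneg_nonneg) auto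
    also have "\<dots> = (norm (p - q) * (K * (2 * M * M) + G * B) + norm (u - v) * (2 * (K * (2 * M)))) * norm h"
      by (simp add: algebra_simps)
    finally have "norm h \<le> (norm (p - q) * (K * (2 * M * M) + G * B) + norm (u - v) * (2 * (K * (2 * M)))) / m"
      using K(1) M G(1) B by (intro coercive[OF p]) auto
    also have "\<dots> \<le> (norm (p - q) * (K * (2 * M * M) + 2 * (K * (2 * M)) + G * B)
        + norm (u - v) * (K * (2 * M * M) + 2 * (K * (2 * M)) + G * B)) / m"
      using K(1) M G(1) B m(1) by (intro divide_right_mono add_mono mult_left_mono) auto
    also have "\<dots> = L * (norm (p - q) + norm (u - v))"
      by (simp add: L_def algebra_simps add_divide_distrib)
    finally show ?thesis
      by (simp add: h_def)
  qed
  moreover have "L \<ge> 0"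
    using K(1) M G(1) B m(1) by (simp add: L_def)
  ultimately show ?thesis
    by blast
qed

text \<open>In a chart the position and velocity of a geodesic solve a first order system with locally
  Lipschitz right-hand side. Gronwall's inequality applies to the squared distance \<open>\<phi>\<close> of two
  solutions.\<close>

lemma geodesic_locally_unique:
  assumes \<gamma>: "geodesic R {0..1} \<gamma>" and \<gamma>': "geodesic R {0..1} \<gamma>'" and t0: "t0 \<in> {0..1}"
    and eq: "\<gamma> t0 = \<gamma>' t0" "velocity R {0..1} \<gamma> t0 = velocity R {0..1} \<gamma>' t0"
  shows "\<forall>\<^sub>F t in at t0 within {0..1}. \<gamma> t = \<gamma>' t \<and> velocity R {0..1} \<gamma> t = velocity R {0..1} \<gamma>' t"
proof -
  obtain c where c: "c \<in> charts_at R (\<gamma> t0)"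
    using chart_at_in[OF geodesic_in_carrier[OF \<gamma> t0]] by blast
  have c': "c \<in> charts_at R (\<gamma>' t0)"
    using c eq by simp
  have ca: "c \<in> atlas R"
    using c by (simp add: charts_at_iff)
  define p where "p = (\<lambda>s. chart_map c (\<gamma> s))"
  define p' where "p' = (\<lambda>s. chart_map c (\<gamma>' s))"
  define u where "u = (\<lambda>s. velocity R {0..1} \<gamma> s c)"
  define u' where "u' = (\<lambda>s. velocity R {0..1} \<gamma>' s c)"
  have eq0: "p t0 = p' t0" "u t0 = u' t0"
    using eq by (simp_all add: p_def p'_def u_def u'_def)
  obtain r where r: "r > 0" "cball (p t0) r \<subseteq> chart_image c"
    using open_chart_image[OF ca] charts_at_image[OF c] unfolding open_contains_cball p_def by blast
  define M where "M = norm (u t0) + 1"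
  obtain L where L: "L \<ge> 0" "\<And>q q' w w'. q \<in> cball (p t0) r \<Longrightarrow> q' \<in> cball (p t0) r \<Longrightarrow> norm w \<le> M \<Longrightarrow> norm w' \<le> M \<Longrightarrow>
      norm (christoffel R c q w w - christoffel R c q' w' w') \<le> L * (norm (q - q') + norm (w - w'))"
    using christoffel_Lipschitz[OF ca r(2), of M] r(1) by (auto simp: M_def)
  \<comment> \<open>The window of parameters in which both curves stay in one chart and in the region of the Lipschitz bound.\<close>
  define near where "near = (\<lambda>s. \<gamma> s \<in> chart_dom c \<and> \<gamma>' s \<in> chart_dom c \<and> dist (p s) (p t0) < r \<and> dist (p' s) (p t0) < r
      \<and> dist (u s) (u t0) < 1 \<and> dist (u' s) (u t0) < 1)"
  have tend: "(p \<longlongrightarrow> p t0) (at t0 within {0..1})" "(p' \<longlongrightarrow> p t0) (at t0 within {0..1})"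
    "(u \<longlongrightarrow> u t0) (at t0 within {0..1})" "(u' \<longlongrightarrow> u t0) (at t0 within {0..1})"
    using has_vector_derivative_continuous[OF geodesic_position[OF \<gamma> t0 c]]
      has_vector_derivative_continuous[OF geodesic_position[OF \<gamma>' t0 c']]
      has_vector_derivative_continuous[OF geodesic_acceleration[OF \<gamma> t0 c]]
      has_vector_derivative_continuous[OF geodesic_acceleration[OF \<gamma>' t0 c']] eq0
    by (simp_all add: continuous_within p_def p'_def u_def u'_def)
  have "\<forall>\<^sub>F s in at t0 within {0..1}. near s"
    unfolding near_def using r(1)
    by (intro eventually_conj eventually_in_chart[OF geodesic_continuous[OF \<gamma>] t0 c]
        eventually_in_chart[OF geodesic_continuous[OF \<gamma>'] t0 c'] tend[THEN tendstoD]) auto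
  then obtain d where d: "d > 0" "\<And>s. s \<in> {0..1} \<Longrightarrow> s \<noteq> t0 \<Longrightarrow> dist s t0 < d \<Longrightarrow> near s"
    by (auto simp: eventually_at)
  have near0: "near t0"
    using c c' r(1) eq0 by (simp add: near_def charts_at_iff)
  define lo where "lo = max 0 (t0 - d / 2)"
  define hi where "hi = min 1 (t0 + d / 2)"
  have J: "{lo..hi} \<subseteq> {0..1}" "t0 \<in> {lo..hi}"
    using t0 d(1) by (auto simp: lo_def hi_def)
  have near: "near s" if "s \<in> {lo..hi}" for s
  proof (cases "s = t0")
    case False
    have "s \<in> {0..1}"
      using that J by blast
    then show ?thesis
      using d(2)[of s] False that d(1) by (auto simp: lo_def hi_def dist_real_def abs_less_iff)
  qed (use near0 in simp)
  define \<phi> where "\<phi> s = (p s - p' s) \<bullet> (p s - p' s) + (u s - u' s) \<bullet> (u s - u' s)" for s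
  let ?a = "\<lambda>s. christoffel R c (p s) (u s) (u s)" and ?a' = "\<lambda>s. christoffel R c (p' s) (u' s) (u' s)"
  have agree: "\<gamma> s = \<gamma>' s \<and> velocity R {0..1} \<gamma> s = velocity R {0..1} \<gamma>' s" if s: "s \<in> {lo..hi}" for s
  proof -
    have charts: "c \<in> charts_at R (\<gamma> t)" "c \<in> charts_at R (\<gamma>' t)" if "t \<in> {lo..hi}" for t
      using near[OF that] ca by (simp_all add: near_def charts_at_iff)
    have "\<phi> s \<le> 0"
    proof (rule Gronwall_zero[OF _ _ J(2) _ s])
      fix t assume t: "t \<in> {lo..hi}"
      have t1: "t \<in> {0..1}"
        using t J by blast
      have "(p has_vector_derivative u t) (at t within {lo..hi})" "(p' has_vector_derivative u' t) (at t within {lo..hi})"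
        "(u has_vector_derivative - ?a t) (at t within {lo..hi})" "(u' has_vector_derivative - ?a' t) (at t within {lo..hi})"
        unfolding p_def p'_def u_def u'_def
        using geodesic_position[OF \<gamma> t1 charts(1)[OF t]] geodesic_position[OF \<gamma>' t1 charts(2)[OF t]]
          geodesic_acceleration[OF \<gamma> t1 charts(1)[OF t]] geodesic_acceleration[OF \<gamma>' t1 charts(2)[OF t]]
        by (blast intro: has_vector_derivative_within_subset[OF _ J(1)])+
      then have "((\<lambda>s. p s - p' s) has_vector_derivative u t - u' t) (at t within {lo..hi})"
        "((\<lambda>s. u s - u' s) has_vector_derivative ?a' t - ?a t) (at t within {lo..hi})"
        by (auto intro!: derivative_eq_intros)
      then have "(\<phi> has_vector_derivative ((p t - p' t) \<bullet> (u t - u' t) + (u t - u' t) \<bullet> (p t - p' t))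
          + ((u t - u' t) \<bullet> (?a' t - ?a t) + (?a' t - ?a t) \<bullet> (u t - u' t))) (at t within {lo..hi})"
        unfolding \<phi>_def by (intro has_vector_derivative_add bounded_bilinear.has_vector_derivative[OF bounded_bilinear_inner])
      then show "(\<phi> has_real_derivative 2 * ((p t - p' t) \<bullet> (u t - u' t)) + 2 * ((u t - u' t) \<bullet> (?a' t - ?a t))) (at t within {lo..hi})"
        by (simp add: has_real_derivative_iff_has_vector_derivative inner_commute)
      have nr: "near t"
        by (rule near[OF t])
      have "norm (u t) \<le> M" "norm (u' t) \<le> M"
        using nr norm_triangle_sub[of "u t" "u t0"] norm_triangle_sub[of "u' t" "u t0"]
        by (auto simp: near_def M_def dist_norm)
      then have a: "norm (?a' t - ?a t) \<le> L * (norm (p t - p' t) + norm (u t - u' t))"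
        using L(2)[of "p t" "p' t" "u t" "u' t"] nr by (simp add: near_def dist_commute less_imp_le norm_minus_commute)
      let ?e = "norm (p t - p' t)" and ?h = "norm (u t - u' t)"
      have \<phi>: "\<phi> t = ?e\<^sup>2 + ?h\<^sup>2"
        by (simp add: \<phi>_def power2_norm_eq_inner)
      have am: "2 * (?e * ?h) \<le> \<phi> t"
        using zero_le_power2[of "?e - ?h"] unfolding \<phi> by (simp add: power2_diff)
      have "\<bar>2 * ((p t - p' t) \<bullet> (u t - u' t)) + 2 * ((u t - u' t) \<bullet> (?a' t - ?a t))\<bar>
          \<le> 2 * (?e * ?h) + 2 * (?h * norm (?a' t - ?a t))"
        using Cauchy_Schwarz_ineq2[of "p t - p' t" "u t - u' t"] Cauchy_Schwarz_ineq2[of "u t - u' t" "?a' t - ?a t"]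
        by linarith
      also have "\<dots> \<le> 2 * (?e * ?h) + 2 * (?h * (L * (?e + ?h)))"
        using a by (intro add_left_mono mult_left_mono) auto
      also have "\<dots> = 2 * (?e * ?h) + L * (2 * (?e * ?h)) + 2 * L * ?h\<^sup>2"
        by (simp add: algebra_simps power2_eq_square)
      also have "\<dots> \<le> \<phi> t + L * \<phi> t + 2 * L * \<phi> t"
        using am L(1) by (intro add_mono mult_left_mono) (auto simp: \<phi>)
      finally show "\<bar>2 * ((p t - p' t) \<bullet> (u t - u' t)) + 2 * ((u t - u' t) \<bullet> (?a' t - ?a t))\<bar> \<le> (1 + 3 * L) * \<phi> t"
        by (simp add: algebra_simps)
    next
      show "\<phi> t0 = 0"
        using eq0 by (simp add: \<phi>_def)
    qed
    then have "p s = p' s" "u s = u' s"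
      unfolding \<phi>_def
      by (smt (verit) inner_eq_zero_iff inner_ge_zero right_minus_eq)+
    moreover have s1: "s \<in> {0..1}"
      using s J by blast
    ultimately have g: "\<gamma> s = \<gamma>' s"
      using chart_map_inj[OF ca, of "\<gamma> s" "\<gamma>' s"] charts[OF s] by (simp add: p_def p'_def charts_at_iff)
    show ?thesis
    proof
      show "velocity R {0..1} \<gamma> s = velocity R {0..1} \<gamma>' s"
        using velocity_in_tangent_space[OF \<gamma> s1] velocity_in_tangent_space[OF \<gamma>' s1] charts(1)[OF s] \<open>u s = u' s\<close>
        by (intro tangent_vector_eqI[where c = c]) (simp_all add: g u_def u'_def)
    qed (rule g)
  qed
  have "s \<in> {lo..hi}" if "s \<in> {0..1}" "dist s t0 < d / 2" for s
    using that unfolding lo_def hi_def dist_real_def by (simp add: abs_if field_simps split: if_splits)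
  then show ?thesis
    using agree d(1) unfolding eventually_at by (intro exI[of _ "d / 2"]) auto
qed

text \<open>Points are separated by the Hausdorff property; at a common point, the velocities differ in a chart,
  where they are continuous.\<close>

lemma geodesics_stay_apart:
  assumes \<gamma>: "geodesic R {0..1} \<gamma>" and \<gamma>': "geodesic R {0..1} \<gamma>'" and t: "t \<in> {0..1}"
    and neq: "\<not> (\<gamma> t = \<gamma>' t \<and> velocity R {0..1} \<gamma> t = velocity R {0..1} \<gamma>' t)"
  shows "\<forall>\<^sub>F s in at t within {0..1}. \<not> (\<gamma> s = \<gamma>' s \<and> velocity R {0..1} \<gamma> s = velocity R {0..1} \<gamma>' s)"
proof (cases "\<gamma> t = \<gamma>' t")
  case False
  then obtain U V where UV: "open U" "open V" "\<gamma> t \<in> U" "\<gamma>' t \<in> V" "U \<inter> V = {}"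
    using hausdorff by metis
  have "(\<gamma> \<longlongrightarrow> \<gamma> t) (at t within {0..1})" "(\<gamma>' \<longlongrightarrow> \<gamma>' t) (at t within {0..1})"
    using geodesic_continuous[OF \<gamma>] geodesic_continuous[OF \<gamma>'] t by (auto simp: continuous_on_def)
  then have "\<forall>\<^sub>F s in at t within {0..1}. \<gamma> s \<in> U" "\<forall>\<^sub>F s in at t within {0..1}. \<gamma>' s \<in> V"
    using UV topological_tendstoD by blast+
  then show ?thesis
    by eventually_elim (use UV(5) in auto)
next
  case True
  obtain c where c: "c \<in> charts_at R (\<gamma> t)"
    using chart_at_in[OF geodesic_in_carrier[OF \<gamma> t]] by blast
  have c': "c \<in> charts_at R (\<gamma>' t)"
    using c True by simp
  have "velocity R {0..1} \<gamma> t c \<noteq> velocity R {0..1} \<gamma>' t c"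
    using tangent_vector_eqI[OF velocity_in_tangent_space[OF \<gamma> t] _ c] velocity_in_tangent_space[OF \<gamma>' t] True neq
    by auto
  moreover have "((\<lambda>s. velocity R {0..1} \<gamma> s c - velocity R {0..1} \<gamma>' s c)
      \<longlongrightarrow> velocity R {0..1} \<gamma> t c - velocity R {0..1} \<gamma>' t c) (at t within {0..1})"
    using has_vector_derivative_continuous[OF geodesic_acceleration[OF \<gamma> t c]]
      has_vector_derivative_continuous[OF geodesic_acceleration[OF \<gamma>' t c']]
    by (intro tendsto_diff) (simp_all add: continuous_within)
  ultimately have "\<forall>\<^sub>F s in at t within {0..1}. velocity R {0..1} \<gamma> s c - velocity R {0..1} \<gamma>' s c \<noteq> 0"
    by (intro tendsto_imp_eventually_ne) auto
  then show ?thesis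
    by eventually_elim auto
qed

text \<open>Agreement of position and velocity is a locally constant property on the connected parameter
  interval.\<close>

theorem geodesic_unique:
  assumes \<gamma>: "geodesic R {0..1} \<gamma>" and \<gamma>': "geodesic R {0..1} \<gamma>'"
    and eq: "\<gamma> 0 = \<gamma>' 0" "velocity R {0..1} \<gamma> 0 = velocity R {0..1} \<gamma>' 0" and t: "t \<in> {0..1}"
  shows "\<gamma> t = \<gamma>' t"
proof -
  let ?A = "\<lambda>t. \<gamma> t = \<gamma>' t \<and> velocity R {0..1} \<gamma> t = velocity R {0..1} \<gamma>' t"
  have "?A 0 = ?A t"
  proof (rule connected_local_const[of "{0..1}" _ _ ?A])
    show "\<forall>a\<in>{0..1}. \<forall>\<^sub>F b in at a within {0..1}. ?A a = ?A b"
    proof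
      fix a :: real assume a: "a \<in> {0..1}"
      show "\<forall>\<^sub>F b in at a within {0..1}. ?A a = ?A b"
      proof (cases "?A a")
        case True
        then show ?thesis
          using geodesic_locally_unique[OF \<gamma> \<gamma>' a] by (auto elim: eventually_mono)
      next
        case False
        then show ?thesis
          using geodesics_stay_apart[OF \<gamma> \<gamma>' a False] by (auto elim: eventually_mono)
      qed
    qed
  qed (use t in auto)
  with eq show ?thesis
    by blast
qed

text \<open>Uniqueness of geodesics makes the definite description in \<^const>\<open>rexp\<close> meaningful.\<close>

lemma rexp_geodesic:
  assumes \<gamma>: "geodesic R {0..1} \<gamma>"
  shows "rexp R (\<gamma> 0) (velocity R {0..1} \<gamma> 0) = \<gamma> 1"
  unfolding rexp_def
proof (rule the_equality)
  show "\<exists>\<gamma>'. geodesic R {0..1} \<gamma>' \<and> \<gamma>' 0 = \<gamma> 0 \<and> velocity R {0..1} \<gamma>' 0 = velocity R {0..1} \<gamma> 0 \<and> \<gamma>' 1 = \<gamma> 1"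
    using \<gamma> by blast
  show "y = \<gamma> 1" if "\<exists>\<gamma>'. geodesic R {0..1} \<gamma>' \<and> \<gamma>' 0 = \<gamma> 0 \<and> velocity R {0..1} \<gamma>' 0 = velocity R {0..1} \<gamma> 0 \<and> \<gamma>' 1 = y" for y
    using that geodesic_unique[OF \<gamma>, of _ 1] by auto
qed

end


section \<open>The exponential map and its inverse\<close>

definition normal_ball ::
  "('a::topological_space, 'e::euclidean_space) riemannian \<Rightarrow> 'a \<Rightarrow> real \<Rightarrow> 'e set" where
  "normal_ball R x r = {a. rnorm R x (tangent_of R x (chart_at R x) a) < r}"

text \<open>The exponential map at \<open>x\<close>, read on the model space through the chosen chart.\<close>

definition exp_in_chart ::
  "('a::topological_space, 'e::euclidean_space) riemannian \<Rightarrow> 'a \<Rightarrow> 'e \<Rightarrow> 'a" where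
  "exp_in_chart R x a = rexp R x (tangent_of R x (chart_at R x) a)"

definition exp_diffeo_on_ball ::
  "('a::topological_space, 'e::euclidean_space) riemannian \<Rightarrow> 'a \<Rightarrow> real \<Rightarrow> bool" where
  "exp_diffeo_on_ball R x r \<longleftrightarrow>
     (\<forall>a\<in>normal_ball R x r. tangent_of R x (chart_at R x) a \<in> exp_dom R x) \<and>
     diffeomorphic_onto_image R (normal_ball R x r) (exp_in_chart R x)"

lemma inj_radius_eq: "inj_radius R x = Sup {ereal r | r. 0 < r \<and> exp_diffeo_on_ball R x r}"
  unfolding inj_radius_def exp_diffeo_on_ball_def normal_ball_def exp_in_chart_def Let_def ..

lemma less_inj_radius_imp_diffeo:
  assumes "ereal d < inj_radius R x"
  shows "\<exists>r>d. 0 < r \<and> exp_diffeo_on_ball R x r"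
  using assms unfolding inj_radius_eq less_Sup_iff by auto

lemma diffeo_imp_le_inj_radius: "0 < r \<Longrightarrow> exp_diffeo_on_ball R x r \<Longrightarrow> ereal r \<le> inj_radius R x"
  unfolding inj_radius_eq by (rule Sup_upper) blast

context riemannian begin

lemma exp_dom_tangent: "v \<in> exp_dom R x \<Longrightarrow> v \<in> tangent_space R x"
  unfolding exp_dom_def using velocity_in_tangent_space[of _ 0] by auto

lemma in_normal_ball:
  assumes "x \<in> manifold_carrier R" "v \<in> tangent_space R x" "rnorm R x v < r"
  shows "v (chart_at R x) \<in> normal_ball R x r"
  using assms tangent_of_component[OF assms(2) chart_at_in[OF assms(1)]] by (simp add: normal_ball_def)

text \<open>Two candidates for the logarithm lie in a common ball on which the exponential map is injective.\<close>

lemma rlog_rexp: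
  assumes x: "x \<in> manifold_carrier R" and v: "v \<in> tangent_space R x" and len: "ereal (rnorm R x v) < inj_radius R x"
  shows "rlog R x (rexp R x v) = v"
  unfolding rlog_def
proof (rule the_equality)
  let ?c = "chart_at R x"
  obtain r where r: "r > rnorm R x v" "0 < r" "exp_diffeo_on_ball R x r"
    using less_inj_radius_imp_diffeo[OF len] by blast
  have "v \<in> exp_dom R x"
    using r(3) in_normal_ball[OF x v r(1)] tangent_of_component[OF v chart_at_in[OF x]]
    by (auto simp: exp_diffeo_on_ball_def)
  then show "v \<in> exp_dom R x \<and> ereal (rnorm R x v) < inj_radius R x \<and> rexp R x v = rexp R x v"
    using len by simp
  fix w assume w: "w \<in> exp_dom R x \<and> ereal (rnorm R x w) < inj_radius R x \<and> rexp R x w = rexp R x v"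
  then have wt: "w \<in> tangent_space R x"
    using exp_dom_tangent by blast
  obtain r' where r': "r' > rnorm R x w" "0 < r'" "exp_diffeo_on_ball R x r'"
    using less_inj_radius_imp_diffeo w by blast
  obtain m where m: "m > rnorm R x v" "m > rnorm R x w" "exp_diffeo_on_ball R x m"
  proof (cases "r \<le> r'")
    case True
    show ?thesis
      by (rule that[of r']) (use r r' True in auto)
  next
    case False
    show ?thesis
      by (rule that[of r]) (use r r' False in auto)
  qed
  have inj: "inj_on (exp_in_chart R x) (normal_ball R x m)"
    using m(3) by (simp add: exp_diffeo_on_ball_def diffeomorphic_onto_image_def)
  have "exp_in_chart R x (w ?c) = exp_in_chart R x (v ?c)"
    using w tangent_of_component[OF v chart_at_in[OF x]] tangent_of_component[OF wt chart_at_in[OF x]]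
    by (simp add: exp_in_chart_def)
  then have "w ?c = v ?c"
    using inj in_normal_ball[OF x v m(1)] in_normal_ball[OF x wt m(2)] by (auto dest: inj_onD)
  then show "w = v"
    using tangent_vector_eqI[OF wt v chart_at_in[OF x]] by simp
qed

lemma rexp_zero:
  assumes x: "x \<in> manifold_carrier R" and len: "0 < inj_radius R x"
  shows "rexp R x (\<lambda>c. 0) = x"
proof -
  have "rnorm R x (\<lambda>c. 0) = 0"
    by (simp add: rnorm_def rinner_zero_left[OF x])
  moreover obtain r where r: "r > 0" "exp_diffeo_on_ball R x r"
    using less_inj_radius_imp_diffeo[of 0 R x] len by (auto simp: zero_ereal_def)
  ultimately have "(\<lambda>c. 0) \<in> exp_dom R x"
    using in_normal_ball[OF x tangent_space_zero, of r] tangent_of_component[OF tangent_space_zero chart_at_in[OF x]]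
    by (auto simp: exp_diffeo_on_ball_def)
  then obtain \<gamma> where \<gamma>: "geodesic R {0..1} \<gamma>" "\<gamma> 0 = x" "velocity R {0..1} \<gamma> 0 = (\<lambda>c. 0)"
    by (auto simp: exp_dom_def)
  \<comment> \<open>Reparametrizing with factor \<open>0\<close> turns any geodesic through \<open>x\<close> into the constant one.\<close>
  have "geodesic R {0..1} (\<lambda>t. \<gamma> (0 + 0 * t))" "velocity R {0..1} (\<lambda>t. \<gamma> (0 + 0 * t)) 0 = (\<lambda>c. 0)"
    using geodesic_affine[OF \<gamma>(1), of 0 0] by simp_all
  then show ?thesis
    using rexp_geodesic[of "\<lambda>t. \<gamma> (0 + 0 * t)"] \<gamma>(2) by simp
qed

lemma exp_in_chart_zero:
  assumes x: "x \<in> manifold_carrier R" and len: "0 < inj_radius R x"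
  shows "exp_in_chart R x 0 = x"
  using tangent_of_component[OF tangent_space_zero chart_at_in[OF x]] rexp_zero[OF assms]
  by (simp add: exp_in_chart_def)

lemma zero_in_normal_ball: "x \<in> manifold_carrier R \<Longrightarrow> 0 < r \<Longrightarrow> 0 \<in> normal_ball R x r"
  by (simp add: normal_ball_def rnorm_tangent_of gram_simps_at)

end

section \<open>Geometry of a small convex domain\<close>

text \<open>The rest of the geometry uses only the comparison inequalities, the fact that logarithms are
  initial velocities of minimizing geodesics, and the bound \<open>D\<close> on all distances, which keeps
  every logarithm within the injectivity radius.\<close>

locale comparison_domain = riemannian R
  for R :: "('a::{second_countable_topology, t2_space}, 'e::euclidean_space) riemannian" +
  fixes X :: "'a set" and Kmin Kmax D C1 C2 C3 C4 :: real
  assumes domain: "manifold_assumption R X Kmin Kmax D"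
    and constants: "comparison_constants R X D C1 C2 C3 C4"
begin

lemma X_carrier: "x \<in> X \<Longrightarrow> x \<in> manifold_carrier R"
  and D_pos: "D > 0"
  and rdist_le_D: "x \<in> X \<Longrightarrow> y \<in> X \<Longrightarrow> rdist R x y \<le> D"
  using domain unfolding manifold_assumption_def by auto

lemma X_convex: "geodesically_convex R X"
  using domain by (simp only: manifold_assumption_def)

lemma D_less_inj_radius:
  assumes "x \<in> X"
  shows "ereal D < inj_radius R x"
proof -
  have "ereal D < (INF x\<in>X. inj_radius R x)"
    using domain unfolding manifold_assumption_def by blast
  then show ?thesis
    using assms by (meson INF_lower order_less_le_trans)
qed

lemma inj_radius_pos: "x \<in> X \<Longrightarrow> 0 < inj_radius R x"
  using D_less_inj_radius[of x] D_pos by (metis ereal_less(2) less_trans)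

lemma C1: "C1 \<ge> 1" and C2: "0 < C2" "C2 \<le> 1" and C4: "C4 \<ge> 0"
  using constants unfolding comparison_constants_def by blast+

lemma comparison_lower:
  "a \<in> X \<Longrightarrow> b \<in> X \<Longrightarrow> c \<in> X \<Longrightarrow>
    C2 * (rdist R b c)\<^sup>2 + (rdist R a b)\<^sup>2 - 2 * rinner R b (rlog R b a) (rlog R b c) \<le> (rdist R a c)\<^sup>2"
  and comparison_upper:
  "a \<in> X \<Longrightarrow> b \<in> X \<Longrightarrow> c \<in> X \<Longrightarrow>
    (rdist R a c)\<^sup>2 \<le> C1 * (rdist R b c)\<^sup>2 + (rdist R a b)\<^sup>2 - 2 * rinner R b (rlog R b a) (rlog R b c)"
  and log_lower:
  "a \<in> X \<Longrightarrow> b \<in> X \<Longrightarrow> c \<in> X \<Longrightarrow>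
    inverse (1 + C3 * D\<^sup>2) * rdist R b c \<le> rnorm R a (\<lambda>k. rlog R a b k - rlog R a c k)"
  and log_upper:
  "a \<in> X \<Longrightarrow> b \<in> X \<Longrightarrow> c \<in> X \<Longrightarrow>
    rnorm R a (\<lambda>k. rlog R a b k - rlog R a c k) \<le> (1 + C4 * D\<^sup>2) * rdist R b c"
  using constants unfolding comparison_constants_def by blast+

lemma minimizing_geodesic_exists:
  assumes "a \<in> X" "b \<in> X"
  shows "\<exists>\<gamma>. minimizing_geodesic R a b \<gamma>"
  using X_convex assms unfolding geodesically_convex_def by blast

lemma minimizing_geodesic_props:
  assumes a: "a \<in> X" and b: "b \<in> X" and \<gamma>: "minimizing_geodesic R a b \<gamma>"
  shows "geodesic R {0..1} \<gamma>" "\<gamma> 0 = a" "\<gamma> 1 = b" "t \<in> {0..1} \<Longrightarrow> \<gamma> t \<in> X"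
    "rnorm R a (velocity R {0..1} \<gamma> 0) = rdist R a b"
proof -
  show g: "geodesic R {0..1} \<gamma>" "\<gamma> 0 = a" "\<gamma> 1 = b"
    using \<gamma> by (auto simp: minimizing_geodesic_def)
  show "t \<in> {0..1} \<Longrightarrow> \<gamma> t \<in> X"
  proof -
    assume t: "t \<in> {0..1}"
    have "\<gamma> ` {0..1} \<subseteq> X"
      using X_convex a b \<gamma> unfolding geodesically_convex_def by simp
    with t show "\<gamma> t \<in> X"
      by blast
  qed
  show "rnorm R a (velocity R {0..1} \<gamma> 0) = rdist R a b"
    using geodesic_length[OF g(1)] \<gamma> g(2) by (simp add: minimizing_geodesic_def)
qed

text \<open>The affine piece of the geodesic from parameter \<open>s\<close> to parameter \<open>t\<close> has initial velocity
  \<open>t - s\<close> times the velocity at \<open>s\<close>. Its length is at most \<open>D\<close>, so it is the logarithm.\<close>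

lemma rlog_along_geodesic:
  assumes a: "a \<in> X" and b: "b \<in> X" and \<gamma>: "minimizing_geodesic R a b \<gamma>"
    and s: "s \<in> {0..1}" and t: "t \<in> {0..1}"
  shows "rlog R (\<gamma> s) (\<gamma> t) = (\<lambda>c. (t - s) *\<^sub>R velocity R {0..1} \<gamma> s c)"
proof -
  note g = minimizing_geodesic_props[OF a b \<gamma>]
  let ?v = "\<lambda>c. (t - s) *\<^sub>R velocity R {0..1} \<gamma> s c"
  have "geodesic R {0..1} (\<lambda>r. \<gamma> (s + (t - s) * r))"
    and "velocity R {0..1} (\<lambda>r. \<gamma> (s + (t - s) * r)) 0 = (\<lambda>c. (t - s) *\<^sub>R velocity R {0..1} \<gamma> (s + (t - s) * 0) c)"
    using geodesic_affine[OF g(1), of s "t - s"] s t by auto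
  then have exp: "rexp R (\<gamma> s) ?v = \<gamma> t"
    using rexp_geodesic[of "\<lambda>r. \<gamma> (s + (t - s) * r)"] by simp
  have "rnorm R (\<gamma> s) ?v = \<bar>t - s\<bar> * rdist R a b"
    using geodesic_constant_speed[OF g(1) s] g(2,5) by (simp add: rnorm_scale[OF X_carrier[OF g(4)[OF s]]])
  also have "\<dots> \<le> 1 * D"
    using rnorm_nonneg[OF X_carrier[OF a], of "velocity R {0..1} \<gamma> 0"] rdist_le_D[OF a b] s t
    unfolding g(5) by (intro mult_mono) auto
  finally have "ereal (rnorm R (\<gamma> s) ?v) < inj_radius R (\<gamma> s)"
    using D_less_inj_radius[OF g(4)[OF s]] by (metis ereal_less_eq(3) mult_1 order_le_less_trans)
  moreover have "?v \<in> tangent_space R (\<gamma> s)"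
    by (rule tangent_space_scale[OF velocity_in_tangent_space[OF g(1) s]])
  ultimately show ?thesis
    using rlog_rexp[OF X_carrier[OF g(4)[OF s]]] exp by metis
qed

definition geo :: "'a \<Rightarrow> 'a \<Rightarrow> real \<Rightarrow> 'a" where
  "geo a b = (SOME \<gamma>. minimizing_geodesic R a b \<gamma>)"

lemma geo_minimizing: "a \<in> X \<Longrightarrow> b \<in> X \<Longrightarrow> minimizing_geodesic R a b (geo a b)"
  unfolding geo_def by (rule someI_ex[where P = "minimizing_geodesic R a b"]) (rule minimizing_geodesic_exists)

lemma geo_in_X: "a \<in> X \<Longrightarrow> b \<in> X \<Longrightarrow> t \<in> {0..1} \<Longrightarrow> geo a b t \<in> X"
  and geo_0: "a \<in> X \<Longrightarrow> b \<in> X \<Longrightarrow> geo a b 0 = a"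
  and geo_1: "a \<in> X \<Longrightarrow> b \<in> X \<Longrightarrow> geo a b 1 = b"
  using minimizing_geodesic_props[OF _ _ geo_minimizing] by blast+

lemma rlog_eq_velocity:
  assumes "a \<in> X" "b \<in> X"
  shows "rlog R a b = velocity R {0..1} (geo a b) 0"
  using rlog_along_geodesic[OF assms geo_minimizing[OF assms], of 0 1] geo_0[OF assms] geo_1[OF assms]
  by simp

lemma rlog_tangent: "a \<in> X \<Longrightarrow> b \<in> X \<Longrightarrow> rlog R a b \<in> tangent_space R a"
  using velocity_in_tangent_space[OF minimizing_geodesic_props(1)[OF _ _ geo_minimizing], of a b 0]
  by (simp add: rlog_eq_velocity geo_0)

lemma rnorm_rlog: "a \<in> X \<Longrightarrow> b \<in> X \<Longrightarrow> rnorm R a (rlog R a b) = rdist R a b"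
  using minimizing_geodesic_props(5)[OF _ _ geo_minimizing] by (simp add: rlog_eq_velocity)

lemma rinner_rlog_self: "a \<in> X \<Longrightarrow> b \<in> X \<Longrightarrow> rinner R a (rlog R a b) (rlog R a b) = (rdist R a b)\<^sup>2"
  using rnorm_power2[OF X_carrier, of a "rlog R a b"] by (simp add: rnorm_rlog)

lemma rexp_rlog: "a \<in> X \<Longrightarrow> b \<in> X \<Longrightarrow> rexp R a (rlog R a b) = b"
  using rexp_geodesic[OF minimizing_geodesic_props(1)[OF _ _ geo_minimizing], of a b]
  by (simp add: rlog_eq_velocity geo_0 geo_1)

lemma rdist_nonneg: "a \<in> X \<Longrightarrow> b \<in> X \<Longrightarrow> rdist R a b \<ge> 0"
  using rnorm_nonneg[OF X_carrier, of a "rlog R a b"] by (simp add: rnorm_rlog)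

text \<open>The reversed minimizing geodesic computes the logarithm at the other end point.\<close>

lemma rdist_sym:
  assumes a: "a \<in> X" and b: "b \<in> X"
  shows "rdist R a b = rdist R b a"
proof -
  note g = minimizing_geodesic_props[OF a b geo_minimizing[OF a b]]
  have "rlog R b a = (\<lambda>c. (0 - 1) *\<^sub>R velocity R {0..1} (geo a b) 1 c)"
    using rlog_along_geodesic[OF a b geo_minimizing[OF a b], of 1 0] g(2,3) by simp
  then have "rdist R b a = rnorm R b (\<lambda>c. (0 - 1) *\<^sub>R velocity R {0..1} (geo a b) 1 c)"
    using rnorm_rlog[OF b a] by simp
  also have "\<dots> = rnorm R (geo a b 1) (velocity R {0..1} (geo a b) 1)"
    using rnorm_scale[OF X_carrier[OF b], of "0 - 1"] g(3) by simp
  also have "\<dots> = rdist R a b"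
    using geodesic_constant_speed[OF g(1), of 1] g(2,5) by simp
  finally show ?thesis ..
qed

text \<open>The lower logarithm estimate for two equal arguments forces the distance to vanish.\<close>

lemma rdist_self: assumes a: "a \<in> X" shows "rdist R a a = 0"
proof -
  have "inverse (1 + C3 * D\<^sup>2) * rdist R a a \<le> 0"
    using log_lower[OF a a a] by (simp add: rnorm_def rinner_zero_left[OF X_carrier[OF a]])
  moreover have "inverse (1 + C3 * D\<^sup>2) > 0"
    using constants by (simp add: comparison_constants_def add_pos_nonneg)
  ultimately show ?thesis
    using rdist_nonneg[OF a a] by (simp add: mult_le_0_iff)
qed

lemma rlog_geo:
  assumes a: "a \<in> X" and b: "b \<in> X" and t: "t \<in> {0..1}"
  shows "rlog R a (geo a b t) = (\<lambda>c. t *\<^sub>R rlog R a b c)"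
  using rlog_along_geodesic[OF a b geo_minimizing[OF a b] _ t, of 0] geo_0[OF a b] rlog_eq_velocity[OF a b] by simp

lemma rdist_geo: "a \<in> X \<Longrightarrow> b \<in> X \<Longrightarrow> t \<in> {0..1} \<Longrightarrow> rdist R a (geo a b t) = t * rdist R a b"
  using rnorm_rlog[of a "geo a b t"] rnorm_scale[OF X_carrier, of a t "rlog R a b"]
  by (simp add: geo_in_X rlog_geo rnorm_rlog)

text \<open>A point on a geodesic is the weighted mean of the end points: the pulls towards them cancel.\<close>

lemma geo_balanced:
  assumes a: "a \<in> X" and b: "b \<in> X" and t: "t \<in> {0..1}"
  shows "(\<lambda>c. (1 - t) *\<^sub>R rlog R (geo a b t) a c + t *\<^sub>R rlog R (geo a b t) b c) = (\<lambda>c. 0)"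
proof -
  have "(1 - t) *\<^sub>R ((0 - t) *\<^sub>R v) + t *\<^sub>R ((1 - t) *\<^sub>R v) = 0" for v :: 'e
    by (simp add: mult.commute)
  moreover have "(0::real) \<in> {0..1}" "(1::real) \<in> {0..1}"
    by simp_all
  ultimately show ?thesis
    using rlog_along_geodesic[OF a b geo_minimizing[OF a b] t, of 0]
      rlog_along_geodesic[OF a b geo_minimizing[OF a b] t, of 1] geo_0[OF a b] geo_1[OF a b]
    by (simp only:)
qed

text \<open>The logarithm is the initial velocity of the connecting geodesic. Writing it as a limit of difference
  quotients is what makes it a measurable function of both end points.\<close>

lemma chart_rlog_LIMSEQ:
  assumes a: "a \<in> X" and b: "b \<in> X" and c: "c \<in> charts_at R a"
  shows "(\<lambda>k. real (Suc k) *\<^sub>R (chart_map c (geo a b (1 / Suc k)) - chart_map c a)) \<longlonglongrightarrow> rlog R a b c"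
proof -
  note g = minimizing_geodesic_props[OF a b geo_minimizing[OF a b]]
  have "((\<lambda>s. chart_map c (geo a b s)) has_vector_derivative rlog R a b c) (at 0 within {0..1})"
    using geodesic_position[OF g(1), of 0 c] g(2) c by (simp add: rlog_eq_velocity[OF a b])
  then have "((\<lambda>s. (1 / norm (s - 0)) *\<^sub>R (chart_map c (geo a b s) - (chart_map c a + (s - 0) *\<^sub>R rlog R a b c)))
      \<longlongrightarrow> 0) (at 0 within {0..1})"
    unfolding has_vector_derivative_def has_derivative_within g(2) by blast
  moreover have "filterlim (\<lambda>k. 1 / real (Suc k)) (at 0 within {0..1}) sequentially"
    unfolding filterlim_at using LIMSEQ_inverse_real_of_nat by (auto simp: divide_simps inverse_eq_divide)
  ultimately have "(\<lambda>k. (1 / norm (1 / real (Suc k) - 0)) *\<^sub>R (chart_map c (geo a b (1 / real (Suc k)))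
      - (chart_map c a + (1 / real (Suc k) - 0) *\<^sub>R rlog R a b c))) \<longlonglongrightarrow> 0"
    by (rule filterlim_compose)
  moreover have "(1 / norm (1 / real (Suc k) - 0)) *\<^sub>R (p - (q + (1 / real (Suc k) - 0) *\<^sub>R v))
      = real (Suc k) *\<^sub>R (p - q) - v" for k and p q v :: 'e
    by (simp add: scaleR_diff_right scaleR_add_right algebra_simps del: of_nat_Suc)
  ultimately have "(\<lambda>k. real (Suc k) *\<^sub>R (chart_map c (geo a b (1 / Suc k)) - chart_map c a) - rlog R a b c) \<longlonglongrightarrow> 0"
    by (simp only:)
  then show ?thesis
    by (simp add: LIM_zero_iff)
qed

lemma Cauchy_Schwarz_rlog:
  assumes "a \<in> X" "b \<in> X" "c \<in> X"
  shows "\<bar>rinner R a (rlog R a b) (rlog R a c)\<bar> \<le> rdist R a b * rdist R a c"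
  using rinner_Cauchy_Schwarz[OF X_carrier[OF assms(1)]] rnorm_rlog assms by metis

text \<open>The upper comparison inequality together with Cauchy-Schwarz replaces the triangle inequality.\<close>

lemma rdist_power2_Lipschitz:
  assumes a: "a \<in> X" and b: "b \<in> X" and c: "c \<in> X"
  shows "\<bar>(rdist R a c)\<^sup>2 - (rdist R a b)\<^sup>2\<bar> \<le> (C1 + 2) * D * rdist R b c"
proof -
  have one: "(rdist R a c)\<^sup>2 - (rdist R a b)\<^sup>2 \<le> (C1 + 2) * D * rdist R b c" if b: "b \<in> X" and c: "c \<in> X" for b c
  proof -
    have "(rdist R a c)\<^sup>2 - (rdist R a b)\<^sup>2 \<le> C1 * (rdist R b c)\<^sup>2 + 2 * (rdist R b a * rdist R b c)"
      using comparison_upper[OF a b c] Cauchy_Schwarz_rlog[OF b a c] by linarith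
    also have "\<dots> \<le> C1 * (D * rdist R b c) + 2 * (D * rdist R b c)"
      unfolding power2_eq_square using C1 rdist_le_D a b c rdist_nonneg
      by (intro add_mono mult_left_mono mult_right_mono) auto
    finally show ?thesis
      by (simp add: algebra_simps)
  qed
  show ?thesis
    using one[OF b c] one[OF c b] rdist_sym[OF b c] by (simp add: abs_le_iff)
qed

subsection \<open>The distance induces the topology\<close>

text \<open>Near \<open>p\<close> the inverse of the exponential map is continuous, and the distance from \<open>p\<close> is the
  length of the logarithm.\<close>

lemma rdist_tendsto_0:
  assumes p: "p \<in> X" and z: "(z \<longlongrightarrow> p) F" and zX: "\<forall>\<^sub>F i in F. z i \<in> X"
  shows "((\<lambda>i. rdist R p (z i)) \<longlongrightarrow> 0) F"
proof -
  let ?c = "chart_at R p" and ?h = "exp_in_chart R p"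
  note pc = chart_at_props[OF X_carrier[OF p]]
  obtain r where r: "0 < r" "exp_diffeo_on_ball R p r"
    using less_inj_radius_imp_diffeo[OF D_less_inj_radius[OF p]] by blast
  define S where "S = normal_ball R p r"
  have diff: "diffeomorphic_onto_image R S ?h" and dom: "\<And>a. a \<in> S \<Longrightarrow> tangent_of R p ?c a \<in> exp_dom R p"
    using r(2) by (auto simp: exp_diffeo_on_ball_def S_def)
  have h: "open (?h ` S)" "inj_on ?h S"
    "smooth_on (chart_map ?c ` (?h ` S \<inter> chart_dom ?c)) (\<lambda>q. inv_into S ?h (chart_inv ?c q))"
    using diff pc(1) unfolding diffeomorphic_onto_image_def by blast+
  have S0: "0 \<in> S" "?h 0 = p"
    using zero_in_normal_ball[OF X_carrier[OF p] r(1)] exp_in_chart_zero[OF X_carrier[OF p] inj_radius_pos[OF p]]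
    by (auto simp: S_def)
  then have pS: "p \<in> ?h ` S"
    by force
  have "open (?h ` S \<inter> chart_dom ?c)"
    using h(1) open_chart_dom[OF pc(1)] by blast
  then have ev: "\<forall>\<^sub>F i in F. z i \<in> ?h ` S \<inter> chart_dom ?c"
    using z pS pc(2) by (intro topological_tendstoD) auto
  define a where "a = (\<lambda>i. inv_into S ?h (z i))"
  have "((\<lambda>i. chart_map ?c (z i)) \<longlongrightarrow> chart_map ?c p) F"
    using ev by (intro continuous_on_tendsto_compose[OF continuous_chart_map[OF pc(1)] z pc(2)])
      (auto elim: eventually_mono)
  then have "((\<lambda>i. inv_into S ?h (chart_inv ?c (chart_map ?c (z i)))) \<longlongrightarrow> inv_into S ?h (chart_inv ?c (chart_map ?c p))) F"
    by (rule continuous_on_tendsto_compose[OF smooth_on_continuous[OF h(3)]])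
       (use pS pc(2) ev in \<open>auto elim: eventually_mono\<close>)
  moreover have "\<forall>\<^sub>F i in F. inv_into S ?h (chart_inv ?c (chart_map ?c (z i))) = a i"
    using ev by eventually_elim (simp add: a_def chart_inv_map[OF pc(1)])
  moreover have "inv_into S ?h (chart_inv ?c (chart_map ?c p)) = 0"
    using S0 h(2) chart_inv_map[OF pc(1,2)] inv_into_f_f by metis
  ultimately have a: "(a \<longlongrightarrow> 0) F"
    by (simp add: tendsto_cong)
  obtain L where L: "L \<ge> 0" "\<And>u v. \<bar>gram R ?c (chart_map ?c p) u v\<bar> \<le> L * (norm u * norm v)"
    using gram_Lipschitz_on_cball[OF pc(1), of "chart_map ?c p" 0] pc(3) by auto
  have bound: "\<forall>\<^sub>F i in F. \<bar>rdist R p (z i)\<bar> \<le> sqrt (L * (norm (a i) * norm (a i)))"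
    using ev zX
  proof eventually_elim
    case (elim i)
    have ai: "a i \<in> S" "?h (a i) = z i"
      using elim by (auto simp: a_def inv_into_into f_inv_into_f)
    let ?v = "tangent_of R p ?c (a i)"
    have "ereal (rnorm R p ?v) < inj_radius R p"
      using ai(1) diffeo_imp_le_inj_radius[OF r] unfolding S_def normal_ball_def
      by (metis less_ereal.simps(1) mem_Collect_eq order_less_le_trans)
    then have "rlog R p (z i) = ?v"
      using rlog_rexp[OF X_carrier[OF p] exp_dom_tangent[OF dom[OF ai(1)]]] ai(2) by (simp add: exp_in_chart_def)
    then have "rdist R p (z i) = sqrt (gram R ?c (chart_map ?c p) (a i) (a i))"
      using rnorm_rlog[OF p elim(2)] rnorm_tangent_of[OF X_carrier[OF p]] by simp
    then show ?case
      using L(2)[of "a i" "a i"] gram_nonneg[OF pc(1,3), of "a i"] by simp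
  qed
  have "((\<lambda>i. sqrt (L * (norm (a i) * norm (a i)))) \<longlongrightarrow> sqrt (L * (norm (0::'e) * norm (0::'e)))) F"
    by (intro tendsto_intros a)
  then have "((\<lambda>i. sqrt (L * (norm (a i) * norm (a i)))) \<longlongrightarrow> 0) F"
    by (simp only: norm_zero mult_zero_right real_sqrt_zero)
  then show ?thesis
    by (rule Lim_null_comparison[OF bound[folded real_norm_def]])
qed

text \<open>Conversely, short logarithms have small components in the chart, because the metric at \<open>p\<close> is
  positive definite, and the exponential map at \<open>p\<close> is continuous.\<close>

lemma tendsto_of_rdist:
  assumes p: "p \<in> X" and z: "((\<lambda>i. rdist R p (z i)) \<longlongrightarrow> 0) F" and zX: "\<forall>\<^sub>F i in F. z i \<in> X"
  shows "(z \<longlongrightarrow> p) F"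
proof -
  let ?c = "chart_at R p" and ?h = "exp_in_chart R p"
  note pc = chart_at_props[OF X_carrier[OF p]]
  obtain r where r: "D < r" "0 < r" "exp_diffeo_on_ball R p r"
    using less_inj_radius_imp_diffeo[OF D_less_inj_radius[OF p]] by blast
  have cont: "continuous_on (normal_ball R p r) ?h"
    using r(3) by (simp add: exp_diffeo_on_ball_def diffeomorphic_onto_image_def)
  define a where "a = (\<lambda>i. rlog R p (z i) ?c)"
  have za: "\<forall>\<^sub>F i in F. ?h (a i) = z i \<and> a i \<in> normal_ball R p r \<and>
      gram R ?c (chart_map ?c p) (a i) (a i) = (rdist R p (z i))\<^sup>2"
    using zX
  proof eventually_elim
    case (elim i)
    have "?h (a i) = z i"
      using rexp_rlog[OF p elim] tangent_of_component[OF rlog_tangent[OF p elim] chart_at_in[OF X_carrier[OF p]]]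
      by (simp add: exp_in_chart_def a_def)
    moreover have "a i \<in> normal_ball R p r"
      unfolding a_def using rdist_le_D[OF p elim] r(1)
      by (intro in_normal_ball[OF X_carrier[OF p] rlog_tangent[OF p elim]]) (simp add: rnorm_rlog[OF p elim])
    ultimately show ?case
      using rinner_rlog_self[OF p elim] by (simp add: rinner_def a_def Let_def)
  qed
  obtain m where m: "m > 0" "\<And>u. m * (norm u)\<^sup>2 \<le> gram R ?c (chart_map ?c p) u u"
    using gram_elliptic_on_cball[OF pc(1), of "chart_map ?c p" 0] pc(3) by auto
  have "((\<lambda>i. sqrt ((rdist R p (z i))\<^sup>2 / m)) \<longlongrightarrow> sqrt (0\<^sup>2 / m)) F"
    using z m(1) by (intro tendsto_intros) auto
  then have lim: "((\<lambda>i. sqrt ((rdist R p (z i))\<^sup>2 / m)) \<longlongrightarrow> 0) F"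
    by (simp only: zero_power2 div_0 real_sqrt_zero)
  have "\<forall>\<^sub>F i in F. norm (a i) \<le> sqrt ((rdist R p (z i))\<^sup>2 / m)"
    using za
  proof eventually_elim
    case (elim i)
    then have "(norm (a i))\<^sup>2 \<le> (rdist R p (z i))\<^sup>2 / m"
      using m(2)[of "a i"] m(1) by (simp add: field_simps)
    then show ?case
      by (rule real_le_rsqrt)
  qed
  then have "(a \<longlongrightarrow> 0) F"
    using lim by (rule Lim_null_comparison)
  then have "((\<lambda>i. ?h (a i)) \<longlongrightarrow> ?h 0) F"
    using za by (intro continuous_on_tendsto_compose[OF cont _ zero_in_normal_ball[OF X_carrier[OF p] r(2)]])
      (auto elim: eventually_mono)
  moreover have "?h 0 = p"
    by (rule exp_in_chart_zero[OF X_carrier[OF p] inj_radius_pos[OF p]])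
  moreover have "\<forall>\<^sub>F i in F. ?h (a i) = z i"
    using za by eventually_elim blast
  ultimately show ?thesis
    by (simp add: tendsto_cong)
qed

lemma rdist_eq_0_imp_eq:
  assumes "a \<in> X" "b \<in> X" "rdist R a b = 0"
  shows "a = b"
proof -
  have "(\<lambda>_::nat. b) \<longlonglongrightarrow> a"
    by (rule tendsto_of_rdist) (use assms in auto)
  then show ?thesis
    using LIMSEQ_unique tendsto_const by blast
qed

lemma continuous_rdist_power2: "continuous_on (X \<times> X) (\<lambda>(a, b). (rdist R a b)\<^sup>2)"
  unfolding continuous_on_def
proof
  fix ab assume ab: "ab \<in> X \<times> X"
  obtain a b where [simp]: "ab = (a, b)" and a: "a \<in> X" and b: "b \<in> X"
    using ab by auto
  let ?F = "at (a, b) within X \<times> X"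
  have ev: "\<forall>\<^sub>F z in ?F. fst z \<in> X" "\<forall>\<^sub>F z in ?F. snd z \<in> X"
    unfolding eventually_at_filter by (rule always_eventually, auto)+
  have "((\<lambda>z. rdist R a (fst z)) \<longlongrightarrow> 0) ?F" "((\<lambda>z. rdist R b (snd z)) \<longlongrightarrow> 0) ?F"
    using tendsto_fst[OF tendsto_ident_at, of "(a, b)" "X \<times> X"] tendsto_snd[OF tendsto_ident_at, of "(a, b)" "X \<times> X"]
    by (auto intro!: rdist_tendsto_0 a b ev)
  then have "((\<lambda>z. (C1 + 2) * D * rdist R b (snd z) + (C1 + 2) * D * rdist R a (fst z)) \<longlongrightarrow>
      (C1 + 2) * D * 0 + (C1 + 2) * D * 0) ?F"
    by (intro tendsto_intros)
  then have lim: "((\<lambda>z. (C1 + 2) * D * rdist R b (snd z) + (C1 + 2) * D * rdist R a (fst z)) \<longlongrightarrow> 0) ?F"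
    by simp
  have "\<forall>\<^sub>F z in ?F. norm ((rdist R (fst z) (snd z))\<^sup>2 - (rdist R a b)\<^sup>2)
      \<le> (C1 + 2) * D * rdist R b (snd z) + (C1 + 2) * D * rdist R a (fst z)"
    using ev
  proof eventually_elim
    case (elim z)
    then show ?case
      using rdist_power2_Lipschitz[OF elim(1) b elim(2)] rdist_power2_Lipschitz[OF b a elim(1)]
        rdist_sym[OF b elim(1)] rdist_sym[OF b a] by simp
  qed
  then have "((\<lambda>z. (rdist R (fst z) (snd z))\<^sup>2 - (rdist R a b)\<^sup>2) \<longlongrightarrow> 0) ?F"
    using lim by (rule Lim_null_comparison)
  then show "((\<lambda>(a, b). (rdist R a b)\<^sup>2) \<longlongrightarrow> (\<lambda>(a, b). (rdist R a b)\<^sup>2) ab) (at ab within X \<times> X)"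
    by (simp add: LIM_zero_iff case_prod_unfold)
qed

section \<open>Barycenters\<close>

definition dispersion :: "('k::finite \<Rightarrow> real) \<Rightarrow> ('k \<Rightarrow> 'a) \<Rightarrow> 'a \<Rightarrow> real" where
  "dispersion w p q = (\<Sum>k\<in>UNIV. w k * (rdist R (p k) q)\<^sup>2)"

text \<open>The first order condition for a minimizer of the dispersion, tested in the directions of
  points of \<open>X\<close>. It is satisfied both by minimizers and by points on geodesics, and it implies strong
  convexity of the dispersion at \<open>m\<close>.\<close>

definition barycenter :: "('k::finite \<Rightarrow> real) \<Rightarrow> ('k \<Rightarrow> 'a) \<Rightarrow> 'a \<Rightarrow> bool" where
  "barycenter w p m \<longleftrightarrow> m \<in> X \<and>
     (\<forall>q\<in>X. (\<Sum>k\<in>UNIV. w k * rinner R m (rlog R m (p k)) (rlog R m q)) \<le> 0)"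

context
  fixes w :: "'k::finite \<Rightarrow> real" and p :: "'k \<Rightarrow> 'a"
  assumes w: "\<And>k. w k \<ge> 0" "(\<Sum>k\<in>UNIV. w k) = 1" and p: "\<And>k. p k \<in> X"
begin

text \<open>Moving \<open>m\<close> towards \<open>q\<close> along the geodesic stays in \<open>X\<close> and changes the dispersion to first order by
  the inner products of logarithms; the upper comparison inequality bounds the second order term.\<close>

lemma approximate_minimizer_slope:
  assumes m: "m \<in> X" and eps: "\<And>q. q \<in> X \<Longrightarrow> dispersion w p m \<le> dispersion w p q + \<epsilon>"
    and q: "q \<in> X" and t: "t \<in> {0..1}"
  shows "2 * t * (\<Sum>k\<in>UNIV. w k * rinner R m (rlog R m (p k)) (rlog R m q)) \<le> \<epsilon> + C1 * t\<^sup>2 * D\<^sup>2"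
proof -
  let ?c = "geo m q t"
  have c: "?c \<in> X"
    by (rule geo_in_X[OF m q t])
  have "rdist R m ?c \<le> t * D"
    using rdist_geo[OF m q t] rdist_le_D[OF m q] t by (simp add: mult_left_mono)
  then have dc: "(rdist R m ?c)\<^sup>2 \<le> t\<^sup>2 * D\<^sup>2"
    using rdist_nonneg[OF m c] by (metis power_mono power_mult_distrib)
  have "(rdist R (p k) ?c)\<^sup>2 \<le> C1 * (t\<^sup>2 * D\<^sup>2) + (rdist R (p k) m)\<^sup>2
      - 2 * t * rinner R m (rlog R m (p k)) (rlog R m q)" for k
  proof -
    have "(rdist R (p k) ?c)\<^sup>2 \<le> C1 * (rdist R m ?c)\<^sup>2 + (rdist R (p k) m)\<^sup>2
        - 2 * (t * rinner R m (rlog R m (p k)) (rlog R m q))"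
      using comparison_upper[OF p m c, of k]
      by (simp only: rlog_geo[OF m q t] rinner_scale_right[OF X_carrier[OF m]])
    moreover have "C1 * (rdist R m ?c)\<^sup>2 \<le> C1 * (t\<^sup>2 * D\<^sup>2)"
      using dc C1 by (intro mult_left_mono) auto
    ultimately show ?thesis
      by linarith
  qed
  then have "dispersion w p ?c \<le> (\<Sum>k\<in>UNIV. w k * (C1 * (t\<^sup>2 * D\<^sup>2) + (rdist R (p k) m)\<^sup>2
      - 2 * t * rinner R m (rlog R m (p k)) (rlog R m q)))"
    unfolding dispersion_def by (intro sum_mono mult_left_mono w(1))
  also have "\<dots> = (\<Sum>k\<in>UNIV. w k) * (C1 * (t\<^sup>2 * D\<^sup>2)) + dispersion w p m
      - 2 * t * (\<Sum>k\<in>UNIV. w k * rinner R m (rlog R m (p k)) (rlog R m q))"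
    by (simp add: dispersion_def distrib_left right_diff_distrib sum.distrib sum_subtractf
        sum_distrib_left sum_distrib_right mult.assoc mult.left_commute)
  finally show ?thesis
    using eps[OF c] by (simp add: w(2) mult.assoc)
qed

lemma minimizer_is_barycenter:
  assumes m: "m \<in> X" and min: "\<And>q. q \<in> X \<Longrightarrow> dispersion w p m \<le> dispersion w p q"
  shows "barycenter w p m"
  unfolding barycenter_def
proof (intro conjI ballI m)
  fix q assume q: "q \<in> X"
  let ?s = "\<Sum>k\<in>UNIV. w k * rinner R m (rlog R m (p k)) (rlog R m q)"
  have "?s \<le> e" if e: "e > 0" for e
  proof -
    \<comment> \<open>The second order term is of size \<open>t\<close> after division by \<open>t\<close>; this choice makes it at most \<open>e\<close>.\<close>
    define t where "t = min 1 (e / (C1 * D\<^sup>2))"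
    have CD: "C1 * D\<^sup>2 > 0"
      using C1 D_pos by simp
    have t: "t \<in> {0..1}" "t > 0" "t * (C1 * D\<^sup>2) \<le> e"
      using e CD by (auto simp: t_def min_def field_simps)
    have "2 * t * ?s \<le> 0 + C1 * t\<^sup>2 * D\<^sup>2"
      by (rule approximate_minimizer_slope[OF m _ q t(1)]) (use min in simp)
    then have "t * (2 * ?s) \<le> t * (t * (C1 * D\<^sup>2))"
      by (simp add: power2_eq_square algebra_simps)
    then have "2 * ?s \<le> t * (C1 * D\<^sup>2)"
      using t(2) by simp
    then show ?thesis
      using t(3) e by linarith
  qed
  then show "?s \<le> 0"
    by (rule field_le_epsilon[of ?s 0, simplified])
qed

text \<open>The weighted sum of the lower comparison inequalities at \<open>m\<close>; the first order terms have a sign.\<close>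

lemma barycenter_strong_convexity:
  assumes m: "barycenter w p m" and q: "q \<in> X"
  shows "C2 * (rdist R m q)\<^sup>2 \<le> dispersion w p q - dispersion w p m"
proof -
  have mX: "m \<in> X"
    using m by (simp add: barycenter_def)
  have "(\<Sum>k\<in>UNIV. w k * (C2 * (rdist R m q)\<^sup>2 + (rdist R (p k) m)\<^sup>2 - 2 * rinner R m (rlog R m (p k)) (rlog R m q)))
      \<le> dispersion w p q"
    unfolding dispersion_def using comparison_lower[OF p mX q] by (intro sum_mono mult_left_mono w(1))
  moreover have "(\<Sum>k\<in>UNIV. w k * (C2 * (rdist R m q)\<^sup>2 + (rdist R (p k) m)\<^sup>2 - 2 * rinner R m (rlog R m (p k)) (rlog R m q)))
      = (\<Sum>k\<in>UNIV. w k) * (C2 * (rdist R m q)\<^sup>2) + dispersion w p m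
        - 2 * (\<Sum>k\<in>UNIV. w k * rinner R m (rlog R m (p k)) (rlog R m q))"
    by (simp add: dispersion_def distrib_left right_diff_distrib sum.distrib sum_subtractf
        sum_distrib_left sum_distrib_right mult.assoc mult.left_commute)
  ultimately show ?thesis
    using m q by (auto simp: barycenter_def w(2))
qed

lemma barycenter_unique:
  assumes "barycenter w p m" "barycenter w p m'"
  shows "m = m'"
proof -
  have X: "m \<in> X" "m' \<in> X"
    using assms by (auto simp: barycenter_def)
  have "C2 * (rdist R m m')\<^sup>2 + C2 * (rdist R m' m)\<^sup>2 \<le> 0"
    using barycenter_strong_convexity[OF assms(1) X(2)] barycenter_strong_convexity[OF assms(2) X(1)] by linarith
  then have "C2 * (rdist R m m')\<^sup>2 \<le> 0"
    using rdist_sym[OF X] by simp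
  then have "rdist R m m' = 0"
    using C2(1) by (simp add: mult_le_0_iff)
  then show ?thesis
    by (rule rdist_eq_0_imp_eq[OF X])
qed

end

lemma geo_barycenter:
  assumes a: "a \<in> X" and b: "b \<in> X" and t: "t \<in> {0..1}"
  shows "barycenter (\<lambda>k. if k then 1 - t else t) (\<lambda>k. if k then a else b) (geo a b t)"
  unfolding barycenter_def
proof (intro conjI ballI geo_in_X[OF a b t])
  fix q assume q: "q \<in> X"
  let ?m = "geo a b t"
  note mc = X_carrier[OF geo_in_X[OF a b t]]
  have "(1 - t) * rinner R ?m (rlog R ?m a) (rlog R ?m q) + t * rinner R ?m (rlog R ?m b) (rlog R ?m q)
     = rinner R ?m (\<lambda>c. (1 - t) *\<^sub>R rlog R ?m a c + t *\<^sub>R rlog R ?m b c) (rlog R ?m q)"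
    by (simp only: rinner_add_left[OF mc] rinner_scale_left[OF mc])
  also have "\<dots> = 0"
    unfolding geo_balanced[OF a b t] by (rule rinner_zero_left[OF mc])
  finally show "(\<Sum>k\<in>UNIV. (if k then 1 - t else t) *
      rinner R ?m (rlog R ?m (if k then a else b)) (rlog R ?m q)) \<le> 0"
    by (simp add: UNIV_bool)
qed

text \<open>Strong convexity at the barycenters of two configurations bounds their squared distance by the
  change of the dispersion, which is Lipschitz in the configuration. Continuity is meant with
  respect to the product topology on configurations.\<close>

lemma barycenter_continuous:
  fixes w :: "'k::finite \<Rightarrow> real"
  assumes w: "\<And>k. w k \<ge> 0" "(\<Sum>k\<in>UNIV. w k) = 1"
    and A: "\<And>p. p \<in> A \<Longrightarrow> barycenter w p (\<mu> p) \<and> (\<forall>k. p k \<in> X)"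
  shows "continuous_on A \<mu>"
  unfolding continuous_on_def
proof
  fix p assume p: "p \<in> A"
  let ?F = "at p within A"
  have bp: "barycenter w p (\<mu> p)" and pX: "\<And>k. p k \<in> X" and mX: "\<mu> p \<in> X"
    using A[OF p] by (auto simp: barycenter_def)
  have evA: "\<forall>\<^sub>F q in ?F. q \<in> A"
    by (simp add: eventually_at_filter)
  have coord: "((\<lambda>q. rdist R (p k) (q k)) \<longlongrightarrow> 0) ?F" for k
  proof (rule rdist_tendsto_0[OF pX])
    show "((\<lambda>q. q k) \<longlongrightarrow> p k) ?F"
      using continuous_on_subset[OF continuous_on_product_coordinates subset_UNIV, of A k] p
      by (simp add: continuous_on_def)
    show "\<forall>\<^sub>F q in ?F. q k \<in> X"
      using evA by eventually_elim (use A in blast)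
  qed
  have bound: "C2 * (rdist R (\<mu> p) (\<mu> q))\<^sup>2 \<le> (\<Sum>k\<in>UNIV. w k * ((C1 + 2) * D * rdist R (p k) (q k)))"
    if q: "q \<in> A" for q
  proof -
    have bq: "barycenter w q (\<mu> q)" and qX: "\<And>k. q k \<in> X" and nX: "\<mu> q \<in> X"
      using A[OF q] by (auto simp: barycenter_def)
    have diff: "\<bar>dispersion w q z - dispersion w p z\<bar> \<le> (\<Sum>k\<in>UNIV. w k * ((C1 + 2) * D * rdist R (p k) (q k)))"
      if z: "z \<in> X" for z
    proof -
      have "\<bar>dispersion w q z - dispersion w p z\<bar> \<le> (\<Sum>k\<in>UNIV. \<bar>w k * ((rdist R (q k) z)\<^sup>2 - (rdist R (p k) z)\<^sup>2)\<bar>)"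
        unfolding dispersion_def sum_subtractf[symmetric] right_diff_distrib[symmetric] by (rule sum_abs)
      also have "\<dots> \<le> (\<Sum>k\<in>UNIV. w k * ((C1 + 2) * D * rdist R (p k) (q k)))"
        using rdist_power2_Lipschitz[OF z pX qX] rdist_sym[OF z pX] rdist_sym[OF z qX] w(1)
        by (intro sum_mono) (simp add: abs_mult mult_left_mono)
      finally show ?thesis .
    qed
    have "2 * (C2 * (rdist R (\<mu> p) (\<mu> q))\<^sup>2)
        \<le> (dispersion w p (\<mu> q) - dispersion w q (\<mu> q)) + (dispersion w q (\<mu> p) - dispersion w p (\<mu> p))"
      using barycenter_strong_convexity[OF w pX bp nX] barycenter_strong_convexity[OF w qX bq mX]
        rdist_sym[OF mX nX] by simp
    then show ?thesis
      using diff[OF nX] diff[OF mX] by linarith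
  qed
  have "((\<lambda>q. sqrt ((\<Sum>k\<in>UNIV. w k * ((C1 + 2) * D * rdist R (p k) (q k))) / C2)) \<longlongrightarrow>
      sqrt ((\<Sum>k\<in>UNIV. w k * ((C1 + 2) * D * 0)) / C2)) ?F"
    using C2(1) by (intro tendsto_intros coord) auto
  then have lim: "((\<lambda>q. sqrt ((\<Sum>k\<in>UNIV. w k * ((C1 + 2) * D * rdist R (p k) (q k))) / C2)) \<longlongrightarrow> 0) ?F"
    by (simp only: mult_zero_right sum.neutral_const div_0 real_sqrt_zero)
  have "\<forall>\<^sub>F q in ?F. norm (rdist R (\<mu> p) (\<mu> q)) \<le> sqrt ((\<Sum>k\<in>UNIV. w k * ((C1 + 2) * D * rdist R (p k) (q k))) / C2)"
    using evA
  proof eventually_elim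
    case (elim q)
    have "(rdist R (\<mu> p) (\<mu> q))\<^sup>2 \<le> (\<Sum>k\<in>UNIV. w k * ((C1 + 2) * D * rdist R (p k) (q k))) / C2"
      using bound[OF elim] C2(1) by (simp add: field_simps)
    then show ?case
      by (simp add: real_le_rsqrt)
  qed
  then have "((\<lambda>q. rdist R (\<mu> p) (\<mu> q)) \<longlongrightarrow> 0) ?F"
    using lim by (rule Lim_null_comparison)
  moreover have "\<forall>\<^sub>F q in ?F. \<mu> q \<in> X"
    using evA by eventually_elim (use A in \<open>auto simp: barycenter_def\<close>)
  ultimately show "(\<mu> \<longlongrightarrow> \<mu> p) ?F"
    by (rule tendsto_of_rdist[OF mX])
qed

end


section \<open>Measurability\<close>

text \<open>This covers domains \<open>A\<close> that are not Borel sets, such as a convex set with an arbitrary part of its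
  boundary.\<close>

lemma measurable_continuous_on_compose:
  fixes f :: "'a::topological_space \<Rightarrow> 'b::topological_space"
  assumes a: "a \<in> borel_measurable M" and A: "\<And>\<omega>. \<omega> \<in> space M \<Longrightarrow> a \<omega> \<in> A" and f: "continuous_on A f"
  shows "(\<lambda>\<omega>. f (a \<omega>)) \<in> borel_measurable M"
  using measurable_compose[OF measurable_restrict_space2[OF _ a] borel_measurable_continuous_on_restrict[OF f]] A
  by blast

lemma measurable_continuous_on_open_part:
  fixes f :: "'a::topological_space \<Rightarrow> 'b::real_normed_vector"
  assumes a: "a \<in> borel_measurable M" and A: "\<And>\<omega>. \<omega> \<in> space M \<Longrightarrow> a \<omega> \<in> A" and U: "open U"
    and f: "continuous_on (A \<inter> U) f"
  shows "(\<lambda>\<omega>. if a \<omega> \<in> U then f (a \<omega>) else 0) \<in> borel_measurable M"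
proof (subst measurable_If_restrict_space_iff)
  show "{\<omega> \<in> space M. a \<omega> \<in> U} \<in> sets M"
    using measurable_sets[OF a, of U] U by (simp add: vimage_def Int_def conj_commute)
  have "(\<lambda>\<omega>. f (a \<omega>)) \<in> borel_measurable (restrict_space M {\<omega>. a \<omega> \<in> U})"
    by (rule measurable_continuous_on_compose[OF measurable_restrict_space1[OF a] _ f])
       (use A in \<open>auto simp: space_restrict_space\<close>)
  then show "(\<lambda>\<omega>. f (a \<omega>)) \<in> borel_measurable (restrict_space M {\<omega>. a \<omega> \<in> U}) \<and>
      (\<lambda>\<omega>. 0) \<in> borel_measurable (restrict_space M {\<omega>. a \<omega> \<notin> U})"
    by simp
qed

context riemannian begin

definition bounded_chart_part :: "'a set \<Rightarrow> bool" where
  "bounded_chart_part V \<longleftrightarrow> open V \<and> (\<exists>c\<in>atlas R. V \<subseteq> chart_dom c \<and> (\<exists>m>0. \<exists>L\<ge>0. \<forall>x\<in>V. \<forall>u v.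
      m * (norm u)\<^sup>2 \<le> gram R c (chart_map c x) u u \<and>
      \<bar>gram R c (chart_map c x) u v\<bar> \<le> L * (norm u * norm v)))"

text \<open>Since \<^const>\<open>chart_at\<close> is an arbitrary choice, measurability of inner products is obtained
  from countably many charts; the bounds on the metric serve to dominate components of
  vectors of bounded length.\<close>

lemma countable_cover_by_bounded_chart_parts:
  "\<exists>\<V>. countable \<V> \<and> manifold_carrier R \<subseteq> \<Union>\<V> \<and> (\<forall>V\<in>\<V>. bounded_chart_part V)"
proof -
  have local: "\<exists>V. bounded_chart_part V \<and> x \<in> V" if x: "x \<in> manifold_carrier R" for x
  proof -
    let ?c = "chart_at R x"
    note xc = chart_at_props[OF x]
    obtain r where r: "r > 0" "cball (chart_map ?c x) r \<subseteq> chart_image ?c"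
      using open_chart_image[OF xc(1)] xc(3) unfolding open_contains_cball by blast
    obtain m where m: "m > 0" "\<And>p u. p \<in> cball (chart_map ?c x) r \<Longrightarrow> m * (norm u)\<^sup>2 \<le> gram R ?c p u u"
      using gram_elliptic_on_cball[OF xc(1) r(2)] r(1) by auto
    obtain L where L: "L \<ge> 0" "\<And>p u v. p \<in> cball (chart_map ?c x) r \<Longrightarrow> \<bar>gram R ?c p u v\<bar> \<le> L * (norm u * norm v)"
      using gram_Lipschitz_on_cball[OF xc(1) r(2)] by auto
    define V where "V = chart_map ?c -` ball (chart_map ?c x) r \<inter> chart_dom ?c"
    have "open V"
      unfolding V_def using continuous_open_preimage[OF continuous_chart_map[OF xc(1)] open_chart_dom[OF xc(1)] open_ball]
      by (simp add: Int_commute)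
    moreover have "x \<in> V"
      using xc(2) r(1) by (simp add: V_def)
    moreover have "chart_map ?c z \<in> cball (chart_map ?c x) r" if "z \<in> V" for z
      using that by (simp add: V_def less_imp_le)
    ultimately have "bounded_chart_part V"
      unfolding bounded_chart_part_def using xc(1) m L by (intro conjI bexI[OF _ xc(1)] exI[of _ m] exI[of _ L]) (auto simp: V_def)
    with \<open>x \<in> V\<close> show ?thesis
      by blast
  qed
  obtain \<V> where \<V>: "\<V> \<subseteq> {V. bounded_chart_part V}" "countable \<V>" "\<Union>\<V> = \<Union>{V. bounded_chart_part V}"
    using Lindelof[of "{V. bounded_chart_part V}"] by (auto simp: bounded_chart_part_def)
  have "manifold_carrier R \<subseteq> \<Union>\<V>"
    unfolding \<V>(3) using local by blast
  moreover have "\<forall>V\<in>\<V>. bounded_chart_part V"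
    using \<V>(1) by blast
  ultimately show ?thesis
    using \<V>(2) by blast
qed

lemma gram_measurable:
  assumes a: "a \<in> borel_measurable M" and c: "c \<in> atlas R"
    and u: "u \<in> borel_measurable M" and v: "v \<in> borel_measurable M"
  shows "(\<lambda>\<omega>. if a \<omega> \<in> chart_dom c then gram R c (chart_map c (a \<omega>)) (u \<omega>) (v \<omega>) else 0) \<in> borel_measurable M"
proof -
  have [measurable]: "(\<lambda>\<omega>. if a \<omega> \<in> chart_dom c then gram R c (chart_map c (a \<omega>)) i j else 0) \<in> borel_measurable M" for i j
  proof (rule measurable_continuous_on_open_part[OF a UNIV_I open_chart_dom[OF c]])
    have "continuous_on (chart_dom c) (\<lambda>x. gram R c (chart_map c x) i j)"
      by (rule continuous_on_compose2[OF smooth_on_continuous[OF smooth_gram[OF c, of i j]] continuous_chart_map[OF c]])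
         (auto simp: chart_image_def)
    then show "continuous_on (UNIV \<inter> chart_dom c) (\<lambda>x. gram R c (chart_map c x) i j)"
      by simp
  qed
  note [measurable] = u v
  have "(\<lambda>\<omega>. \<Sum>(i, j)\<in>Basis \<times> Basis. (u \<omega> \<bullet> i) * (v \<omega> \<bullet> j) *
      (if a \<omega> \<in> chart_dom c then gram R c (chart_map c (a \<omega>)) i j else 0)) \<in> borel_measurable M"
    unfolding case_prod_unfold by measurable
  also have "(\<lambda>\<omega>. \<Sum>(i, j)\<in>Basis \<times> Basis. (u \<omega> \<bullet> i) * (v \<omega> \<bullet> j) *
      (if a \<omega> \<in> chart_dom c then gram R c (chart_map c (a \<omega>)) i j else 0))
    = (\<lambda>\<omega>. if a \<omega> \<in> chart_dom c then gram R c (chart_map c (a \<omega>)) (u \<omega>) (v \<omega>) else 0)"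
    using gram_Basis_expansion[OF c chart_map_in] by (auto simp: fun_eq_iff case_prod_unfold)
  finally show ?thesis .
qed

lemma rinner_measurable:
  assumes a: "a \<in> borel_measurable M" and ac: "\<And>\<omega>. \<omega> \<in> space M \<Longrightarrow> a \<omega> \<in> manifold_carrier R"
    and u: "\<And>c. c \<in> atlas R \<Longrightarrow> (\<lambda>\<omega>. u \<omega> c) \<in> borel_measurable M"
    and v: "\<And>c. c \<in> atlas R \<Longrightarrow> (\<lambda>\<omega>. v \<omega> c) \<in> borel_measurable M"
    and ut: "\<And>\<omega>. \<omega> \<in> space M \<Longrightarrow> u \<omega> \<in> tangent_space R (a \<omega>)"
    and vt: "\<And>\<omega>. \<omega> \<in> space M \<Longrightarrow> v \<omega> \<in> tangent_space R (a \<omega>)"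
  shows "(\<lambda>\<omega>. rinner R (a \<omega>) (u \<omega>) (v \<omega>)) \<in> borel_measurable M"
proof -
  obtain \<V> where \<V>: "countable \<V>" "manifold_carrier R \<subseteq> \<Union>\<V>"
    "\<And>V. V \<in> \<V> \<Longrightarrow> bounded_chart_part V"
    using countable_cover_by_bounded_chart_parts by blast
  show ?thesis
  proof (rule measurable_piecewise_restrict[of "(\<lambda>V. a -` V \<inter> space M) ` \<V>"])
    show "space M \<subseteq> \<Union> ((\<lambda>V. a -` V \<inter> space M) ` \<V>)"
    proof
      fix \<omega> assume \<omega>: "\<omega> \<in> space M"
      then obtain V where "V \<in> \<V>" "a \<omega> \<in> V"
        using ac[OF \<omega>] \<V>(2) by auto
      then show "\<omega> \<in> \<Union> ((\<lambda>V. a -` V \<inter> space M) ` \<V>)"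
        using \<omega> by auto
    qed
    fix \<Omega> assume "\<Omega> \<in> (\<lambda>V. a -` V \<inter> space M) ` \<V>"
    then obtain V c where V: "\<Omega> = a -` V \<inter> space M" "open V" "c \<in> atlas R" "V \<subseteq> chart_dom c"
      using \<V>(3) unfolding bounded_chart_part_def by fast
    show "\<Omega> \<inter> space M \<in> sets M"
      using measurable_sets[OF a, of V] V(1,2) by simp
    have "(\<lambda>\<omega>. if a \<omega> \<in> chart_dom c then gram R c (chart_map c (a \<omega>)) (u \<omega> c) (v \<omega> c) else 0)
        \<in> borel_measurable (restrict_space M \<Omega>)"
      by (rule measurable_restrict_space1[OF gram_measurable[OF a V(3) u[OF V(3)] v[OF V(3)]]])
    then show "(\<lambda>\<omega>. rinner R (a \<omega>) (u \<omega>) (v \<omega>)) \<in> borel_measurable (restrict_space M \<Omega>)"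
    proof (rule measurable_cong[THEN iffD1, rotated])
      fix \<omega> assume "\<omega> \<in> space (restrict_space M \<Omega>)"
      then have "\<omega> \<in> space M" "a \<omega> \<in> chart_dom c"
        using V(1,4) by (auto simp: space_restrict_space)
      then show "(if a \<omega> \<in> chart_dom c then gram R c (chart_map c (a \<omega>)) (u \<omega> c) (v \<omega> c) else 0)
          = rinner R (a \<omega>) (u \<omega>) (v \<omega>)"
        using rinner_chart[OF ut vt] V(3) by (simp add: charts_at_iff)
    qed
  qed (use \<V>(1) in simp)
qed

text \<open>The conditional expectation of a random tangent vector is given componentwise. Pairing with a
  known tangent vector commutes with it: locally in a chart the inner product is a finite sum of
  products of components.\<close>

lemma real_cond_exp_rinner:
  assumes P: "prob_space P" and F: "subalgebra P F" and a: "a \<in> borel_measurable F"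
    and ac: "\<And>\<omega>. \<omega> \<in> space P \<Longrightarrow> a \<omega> \<in> manifold_carrier R"
    and u: "\<And>c. c \<in> atlas R \<Longrightarrow> (\<lambda>\<omega>. u \<omega> c) \<in> borel_measurable P"
    and h: "\<And>c. c \<in> atlas R \<Longrightarrow> (\<lambda>\<omega>. h \<omega> c) \<in> borel_measurable F"
    and ut: "\<And>\<omega>. \<omega> \<in> space P \<Longrightarrow> u \<omega> \<in> tangent_space R (a \<omega>)"
    and vt: "\<And>\<omega>. \<omega> \<in> space P \<Longrightarrow> v \<omega> \<in> tangent_space R (a \<omega>)"
    and ht: "\<And>\<omega>. \<omega> \<in> space P \<Longrightarrow> h \<omega> \<in> tangent_space R (a \<omega>)"
    and cond: "\<And>c b. c \<in> atlas R \<Longrightarrow> b \<in> Basis \<Longrightarrow>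
      AE \<omega> in P. real_cond_exp P F (\<lambda>\<omega>. u \<omega> c \<bullet> b) \<omega> = v \<omega> c \<bullet> b"
    and G: "AE \<omega> in P. rnorm R (a \<omega>) (u \<omega>) \<le> G"
    and H: "\<And>\<omega>. \<omega> \<in> space P \<Longrightarrow> rnorm R (a \<omega>) (h \<omega>) \<le> H"
  shows "integrable P (\<lambda>\<omega>. rinner R (a \<omega>) (u \<omega>) (h \<omega>))"
    and "AE \<omega> in P. real_cond_exp P F (\<lambda>\<omega>. rinner R (a \<omega>) (u \<omega>) (h \<omega>)) \<omega> = rinner R (a \<omega>) (v \<omega>) (h \<omega>)"
proof -
  interpret prob_space P
    by fact
  interpret finite_measure_subalgebra P F
    by unfold_locales (rule F)
  have aP: "a \<in> borel_measurable P" and hP: "\<And>c. c \<in> atlas R \<Longrightarrow> (\<lambda>\<omega>. h \<omega> c) \<in> borel_measurable P"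
    using measurable_from_subalg[OF F] a h by blast+
  let ?f = "\<lambda>\<omega>. rinner R (a \<omega>) (u \<omega>) (h \<omega>)"
  have f_meas[measurable]: "?f \<in> borel_measurable P"
    by (rule rinner_measurable[OF aP ac u hP ut ht])
  have "AE \<omega> in P. norm (?f \<omega>) \<le> \<bar>G\<bar> * \<bar>H\<bar>"
    using G
  proof (rule AE_mp, intro AE_I2 impI)
    fix \<omega> assume \<omega>: "\<omega> \<in> space P" and "rnorm R (a \<omega>) (u \<omega>) \<le> G"
    then have "rnorm R (a \<omega>) (u \<omega>) * rnorm R (a \<omega>) (h \<omega>) \<le> \<bar>G\<bar> * \<bar>H\<bar>"
      using H[OF \<omega>] rnorm_nonneg[OF ac[OF \<omega>]] by (intro mult_mono) (auto intro: order_trans)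
    then show "norm (?f \<omega>) \<le> \<bar>G\<bar> * \<bar>H\<bar>"
      using rinner_Cauchy_Schwarz[OF ac[OF \<omega>], of "u \<omega>" "h \<omega>"] by simp
  qed
  then show int_f: "integrable P ?f"
    by (rule integrable_const_bound) (rule f_meas)
  obtain \<V> where \<V>: "countable \<V>" "manifold_carrier R \<subseteq> \<Union>\<V>"
    "\<And>V. V \<in> \<V> \<Longrightarrow> bounded_chart_part V"
    using countable_cover_by_bounded_chart_parts by blast
  have local: "AE \<omega> in P. a \<omega> \<in> V \<longrightarrow> real_cond_exp P F ?f \<omega> = rinner R (a \<omega>) (v \<omega>) (h \<omega>)" if V: "V \<in> \<V>" for V
  proof -
    obtain c m L where c: "c \<in> atlas R" "V \<subseteq> chart_dom c" and opO: "open V" and m: "m > 0" and L: "L \<ge> 0"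
      and mL: "\<And>x u. x \<in> V \<Longrightarrow> m * (norm u)\<^sup>2 \<le> gram R c (chart_map c x) u u"
        "\<And>x u v. x \<in> V \<Longrightarrow> \<bar>gram R c (chart_map c x) u v\<bar> \<le> L * (norm u * norm v)"
      using \<V>(3)[OF V] unfolding bounded_chart_part_def by blast
    \<comment> \<open>On the known event \<open>A\<close> the base point lies in \<open>V\<close>, and all components of vectors of bounded length are bounded.\<close>
    define A where "A = a -` V \<inter> space P"
    have space: "space F = space P"
      using F by (simp add: subalgebra_def)
    have A[measurable]: "A \<in> sets F"
      using measurable_sets[OF a, of V] opO space by (simp add: A_def)
    define g where "g = (\<lambda>b \<omega>. if a \<omega> \<in> chart_dom c then gram R c (chart_map c (a \<omega>)) b (h \<omega> c) else 0)"
    have [measurable]: "g b \<in> borel_measurable F" for b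
      unfolding g_def by (rule gram_measurable[OF a c(1) measurable_const h[OF c(1)]]) simp
    define z where "z = (\<lambda>b \<omega>. indicator A \<omega> * g b \<omega>)"
    have z_meas[measurable]: "z b \<in> borel_measurable F" for b
      unfolding z_def by measurable
    have zP: "z b \<in> borel_measurable P" for b
      using measurable_from_subalg[OF F z_meas] .
    note [measurable] = u[OF c(1)] zP
    have chart: "c \<in> charts_at R (a \<omega>)" if "\<omega> \<in> A" for \<omega>
      using that c by (auto simp: A_def charts_at_iff)
    have size: "norm (w c) \<le> k / sqrt m"
      if "\<omega> \<in> A" "w \<in> tangent_space R (a \<omega>)" "rnorm R (a \<omega>) w \<le> k" for \<omega> w k
    proof -
      have \<omega>: "a \<omega> \<in> manifold_carrier R"
        using ac that(1) by (simp add: A_def)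
      have "m * (norm (w c))\<^sup>2 \<le> (rnorm R (a \<omega>) w)\<^sup>2"
        using mL(1)[of "a \<omega>" "w c"] that(1) rinner_chart[OF that(2) that(2) chart[OF that(1)]]
        by (simp add: rnorm_power2[OF \<omega>] A_def)
      also have "\<dots> \<le> k\<^sup>2"
        using that(3) rnorm_nonneg[OF \<omega>] by (rule power_mono)
      finally have "(sqrt m * norm (w c))\<^sup>2 \<le> k\<^sup>2"
        using m by (simp add: power_mult_distrib)
      moreover have "0 \<le> k"
        using that(3) rnorm_nonneg[OF \<omega>, of w] by linarith
      ultimately have "sqrt m * norm (w c) \<le> k"
        by (rule power2_le_imp_le)
      then show ?thesis
        using m by (simp add: field_simps)
    qed
    have prod_int: "integrable P (\<lambda>\<omega>. z b \<omega> * (u \<omega> c \<bullet> b))" if b: "b \<in> Basis" for b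
    proof (rule integrable_const_bound)
      show "AE \<omega> in P. norm (z b \<omega> * (u \<omega> c \<bullet> b)) \<le> \<bar>L * (\<bar>H\<bar> / sqrt m)\<bar> * \<bar>\<bar>G\<bar> / sqrt m\<bar>"
        using G
      proof (rule AE_mp, intro AE_I2 impI)
        fix \<omega> assume \<omega>: "\<omega> \<in> space P" and Gw: "rnorm R (a \<omega>) (u \<omega>) \<le> G"
        show "norm (z b \<omega> * (u \<omega> c \<bullet> b)) \<le> \<bar>L * (\<bar>H\<bar> / sqrt m)\<bar> * \<bar>\<bar>G\<bar> / sqrt m\<bar>"
        proof (cases "\<omega> \<in> A")
          case True
          have "\<bar>g b \<omega>\<bar> \<le> L * (norm b * norm (h \<omega> c))"
            using mL(2)[of "a \<omega>" b "h \<omega> c"] True chart[OF True] by (simp add: g_def A_def charts_at_iff)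
          also have "\<dots> \<le> L * (\<bar>H\<bar> / sqrt m)"
            using size[OF True ht[OF \<omega>], of "\<bar>H\<bar>"] H[OF \<omega>] L b by (intro mult_left_mono) auto
          finally have "\<bar>g b \<omega>\<bar> \<le> \<bar>L * (\<bar>H\<bar> / sqrt m)\<bar>"
            by linarith
          then have "\<bar>z b \<omega>\<bar> \<le> \<bar>L * (\<bar>H\<bar> / sqrt m)\<bar>"
            using True by (simp only: z_def indicator_simps mult_1)
          moreover have "\<bar>u \<omega> c \<bullet> b\<bar> \<le> \<bar>\<bar>G\<bar> / sqrt m\<bar>"
          proof -
            have "rnorm R (a \<omega>) (u \<omega>) \<le> \<bar>G\<bar>"
              using Gw by linarith
            from size[OF True ut[OF \<omega>] this] Basis_le_norm[OF b, of "u \<omega> c"] show ?thesis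
              by linarith
          qed
          ultimately show ?thesis
            unfolding real_norm_def abs_mult[of "z b \<omega>"] by (intro mult_mono) auto
        qed (simp add: z_def)
      qed
      show "(\<lambda>\<omega>. z b \<omega> * (u \<omega> c \<bullet> b)) \<in> borel_measurable P"
        by measurable
    qed
    have expand: "indicator A \<omega> * rinner R (a \<omega>) w (h \<omega>) = (\<Sum>b\<in>Basis. z b \<omega> * (w c \<bullet> b))"
      if \<omega>: "\<omega> \<in> space P" and w: "w \<in> tangent_space R (a \<omega>)" for \<omega> w
    proof (cases "\<omega> \<in> A")
      case True
      have pc: "chart_map c (a \<omega>) \<in> chart_image c"
        using charts_at_image[OF chart[OF True]] .
      have "rinner R (a \<omega>) w (h \<omega>) = (\<Sum>b\<in>Basis. (w c \<bullet> b) * gram R c (chart_map c (a \<omega>)) b (h \<omega> c))"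
        using rinner_chart[OF w ht[OF \<omega>] chart[OF True]] linear_Basis_expansion[OF linear_gram_left[OF c(1) pc]] by metis
      then show ?thesis
        using True chart[OF True] by (simp add: z_def g_def charts_at_iff mult.commute)
    qed (simp add: z_def)
    have AE1: "AE \<omega> in P. real_cond_exp P F (\<lambda>\<omega>. indicator A \<omega> * ?f \<omega>) \<omega> = indicator A \<omega> * real_cond_exp P F ?f \<omega>"
    proof (rule real_cond_exp_mult)
      have "A \<in> sets P"
        using A F by (auto simp: subalgebra_def)
      then show "integrable P (\<lambda>\<omega>. indicator A \<omega> * ?f \<omega>)"
        using integrable_mult_indicator[OF _ int_f, of A] by simp
    qed measurable
    have AE2: "AE \<omega> in P. real_cond_exp P F (\<lambda>\<omega>. indicator A \<omega> * ?f \<omega>) \<omega>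
        = real_cond_exp P F (\<lambda>\<omega>. \<Sum>b\<in>Basis. z b \<omega> * (u \<omega> c \<bullet> b)) \<omega>"
    proof (rule real_cond_exp_cong)
      show "AE \<omega> in P. indicator A \<omega> * ?f \<omega> = (\<Sum>b\<in>Basis. z b \<omega> * (u \<omega> c \<bullet> b))"
        by (rule AE_I2) (rule expand[OF _ ut])
      have "A \<in> sets P"
        using A F by (auto simp: subalgebra_def)
      then show "(\<lambda>\<omega>. indicator A \<omega> * ?f \<omega>) \<in> borel_measurable P"
        by measurable
    qed measurable
    have AE3: "AE \<omega> in P. real_cond_exp P F (\<lambda>\<omega>. \<Sum>b\<in>Basis. z b \<omega> * (u \<omega> c \<bullet> b)) \<omega>
        = (\<Sum>b\<in>Basis. real_cond_exp P F (\<lambda>\<omega>. z b \<omega> * (u \<omega> c \<bullet> b)) \<omega>)"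
    proof -
      have "integrable P (\<lambda>\<omega>. if b \<in> Basis then z b \<omega> * (u \<omega> c \<bullet> b) else 0)" for b
        using prod_int[of b] by (cases "b \<in> Basis") simp_all
      then have "AE \<omega> in P. real_cond_exp P F (\<lambda>\<omega>. \<Sum>b\<in>Basis. (if b \<in> Basis then z b \<omega> * (u \<omega> c \<bullet> b) else 0)) \<omega>
        = (\<Sum>b\<in>Basis. real_cond_exp P F (\<lambda>\<omega>. if b \<in> Basis then z b \<omega> * (u \<omega> c \<bullet> b) else 0) \<omega>)"
        by (rule real_cond_exp_sum[of "\<lambda>b \<omega>. if b \<in> Basis then z b \<omega> * (u \<omega> c \<bullet> b) else 0"])
      then show ?thesis
        by (simp cong: sum.cong)
    qed
    have AE4: "AE \<omega> in P. \<forall>b\<in>Basis. real_cond_exp P F (\<lambda>\<omega>. z b \<omega> * (u \<omega> c \<bullet> b)) \<omega> = z b \<omega> * (v \<omega> c \<bullet> b)"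
    proof (rule AE_finite_allI)
      fix b :: 'e assume b: "b \<in> Basis"
      have "AE \<omega> in P. real_cond_exp P F (\<lambda>\<omega>. z b \<omega> * (u \<omega> c \<bullet> b)) \<omega> = z b \<omega> * real_cond_exp P F (\<lambda>\<omega>. u \<omega> c \<bullet> b) \<omega>"
        by (rule real_cond_exp_mult[OF z_meas _ prod_int[OF b]]) measurable
      then show "AE \<omega> in P. real_cond_exp P F (\<lambda>\<omega>. z b \<omega> * (u \<omega> c \<bullet> b)) \<omega> = z b \<omega> * (v \<omega> c \<bullet> b)"
        using cond[OF c(1) b] by eventually_elim simp
    qed simp
    show ?thesis
      using AE1 AE2 AE3 AE4 AE_space
    proof eventually_elim
      case (elim \<omega>)
      have "indicator A \<omega> * real_cond_exp P F ?f \<omega> = (\<Sum>b\<in>Basis. z b \<omega> * (v \<omega> c \<bullet> b))"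
        using elim by simp
      also have "\<dots> = indicator A \<omega> * rinner R (a \<omega>) (v \<omega>) (h \<omega>)"
        using expand[OF elim(5) vt[OF elim(5)]] by simp
      finally show ?case
        using elim(5) by (auto simp: A_def)
    qed
  qed
  have "AE \<omega> in P. \<forall>V\<in>\<V>. a \<omega> \<in> V \<longrightarrow> real_cond_exp P F ?f \<omega> = rinner R (a \<omega>) (v \<omega>) (h \<omega>)"
    by (subst AE_ball_countable[OF \<V>(1)]) (use local in blast)
  then show "AE \<omega> in P. real_cond_exp P F ?f \<omega> = rinner R (a \<omega>) (v \<omega>) (h \<omega>)"
    using AE_space
  proof eventually_elim
    case (elim \<omega>)
    then show ?case
      using ac[OF elim(2)] \<V>(2) by blast
  qed
qed

end

context comparison_domain begin

lemma rdist_power2_measurable: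
  assumes "a \<in> borel_measurable M" "b \<in> borel_measurable M"
    and "\<And>\<omega>. \<omega> \<in> space M \<Longrightarrow> a \<omega> \<in> X" "\<And>\<omega>. \<omega> \<in> space M \<Longrightarrow> b \<omega> \<in> X"
  shows "(\<lambda>\<omega>. (rdist R (a \<omega>) (b \<omega>))\<^sup>2) \<in> borel_measurable M"
  using measurable_continuous_on_compose[OF borel_measurable_Pair[OF assms(1,2)] _ continuous_rdist_power2] assms(3,4)
  by simp

text \<open>The mean is a continuous function of the configuration, hence known as soon as the configuration is.\<close>

lemma barycenter_measurable:
  fixes w :: "'k::finite \<Rightarrow> real"
  assumes w: "\<And>k. w k \<ge> 0" "(\<Sum>k\<in>UNIV. w k) = 1"
    and p: "\<And>k. (\<lambda>\<omega>. p \<omega> k) \<in> borel_measurable M" and pX: "\<And>\<omega> k. \<omega> \<in> space M \<Longrightarrow> p \<omega> k \<in> X"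
    and m: "\<And>\<omega>. \<omega> \<in> space M \<Longrightarrow> barycenter w (p \<omega>) (m \<omega>)"
  shows "m \<in> borel_measurable M"
proof -
  define \<mu> where "\<mu> q = (SOME m. barycenter w q m)" for q
  define A where "A = {q. (\<forall>k. q k \<in> X) \<and> (\<exists>m. barycenter w q m)}"
  have A: "barycenter w q (\<mu> q) \<and> (\<forall>k. q k \<in> X)" if "q \<in> A" for q
    using that someI_ex[of "barycenter w q"] by (auto simp: A_def \<mu>_def)
  have pA: "p \<omega> \<in> A" if "\<omega> \<in> space M" for \<omega>
    using pX m that by (auto simp: A_def)
  have "(\<lambda>\<omega>. \<mu> (p \<omega>)) \<in> borel_measurable M"
    by (rule measurable_continuous_on_compose[OF measurable_coordinatewise_then_product[OF p] pA
          barycenter_continuous[OF w A]])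
  then show ?thesis
  proof (rule measurable_cong[THEN iffD1, rotated])
    fix \<omega> assume \<omega>: "\<omega> \<in> space M"
    show "\<mu> (p \<omega>) = m \<omega>"
      using barycenter_unique[OF w pX[OF \<omega>] conjunct1[OF A[OF pA[OF \<omega>]]] m[OF \<omega>]] .
  qed
qed

text \<open>A point on a geodesic is a barycenter of the end points, here indexed by the two truth values, so it
  depends continuously on them.\<close>

lemma geo_measurable:
  assumes a: "a \<in> borel_measurable M" and b: "b \<in> borel_measurable M"
    and aX: "\<And>\<omega>. \<omega> \<in> space M \<Longrightarrow> a \<omega> \<in> X" and bX: "\<And>\<omega>. \<omega> \<in> space M \<Longrightarrow> b \<omega> \<in> X" and t: "t \<in> {0..1}"
  shows "(\<lambda>\<omega>. geo (a \<omega>) (b \<omega>) t) \<in> borel_measurable M"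
proof (rule barycenter_measurable)
  show "\<And>\<omega>. \<omega> \<in> space M \<Longrightarrow>
      barycenter (\<lambda>k. if k then 1 - t else t) (\<lambda>k. if k then a \<omega> else b \<omega>) (geo (a \<omega>) (b \<omega>) t)"
    by (rule geo_barycenter[OF aX bX t])
  show "(\<lambda>\<omega>. if k then a \<omega> else b \<omega>) \<in> borel_measurable M" for k
    using a b by (cases k) simp_all
qed (use t aX bX in \<open>auto simp: UNIV_bool\<close>)

lemma rlog_measurable:
  assumes a: "a \<in> borel_measurable M" and b: "b \<in> borel_measurable M"
    and aX: "\<And>\<omega>. \<omega> \<in> space M \<Longrightarrow> a \<omega> \<in> X" and bX: "\<And>\<omega>. \<omega> \<in> space M \<Longrightarrow> b \<omega> \<in> X" and c: "c \<in> atlas R"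
  shows "(\<lambda>\<omega>. rlog R (a \<omega>) (b \<omega>) c) \<in> borel_measurable M"
proof -
  define \<psi> where "\<psi> x = (if x \<in> chart_dom c then chart_map c x else 0)" for x
  have \<psi>: "(\<lambda>\<omega>. \<psi> (q \<omega>)) \<in> borel_measurable M" if q: "q \<in> borel_measurable M" for q
    unfolding \<psi>_def using continuous_chart_map[OF c]
    by (intro measurable_continuous_on_open_part[OF q UNIV_I open_chart_dom[OF c]]) simp
  have dom[measurable]: "Measurable.pred M (\<lambda>\<omega>. a \<omega> \<in> chart_dom c)"
    using measurable_sets[OF a, of "chart_dom c"] open_chart_dom[OF c]
    by (simp add: pred_def vimage_def Int_def conj_commute)
  have unit: "1 / real (Suc k) \<in> {0..1}" for k
    by (simp add: divide_simps)
  note [measurable] = \<psi>[OF geo_measurable[OF a b aX bX unit]] \<psi>[OF a]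
  show ?thesis
  proof (rule borel_measurable_LIMSEQ_metric)
    show "(\<lambda>\<omega>. if a \<omega> \<in> chart_dom c then real (Suc k) *\<^sub>R (\<psi> (geo (a \<omega>) (b \<omega>) (1 / Suc k)) - \<psi> (a \<omega>)) else 0)
        \<in> borel_measurable M" for k
      by measurable
    fix \<omega> assume \<omega>: "\<omega> \<in> space M"
    note X = aX[OF \<omega>] bX[OF \<omega>]
    show "(\<lambda>k. if a \<omega> \<in> chart_dom c then real (Suc k) *\<^sub>R (\<psi> (geo (a \<omega>) (b \<omega>) (1 / Suc k)) - \<psi> (a \<omega>)) else 0)
        \<longlonglongrightarrow> rlog R (a \<omega>) (b \<omega>) c"
    proof (cases "a \<omega> \<in> chart_dom c")
      case True
      have ch: "c \<in> charts_at R (a \<omega>)"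
        using True c by (simp add: charts_at_iff)
      have "(geo (a \<omega>) (b \<omega>) \<longlongrightarrow> geo (a \<omega>) (b \<omega>) 0) (at 0 within {0..1})"
        using geodesic_continuous[OF minimizing_geodesic_props(1)[OF X geo_minimizing[OF X]]]
        by (simp add: continuous_on_def)
      then have "\<forall>\<^sub>F s in at 0 within {0..1}. geo (a \<omega>) (b \<omega>) s \<in> chart_dom c"
        using True open_chart_dom[OF c] geo_0[OF X] by (intro topological_tendstoD) auto
      moreover have "filterlim (\<lambda>k. 1 / real (Suc k)) (at 0 within {0..1}) sequentially"
        unfolding filterlim_at using LIMSEQ_inverse_real_of_nat by (auto simp: divide_simps inverse_eq_divide)
      ultimately have "\<forall>\<^sub>F k in sequentially. geo (a \<omega>) (b \<omega>) (1 / real (Suc k)) \<in> chart_dom c"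
        by (rule eventually_compose_filterlim)
      then have "\<forall>\<^sub>F k in sequentially. real (Suc k) *\<^sub>R (chart_map c (geo (a \<omega>) (b \<omega>) (1 / Suc k)) - chart_map c (a \<omega>))
          = (if a \<omega> \<in> chart_dom c then real (Suc k) *\<^sub>R (\<psi> (geo (a \<omega>) (b \<omega>) (1 / Suc k)) - \<psi> (a \<omega>)) else 0)"
        by eventually_elim (use True in \<open>simp add: \<psi>_def\<close>)
      then show ?thesis
        by (rule Lim_transform_eventually[OF chart_rlog_LIMSEQ[OF X ch]])
    next
      case False
      then show ?thesis
        using tangent_space_off_chart[OF rlog_tangent[OF X], of c] by (simp add: charts_at_iff)
    qed
  qed
qed

end


section \<open>The spectral gap of the network\<close>

lemma weighted_variance:
  fixes w z :: "'k::finite \<Rightarrow> real"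
  assumes "(\<Sum>k\<in>UNIV. w k) = 1"
  shows "(\<Sum>k\<in>UNIV. w k * (z k)\<^sup>2) - (\<Sum>k\<in>UNIV. w k * z k)\<^sup>2
    = (\<Sum>k\<in>UNIV. w k * (z k - (\<Sum>k\<in>UNIV. w k * z k))\<^sup>2)"
proof -
  let ?m = "\<Sum>k\<in>UNIV. w k * z k"
  have "(\<Sum>k\<in>UNIV. w k * (z k - ?m)\<^sup>2) = (\<Sum>k\<in>UNIV. w k * (z k)\<^sup>2 - 2 * ?m * (w k * z k) + ?m\<^sup>2 * w k)"
    by (rule sum.cong[OF refl]) (simp add: power2_eq_square algebra_simps)
  also have "\<dots> = (\<Sum>k\<in>UNIV. w k * (z k)\<^sup>2) - 2 * ?m * ?m + ?m\<^sup>2 * (\<Sum>k\<in>UNIV. w k)"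
    by (simp add: sum.distrib sum_subtractf sum_distrib_left[symmetric])
  finally show ?thesis
    using assms by (simp add: power2_eq_square)
qed

lemma norm_vec_power2: "(norm (v :: real ^ 'k))\<^sup>2 = (\<Sum>i\<in>UNIV. (v $ i)\<^sup>2)"
  unfolding power2_norm_eq_inner by (simp add: inner_vec_def power2_eq_square)

lemma quadratic_nonneg_imp_linear_zero:
  fixes b c :: real
  assumes "\<And>t. 0 \<le> 2 * t * b + t\<^sup>2 * c"
  shows "b = 0"
proof (rule ccontr)
  assume b: "b \<noteq> 0"
  define k where "k = \<bar>c\<bar> + 1"
  have k: "k > 0" "c < k"
    by (auto simp: k_def)
  have "0 \<le> (2 * (- b / k) * b + (- b / k)\<^sup>2 * c) * k\<^sup>2"
    using assms[of "- b / k"] by (intro mult_nonneg_nonneg) auto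
  also have "\<dots> = b\<^sup>2 * (c - 2 * k)"
    using k(1) by (simp add: field_simps power2_eq_square)
  also have "\<dots> < 0"
    using b k by (intro mult_pos_neg) auto
  finally show False
    by simp
qed

locale network =
  fixes E :: "'n::finite \<Rightarrow> 'n \<Rightarrow> bool" and W :: "real ^ 'n ^ 'n"
  assumes network: "network_assumption E W"
begin

lemma W_transpose: "transpose W = W" and W_row_sum: "(\<Sum>j\<in>UNIV. W $ i $ j) = 1"
  and W_col_sum: "(\<Sum>i\<in>UNIV. W $ i $ j) = 1" and W_nonneg: "W $ i $ j \<ge> 0" and W_diag_pos: "W $ i $ i > 0"
  and W_edge_pos: "E i j \<Longrightarrow> W $ i $ j > 0" and E_connected: "E\<^sup>*\<^sup>* i j"
  using network unfolding network_assumption_def by blast+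

lemma W_selfadjoint: "(W *v u) \<bullet> v = u \<bullet> (W *v v)"
  by (metis W_transpose dot_lmul_matrix transpose_matrix_vector)

lemma W_one: "W *v 1 = 1"
  by (simp add: matrix_vector_mult_def vec_eq_iff W_row_sum)

lemma inner_one: "z \<bullet> (1 :: real ^ 'n) = (\<Sum>i\<in>UNIV. z $ i)"
  by (simp add: inner_vec_def)

lemma gram_eigenspace_iff: "v \<in> gram_eigenspace W r \<longleftrightarrow> W *v (W *v v) = r\<^sup>2 *\<^sub>R v"
  by (simp add: gram_eigenspace_def W_transpose matrix_vector_mul_assoc)

lemma norm_W_power2: "norm (W *v v) ^ 2 = v \<bullet> (W *v (W *v v))"
  by (simp add: power2_norm_eq_inner W_selfadjoint)

text \<open>The loss of squared length under averaging is the sum, over all agents, of the weighted variance of the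
  entries that the agent averages.\<close>

lemma norm_W_defect:
  "(norm v)\<^sup>2 - (norm (W *v v))\<^sup>2
    = (\<Sum>i\<in>UNIV. \<Sum>j\<in>UNIV. W $ i $ j * (v $ j - (W *v v) $ i)\<^sup>2)"
proof -
  have "(\<Sum>i\<in>UNIV. \<Sum>j\<in>UNIV. W $ i $ j * (v $ j - (W *v v) $ i)\<^sup>2)
      = (\<Sum>i\<in>UNIV. (\<Sum>j\<in>UNIV. W $ i $ j * (v $ j)\<^sup>2) - ((W *v v) $ i)\<^sup>2)"
    using weighted_variance[OF W_row_sum, where z = "\<lambda>j. v $ j"] by (simp add: matrix_vector_mult_def)
  also have "\<dots> = (\<Sum>j\<in>UNIV. \<Sum>i\<in>UNIV. W $ i $ j * (v $ j)\<^sup>2) - (\<Sum>i\<in>UNIV. ((W *v v) $ i)\<^sup>2)"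
    by (subst sum_subtractf, subst sum.swap) (rule refl)
  also have "(\<Sum>j\<in>UNIV. \<Sum>i\<in>UNIV. W $ i $ j * (v $ j)\<^sup>2) = (\<Sum>j\<in>UNIV. (v $ j)\<^sup>2)"
    by (simp add: sum_distrib_right[symmetric] W_col_sum)
  finally show ?thesis
    by (simp only: norm_vec_power2)
qed

lemma norm_W_le: "norm (W *v v) \<le> norm v"
proof -
  have "0 \<le> (norm v)\<^sup>2 - (norm (W *v v))\<^sup>2"
    unfolding norm_W_defect by (intro sum_nonneg mult_nonneg_nonneg W_nonneg) simp
  then have "(norm (W *v v))\<^sup>2 \<le> (norm v)\<^sup>2"
    by simp
  then show ?thesis
    by (rule power2_le_imp_le) simp
qed

text \<open>If \<open>W\<close> preserves the length of \<open>v\<close> then averaging over neighbours does not change any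
  entry, so that \<open>v\<close> is constant along edges.\<close>

lemma top_gram_eigenvector_constant:
  assumes "v \<in> gram_eigenspace W 1"
  shows "v \<in> span {1}"
proof -
  have "(norm v)\<^sup>2 - (norm (W *v v))\<^sup>2 = 0"
    using assms norm_W_power2[of v] power2_norm_eq_inner[of v] by (simp add: gram_eigenspace_iff)
  then have "\<forall>i\<in>UNIV. (\<Sum>j\<in>UNIV. W $ i $ j * (v $ j - (W *v v) $ i)\<^sup>2) = 0"
    unfolding norm_W_defect
    by (subst (asm) sum_nonneg_eq_0_iff) (auto intro!: sum_nonneg mult_nonneg_nonneg W_nonneg)
  then have "W $ i $ j * (v $ j - (W *v v) $ i)\<^sup>2 = 0" for i j
    by (subst (asm) sum_nonneg_eq_0_iff) (auto intro!: mult_nonneg_nonneg W_nonneg)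
  then have avg: "W $ i $ j > 0 \<Longrightarrow> v $ j = (W *v v) $ i" for i j
    by (metis less_irrefl mult_eq_0_iff power2_eq_square right_minus_eq)
  have edge: "v $ i = v $ j" if "E i j" for i j
    using avg[OF W_diag_pos[of i]] avg[OF W_edge_pos[OF that]] by simp
  have "v $ i = v $ j" for i j
    using E_connected[of i j] by (induction rule: rtranclp_induct) (auto simp: edge)
  then have "v = (v $ undefined) *\<^sub>R 1"
    by (simp add: vec_eq_iff)
  then show ?thesis
    by (metis span_base span_scale singletonI)
qed

definition singular_value_set :: "real set" where
  "singular_value_set = {r. r \<ge> 0 \<and> (\<exists>v\<in>gram_eigenspace W r. v \<noteq> 0)}"

text \<open>Eigenvectors of a symmetric matrix for distinct eigenvalues are orthogonal. Finiteness matters,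
  because the sum that defines \<^const>\<open>singular_values\<close> is zero over an infinite set.\<close>

lemma finite_singular_value_set: "finite singular_value_set"
proof -
  define e where "e r = (SOME v. v \<in> gram_eigenspace W r \<and> v \<noteq> 0)" for r
  have e: "e r \<in> gram_eigenspace W r" "e r \<noteq> 0" if "r \<in> singular_value_set" for r
    using that someI_ex[of "\<lambda>v. v \<in> gram_eigenspace W r \<and> v \<noteq> 0"]
    by (auto simp: e_def singular_value_set_def)
  have orth: "e r \<bullet> e r' = 0" if r: "r \<in> singular_value_set" "r' \<in> singular_value_set" "r \<noteq> r'" for r r'
  proof -
    have "r\<^sup>2 * (e r \<bullet> e r') = (W *v (W *v e r)) \<bullet> e r'"
      using e(1)[OF r(1)] by (simp add: gram_eigenspace_iff)
    also have "\<dots> = e r \<bullet> (W *v (W *v e r'))"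
      by (simp add: W_selfadjoint)
    also have "\<dots> = r'\<^sup>2 * (e r \<bullet> e r')"
      using e(1)[OF r(2)] by (simp add: gram_eigenspace_iff)
    finally have "(r\<^sup>2 - r'\<^sup>2) * (e r \<bullet> e r') = 0"
      by (simp add: left_diff_distrib)
    moreover have "r\<^sup>2 \<noteq> r'\<^sup>2"
      using r by (auto simp: singular_value_set_def power2_eq_iff_nonneg)
    ultimately show ?thesis
      by simp
  qed
  have "independent (e ` singular_value_set)"
  proof (rule pairwise_orthogonal_independent)
    show "pairwise orthogonal (e ` singular_value_set)"
      using orth by (auto simp: pairwise_def orthogonal_def)
    show "0 \<notin> e ` singular_value_set"
      using e(2) by force
  qed
  then have "finite (e ` singular_value_set)"
    by (rule independent_imp_finite)
  moreover have "inj_on e singular_value_set"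
    using orth e(2) by (metis inj_onI inner_eq_zero_iff)
  ultimately show ?thesis
    by (rule finite_imageD)
qed

lemma count_singular_values:
  "count (singular_values W) r = (if r \<in> singular_value_set then dim (gram_eigenspace W r) else 0)"
proof -
  have "count (singular_values W) r
      = (\<Sum>r'\<in>singular_value_set. count (replicate_mset (dim (gram_eigenspace W r')) r') r)"
    unfolding singular_values_def singular_value_set_def by (rule count_sum)
  also have "\<dots> = (\<Sum>r'\<in>singular_value_set. if r' = r then dim (gram_eigenspace W r) else 0)"
    by (rule sum.cong) auto
  finally show ?thesis
    using finite_singular_value_set by (simp add: sum.delta)
qed

lemma dim_eigenspace_pos:
  assumes "r \<in> singular_value_set"
  shows "dim (gram_eigenspace W r) \<ge> 1"
proof -
  obtain v where v: "v \<in> gram_eigenspace W r" "v \<noteq> 0"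
    using assms by (auto simp: singular_value_set_def)
  then show ?thesis
    using independent_card_le_dim[of "{v}" "gram_eigenspace W r"] by auto
qed

lemma mem_singular_values: "r \<in># singular_values W \<longleftrightarrow> r \<in> singular_value_set"
  using dim_eigenspace_pos[of r] by (auto simp: count_singular_values simp flip: count_greater_zero_iff)

lemma singular_value_le_1:
  assumes "r \<in> singular_value_set"
  shows "r \<le> 1"
proof -
  obtain v where v: "v \<in> gram_eigenspace W r" "v \<noteq> 0" and r: "r \<ge> 0"
    using assms by (auto simp: singular_value_set_def)
  have "(norm (W *v v))\<^sup>2 = (r * norm v)\<^sup>2"
    using v(1) norm_W_power2[of v] power2_norm_eq_inner[of v] by (simp add: gram_eigenspace_iff power_mult_distrib)
  then have "r * norm v = norm (W *v v)"
    using r by (simp add: power2_eq_iff_nonneg)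
  then have "r * norm v \<le> 1 * norm v"
    using norm_W_le[of v] by simp
  then show ?thesis
    using v(2) by (simp only: mult_le_cancel_right) (metis norm_eq_zero norm_ge_zero order_antisym_conv not_le)
qed

lemma one_in_singular_value_set: "1 \<in> singular_value_set"
proof -
  have "1 \<in> gram_eigenspace W 1"
    by (simp add: gram_eigenspace_iff W_one)
  moreover have "(1 :: real ^ 'n) \<noteq> 0"
    by simp
  ultimately have "\<exists>v\<in>gram_eigenspace W 1. v \<noteq> 0"
    by blast
  then show ?thesis
    by (simp add: singular_value_set_def)
qed

lemma Max_singular_values: "Max_mset (singular_values W) = 1"
proof (rule Max_eqI)
  show "1 \<in># singular_values W"
    using one_in_singular_value_set mem_singular_values by blast
qed (use mem_singular_values singular_value_le_1 in auto)

text \<open>The largest stretch factor of \<open>W\<close> on the complement of the constants is itself a singular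
  value, because that complement is invariant.\<close>

lemma stretch_on_mean_zero:
  assumes "CARD('n) \<ge> 2"
  obtains r z where "r \<ge> 0" "z \<noteq> 0" "z \<bullet> 1 = 0" "z \<in> gram_eigenspace W r"
    "\<And>v. v \<bullet> 1 = 0 \<Longrightarrow> norm (W *v v) \<le> r * norm v"
proof -
  define S where "S = {z :: real ^ 'n. z \<bullet> 1 = 0} \<inter> sphere 0 1"
  have "closed {z :: real ^ 'n. z \<bullet> 1 = 0}"
    using closed_hyperplane[of "1 :: real ^ 'n" 0] by (simp add: inner_commute)
  then have "compact S"
    unfolding S_def by (intro closed_Int_compact) auto
  moreover have "S \<noteq> {}"
  proof -
    obtain i j :: 'n where ij: "i \<noteq> j"
      using assms by (metis UNIV_I card_1_singleton_iff card_le_Suc0_iff_eq finite not_less_eq_eq numeral_2_eq_2)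
    define z :: "real ^ 'n" where "z = axis i 1 - axis j 1"
    have "z \<bullet> 1 = 0"
      by (simp add: z_def inner_diff_left inner_axis')
    moreover have "z \<noteq> 0"
    proof
      assume "z = 0"
      then have "z $ i = 0"
        by simp
      then show False
        using ij by (simp add: z_def axis_def)
    qed
    ultimately have "(1 / norm z) *\<^sub>R z \<in> S"
      by (simp add: S_def)
    then show ?thesis
      by blast
  qed
  moreover have "continuous_on S (\<lambda>z. (norm (W *v z))\<^sup>2)"
    by (intro continuous_intros linear_continuous_on linear_conv_bounded_linear[THEN iffD1]) auto
  ultimately obtain z where z: "z \<in> S" "\<And>v. v \<in> S \<Longrightarrow> (norm (W *v v))\<^sup>2 \<le> (norm (W *v z))\<^sup>2"
    using continuous_attains_sup[of S "\<lambda>z. (norm (W *v z))\<^sup>2"] by blast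
  define \<mu> where "\<mu> = (norm (W *v z))\<^sup>2"
  have z1: "z \<bullet> 1 = 0" "norm z = 1"
    using z(1) by (auto simp: S_def)
  have le: "(norm (W *v v))\<^sup>2 \<le> \<mu> * (norm v)\<^sup>2" if v: "v \<bullet> 1 = 0" for v
  proof (cases "v = 0")
    case False
    have "(1 / norm v) *\<^sub>R v \<in> S"
      using v False by (simp add: S_def)
    from z(2)[OF this] show ?thesis
      using False by (simp add: matrix_vector_mult_scaleR \<mu>_def power_mult_distrib power_divide field_simps)
  qed simp
  \<comment> \<open>A maximizer of the stretch is an eigenvector: its residual \<open>h\<close> has mean zero, and perturbing \<open>z\<close> in the direction \<open>h\<close> shows that it vanishes.\<close>
  define h where "h = \<mu> *\<^sub>R z - W *v (W *v z)"
  have h1: "h \<bullet> 1 = 0"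
    using z1(1) by (simp add: h_def inner_diff_left W_selfadjoint W_one)
  have "z \<bullet> h = 0"
    using z1(2) norm_W_power2[of z] by (simp add: h_def inner_diff_right \<mu>_def power2_norm_eq_inner[symmetric])
  have "0 \<le> 2 * t * (h \<bullet> h) + t\<^sup>2 * (\<mu> * (norm h)\<^sup>2 - (norm (W *v h))\<^sup>2)" for t
  proof -
    have "0 \<le> \<mu> * (norm (z + t *\<^sub>R h))\<^sup>2 - (norm (W *v (z + t *\<^sub>R h)))\<^sup>2"
      using le[of "z + t *\<^sub>R h"] z1(1) h1 by (simp add: inner_add_left)
    also have "\<dots> = 2 * t * ((\<mu> *\<^sub>R z - W *v (W *v z)) \<bullet> h) + t\<^sup>2 * (\<mu> * (norm h)\<^sup>2 - (norm (W *v h))\<^sup>2)"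
    proof -
      have expand: "(norm (a + t *\<^sub>R b))\<^sup>2 = (norm a)\<^sup>2 + 2 * t * (a \<bullet> b) + t\<^sup>2 * (norm b)\<^sup>2" for a b :: "real ^ 'n"
        unfolding power2_norm_eq_inner
        by (simp add: inner_add_left inner_add_right inner_commute[of b a] algebra_simps power2_eq_square)
      have "(W *v z) \<bullet> (W *v h) = (W *v (W *v z)) \<bullet> h"
        by (simp add: W_selfadjoint)
      then show ?thesis
        unfolding matrix_vector_right_distrib matrix_vector_mult_scaleR expand
        using z1(2) by (simp add: \<mu>_def inner_diff_left algebra_simps)
    qed
    finally show ?thesis
      by (simp add: h_def)
  qed
  then have "h \<bullet> h = 0"
    by (rule quadratic_nonneg_imp_linear_zero)
  then have "W *v (W *v z) = \<mu> *\<^sub>R z"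
    by (simp add: h_def)
  then have "z \<in> gram_eigenspace W (sqrt \<mu>)"
    by (simp add: gram_eigenspace_iff \<mu>_def)
  moreover have "norm (W *v v) \<le> sqrt \<mu> * norm v" if "v \<bullet> 1 = 0" for v
  proof (rule power2_le_imp_le)
    show "(norm (W *v v))\<^sup>2 \<le> (sqrt \<mu> * norm v)\<^sup>2"
      using le[OF that] by (simp add: power_mult_distrib \<mu>_def)
  qed (simp add: \<mu>_def)
  moreover have "z \<noteq> 0"
    using z1(2) by auto
  ultimately show thesis
    using that[of "sqrt \<mu>" z] z1(1) by (simp add: \<mu>_def)
qed

text \<open>After removal of one copy of the top singular value \<open>1\<close>, the stretch factor \<open>r\<close> on mean zero vectors
  is still present: either \<open>r\<close> differs from \<open>1\<close>, or the eigenspace of \<open>1\<close> has dimension at least two.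
  The latter is excluded by connectedness, which makes that eigenspace one-dimensional.\<close>

lemma sigma2_props:
  shows "sigma2 W \<ge> 0" and "sigma2 W < 1" and "v \<bullet> 1 = 0 \<Longrightarrow> norm (W *v v) \<le> sigma2 W * norm v"
proof -
  have "sigma2 W \<ge> 0 \<and> sigma2 W < 1 \<and> (\<forall>v. v \<bullet> 1 = 0 \<longrightarrow> norm (W *v v) \<le> sigma2 W * norm v)"
  proof (cases "CARD('n) \<ge> 2")
    case True
    define sv where "sv = singular_values W - {# 1 #}"
    have s2: "sigma2 W = Max_mset sv"
      using True by (simp add: sigma2_def Max_singular_values sv_def)
    obtain r z where r: "r \<ge> 0" "z \<noteq> 0" "z \<bullet> 1 = 0" "z \<in> gram_eigenspace W r"
      "\<And>v. v \<bullet> 1 = 0 \<Longrightarrow> norm (W *v v) \<le> r * norm v"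
      using stretch_on_mean_zero[OF True] by blast
    have rS: "r \<in> singular_value_set"
      using r(1,2,4) by (auto simp: singular_value_set_def)
    have r_sv: "r \<in># sv"
    proof (cases "r = 1")
      case False
      then have "r \<in># singular_values W"
        using rS mem_singular_values by blast
      with False show ?thesis
        by (simp add: sv_def in_diff_count)
    next
      case True
      have "independent {1, z}"
      proof (rule pairwise_orthogonal_independent)
        show "pairwise orthogonal {1, z}"
          using r(3) by (auto simp: pairwise_def orthogonal_def inner_commute)
        show "0 \<notin> {1, z}"
          using r(2) by auto
      qed
      moreover have "{1, z} \<subseteq> gram_eigenspace W 1"
        using r(4) True by (auto simp: gram_eigenspace_iff W_one)
      ultimately have "card {1, z} \<le> dim (gram_eigenspace W 1)"
        by (intro independent_card_le_dim)
      moreover have "z \<noteq> 1"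
        using r(2,3) by auto
      ultimately have "2 \<le> dim (gram_eigenspace W 1)"
        by (metis card_2_iff)
      then show ?thesis
        using True by (simp add: sv_def in_diff_count count_singular_values one_in_singular_value_set)
    qed
    then have ge: "r \<le> sigma2 W"
      by (simp add: s2)
    have "set_mset sv \<noteq> {}"
      using r_sv by auto
    then have mem: "sigma2 W \<in># sv"
      unfolding s2 by (rule Max_in[OF finite_set_mset])
    have memS: "sigma2 W \<in> singular_value_set"
      using mem in_diffD mem_singular_values unfolding sv_def by fast
    have "sigma2 W \<noteq> 1"
    proof
      assume "sigma2 W = 1"
      then have "2 \<le> count (singular_values W) 1"
        using mem by (simp add: sv_def in_diff_count)
      then have "2 \<le> dim (gram_eigenspace W 1)"
        by (simp add: count_singular_values split: if_splits)
      also have "\<dots> \<le> card {1 :: real ^ 'n}"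
        using top_gram_eigenvector_constant by (intro dim_le_card) auto
      finally show False
        by simp
    qed
    moreover have "norm (W *v v) \<le> sigma2 W * norm v" if "v \<bullet> 1 = 0" for v
      using r(5)[OF that] mult_right_mono[OF ge norm_ge_zero, of v] by linarith
    ultimately show ?thesis
      using singular_value_le_1[OF memS] r(1) ge by force
  next
    case False
    then have "CARD('n) = Suc 0"
      using zero_less_card_finite[where 'a = 'n] by linarith
    then obtain k :: 'n where k: "UNIV = {k}"
      by (metis One_nat_def card_1_singletonE)
    have "v = 0" if "v \<bullet> 1 = 0" for v :: "real ^ 'n"
    proof -
      have "v $ k = 0"
        using that by (simp add: inner_one k)
      moreover have "i = k" for i
        using k by blast
      ultimately show ?thesis
        by (simp add: vec_eq_iff) metis
    qed
    then have "norm (W *v v) \<le> 0 * norm v" if "v \<bullet> 1 = 0" for v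
      using that by (metis matrix_vector_mult_0_right mult_zero_left norm_zero order_refl)
    then show ?thesis
      using False by (simp add: sigma2_def)
  qed
  then show "sigma2 W \<ge> 0" "sigma2 W < 1" "v \<bullet> 1 = 0 \<Longrightarrow> norm (W *v v) \<le> sigma2 W * norm v"
    by auto
qed

lemma spectral_gap_scalar:
  assumes "(\<Sum>i\<in>UNIV. z i) = 0"
  shows "(\<Sum>i\<in>UNIV. \<Sum>j\<in>UNIV. W $ i $ j * (z i * z j)) \<le> sigma2 W * (\<Sum>i\<in>UNIV. (z i)\<^sup>2)"
proof -
  define v :: "real ^ 'n" where "v = (\<chi> i. z i)"
  have v1: "v \<bullet> 1 = 0"
    using assms by (simp add: v_def inner_one)
  have "(\<Sum>i\<in>UNIV. \<Sum>j\<in>UNIV. W $ i $ j * (z i * z j)) = v \<bullet> (W *v v)"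
    by (simp add: inner_vec_def matrix_vector_mult_def v_def sum_distrib_left mult.left_commute)
  also have "\<dots> \<le> norm v * norm (W *v v)"
    using Cauchy_Schwarz_ineq2[of v "W *v v"] by linarith
  also have "\<dots> \<le> norm v * (sigma2 W * norm v)"
    using sigma2_props(3)[OF v1] by (intro mult_left_mono) auto
  also have "\<dots> = sigma2 W * (norm v)\<^sup>2"
    by (simp add: power2_eq_square)
  also have "(norm v)\<^sup>2 = (\<Sum>i\<in>UNIV. (z i)\<^sup>2)"
    by (simp add: norm_vec_power2 v_def)
  finally show ?thesis .
qed

end

text \<open>Gram-Schmidt for an arbitrary positive definite form. It transfers the spectral gap from
  real-valued to vector-valued configurations.\<close>

lemma positive_form_Parseval:
  fixes g :: "'e::euclidean_space \<Rightarrow> 'e \<Rightarrow> real"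
  assumes bil: "bilinear g" and sym: "\<And>u v. g u v = g v u" and pos: "\<And>u. u \<noteq> 0 \<Longrightarrow> g u u > 0"
  shows "\<exists>Q. finite Q \<and> (\<forall>u v. g u v = (\<Sum>q\<in>Q. g u q * g v q))"
proof -
  note g_simps = bilinear_ladd[OF bil] bilinear_radd[OF bil] bilinear_lmul[OF bil] bilinear_rmul[OF bil]
    bilinear_lsub[OF bil] bilinear_rsub[OF bil] bilinear_lzero[OF bil] bilinear_rzero[OF bil]
  have g_sum: "g (\<Sum>q\<in>Q. f q) v = (\<Sum>q\<in>Q. g (f q) v)" for Q :: "'e set" and f v
    by (induction Q rule: infinite_finite_induct) (simp_all add: g_simps)
  define V where "V Q = {u. (\<Sum>q\<in>Q. g u q *\<^sub>R q) = u}" for Q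
  have V_form: "g u v = (\<Sum>q\<in>Q. g u q * g q v)" if "u \<in> V Q" for u v Q
  proof -
    have "g u v = g (\<Sum>q\<in>Q. g u q *\<^sub>R q) v"
      using that by (simp add: V_def)
    then show ?thesis
      by (simp add: g_sum g_simps)
  qed
  have V_subspace: "subspace (V Q)" for Q
    unfolding subspace_def V_def
    by (auto simp: g_simps scaleR_add_left sum.distrib scaleR_sum_right[symmetric] simp flip: scaleR_scaleR)
  have "\<exists>Q. finite Q \<and> Q \<subseteq> V Q \<and> S \<subseteq> V Q" if "finite S" for S :: "'e set"
    using that
  proof induction
    case empty
    show ?case
      by (intro exI[of _ "{}"]) auto
  next
    case (insert x S)
    then obtain Q where Q: "finite Q" "Q \<subseteq> V Q" "S \<subseteq> V Q"
      by blast
    define y where "y = x - (\<Sum>q\<in>Q. g x q *\<^sub>R q)"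
    show ?case
    proof (cases "y = 0")
      case True
      then have "x \<in> V Q"
        by (simp add: y_def V_def)
      with Q show ?thesis
        by blast
    next
      case False
      define e where "e = (1 / sqrt (g y y)) *\<^sub>R y"
      have yy: "g y y > 0"
        by (rule pos[OF False])
      have ee: "g e e = 1"
        using yy by (simp add: e_def g_simps)
      have qy: "g q y = 0" if q: "q \<in> Q" for q
      proof -
        have "g q y = g q x - (\<Sum>p\<in>Q. g x p * g q p)"
          by (simp add: y_def g_simps sym[of q] g_sum)
        also have "g q x = (\<Sum>p\<in>Q. g q p * g p x)"
          by (rule V_form) (use q Q(2) in blast)
        finally show ?thesis
          by (simp add: sym[of _ x] mult.commute)
      qed
      have qe: "g q e = 0" if "q \<in> Q" for q
        using qy[OF that] by (simp add: e_def g_simps)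
      have eQ: "e \<notin> Q"
        using qe[of e] ee by auto
      have old: "u \<in> V (insert e Q)" if u: "u \<in> V Q" for u
      proof -
        have "g u e = 0"
          using V_form[OF u, of e] qe by simp
        then show ?thesis
          using u eQ Q(1) by (simp add: V_def)
      qed
      have new: "e \<in> V (insert e Q)"
      proof -
        have "g e q = 0" if "q \<in> Q" for q
          using qe[OF that] sym[of q e] by simp
        then show ?thesis
          using eQ Q(1) ee by (simp add: V_def)
      qed
      have "x = sqrt (g y y) *\<^sub>R e + (\<Sum>q\<in>Q. g x q *\<^sub>R q)"
        using yy by (simp add: e_def y_def)
      also have "\<dots> \<in> V (insert e Q)"
        using new old Q(2)
        by (intro subspace_add[OF V_subspace] subspace_scale[OF V_subspace] subspace_sum[OF V_subspace]) auto
      finally have "x \<in> V (insert e Q)" .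
      then show ?thesis
        using Q old new by (intro exI[of _ "insert e Q"]) auto
    qed
  qed
  from this[of Basis] obtain Q where Q: "finite Q" "Basis \<subseteq> V Q"
    by auto
  have "u \<in> V Q" for u
    using span_minimal[OF Q(2) V_subspace] span_Basis by auto
  then have "g u v = (\<Sum>q\<in>Q. g u q * g v q)" for u v
    using V_form[of u Q v] sym by simp
  with Q(1) show ?thesis
    by blast
qed

lemma (in network) spectral_gap_form:
  fixes g :: "'e::euclidean_space \<Rightarrow> 'e \<Rightarrow> real"
  assumes bil: "bilinear g" and sym: "\<And>u v. g u v = g v u" and pos: "\<And>u. u \<noteq> 0 \<Longrightarrow> g u u > 0"
    and mean: "(\<Sum>i\<in>UNIV. u i) = 0"
  shows "(\<Sum>i\<in>UNIV. \<Sum>j\<in>UNIV. W $ i $ j * g (u i) (u j)) \<le> sigma2 W * (\<Sum>i\<in>UNIV. g (u i) (u i))"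
proof -
  obtain Q where Q: "finite Q" "\<And>u v. g u v = (\<Sum>q\<in>Q. g u q * g v q)"
    using positive_form_Parseval[OF bil sym pos] by blast
  have lin: "linear (\<lambda>u. g u q)" for q
    using bil by (simp add: bilinear_def)
  have "(\<Sum>i\<in>UNIV. \<Sum>j\<in>UNIV. W $ i $ j * g (u i) (u j))
      = (\<Sum>i\<in>UNIV. \<Sum>j\<in>UNIV. \<Sum>q\<in>Q. W $ i $ j * (g (u i) q * g (u j) q))"
    by (subst Q(2)) (simp add: sum_distrib_left)
  also have "\<dots> = (\<Sum>i\<in>UNIV. \<Sum>q\<in>Q. \<Sum>j\<in>UNIV. W $ i $ j * (g (u i) q * g (u j) q))"
    by (subst sum.swap) (rule refl)
  also have "\<dots> = (\<Sum>q\<in>Q. \<Sum>i\<in>UNIV. \<Sum>j\<in>UNIV. W $ i $ j * (g (u i) q * g (u j) q))"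
    by (rule sum.swap)
  also have "\<dots> \<le> (\<Sum>q\<in>Q. sigma2 W * (\<Sum>i\<in>UNIV. (g (u i) q)\<^sup>2))"
  proof (intro sum_mono spectral_gap_scalar)
    fix q
    show "(\<Sum>i\<in>UNIV. g (u i) q) = 0"
      using linear_sum[OF lin, of u UNIV q] linear_0[OF lin] mean by simp
  qed
  also have "\<dots> = sigma2 W * (\<Sum>i\<in>UNIV. \<Sum>q\<in>Q. g (u i) q * g (u i) q)"
    by (subst sum.swap) (simp add: sum_distrib_left power2_eq_square)
  also have "\<dots> = sigma2 W * (\<Sum>i\<in>UNIV. g (u i) (u i))"
    by (simp add: Q(2)[symmetric])
  finally show ?thesis .
qed


section \<open>The consensus step\<close>

text \<open>Jensen's inequality, as nonnegativity of a variance.\<close>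

lemma (in riemannian) rinner_mean_le:
  fixes w :: "'k::finite \<Rightarrow> real"
  assumes x: "x \<in> manifold_carrier R" and w: "\<And>k. w k \<ge> 0" "(\<Sum>k\<in>UNIV. w k) = 1"
  shows "rinner R x (\<lambda>c. \<Sum>k\<in>UNIV. w k *\<^sub>R u k c) (\<lambda>c. \<Sum>k\<in>UNIV. w k *\<^sub>R u k c)
    \<le> (\<Sum>k\<in>UNIV. w k * rinner R x (u k) (u k))"
proof -
  let ?m = "\<lambda>c. \<Sum>k\<in>UNIV. w k *\<^sub>R u k c"
  have pair: "rinner R x ?m v = (\<Sum>k\<in>UNIV. w k * rinner R x (u k) v)" for v
    using rinner_sum_left[OF x, of "\<lambda>k c. w k *\<^sub>R u k c" UNIV v] by (simp add: rinner_scale_left[OF x])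
  have "0 \<le> (\<Sum>k\<in>UNIV. w k * rinner R x (\<lambda>c. u k c - ?m c) (\<lambda>c. u k c - ?m c))"
    by (intro sum_nonneg mult_nonneg_nonneg w rinner_nonneg[OF x])
  also have "\<dots> = (\<Sum>k\<in>UNIV. w k * rinner R x (u k) (u k) - 2 * (w k * rinner R x (u k) ?m) + w k * rinner R x ?m ?m)"
  proof (rule sum.cong[OF refl])
    fix k
    show "w k * rinner R x (\<lambda>c. u k c - ?m c) (\<lambda>c. u k c - ?m c)
        = w k * rinner R x (u k) (u k) - 2 * (w k * rinner R x (u k) ?m) + w k * rinner R x ?m ?m"
      unfolding rinner_diff_left[OF x] rinner_diff_right[OF x] rinner_sym[OF x, of ?m "u k"]
      by (simp add: algebra_simps)
  qed
  also have "\<dots> = (\<Sum>k\<in>UNIV. w k * rinner R x (u k) (u k)) - 2 * (\<Sum>k\<in>UNIV. w k * rinner R x (u k) ?m)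
      + (\<Sum>k\<in>UNIV. w k) * rinner R x ?m ?m"
    by (simp add: sum.distrib sum_subtractf sum_distrib_left sum_distrib_right)
  finally show ?thesis
    by (simp add: w(2) pair[symmetric])
qed

text \<open>The consensus step is deterministic: it concerns one configuration \<open>y\<close> of the agents.\<close>

locale decentralized_network =
  comparison_domain R X Kmin Kmax D C1 C2 C3 C4 + network E W
  for R :: "('a::{second_countable_topology, t2_space}, 'e::euclidean_space) riemannian"
    and X :: "'a set" and Kmin Kmax D C1 C2 C3 C4 :: real
    and E :: "'n::finite \<Rightarrow> 'n \<Rightarrow> bool" and W :: "real ^ 'n ^ 'n"
begin

definition mixing_rate :: real where
  "mixing_rate = C2 ^ 3 * (1 - sigma2 W) / (4 * C1 * (1 + C4 * D\<^sup>2)\<^sup>2)"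

definition spread :: "('n \<Rightarrow> 'a) \<Rightarrow> 'a \<Rightarrow> real" where
  "spread y z = (\<Sum>i\<in>UNIV. (rdist R (y i) z)\<^sup>2)"

definition disagreement :: "('n \<Rightarrow> 'a) \<Rightarrow> real" where
  "disagreement y = (\<Sum>i\<in>UNIV. \<Sum>j\<in>UNIV. W $ i $ j * (rdist R (y i) (y j))\<^sup>2)"

definition consensus_direction :: "('n \<Rightarrow> 'a) \<Rightarrow> 'n \<Rightarrow> ('a, 'e) tangent_vector" where
  "consensus_direction y i = (\<lambda>c. \<Sum>j\<in>UNIV. W $ i $ j *\<^sub>R rlog R (y i) (y j) c)"

lemma CARD_pos: "real CARD('n) > 0"
  by simp

lemma sum_W_left: "(\<Sum>i\<in>UNIV. \<Sum>j\<in>UNIV. W $ i $ j * f i) = (\<Sum>i\<in>UNIV. f i)"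
  and sum_W_right: "(\<Sum>i\<in>UNIV. \<Sum>j\<in>UNIV. W $ i $ j * f j) = (\<Sum>j\<in>UNIV. f j)"
proof -
  show "(\<Sum>i\<in>UNIV. \<Sum>j\<in>UNIV. W $ i $ j * f i) = (\<Sum>i\<in>UNIV. f i)"
    by (simp add: sum_distrib_right[symmetric] W_row_sum)
  show "(\<Sum>i\<in>UNIV. \<Sum>j\<in>UNIV. W $ i $ j * f j) = (\<Sum>j\<in>UNIV. f j)"
    by (subst sum.swap) (simp add: sum_distrib_right[symmetric] W_col_sum)
qed

context
  fixes y :: "'n \<Rightarrow> 'a"
  assumes y: "\<And>i. y i \<in> X"
begin

lemma consensus_direction_tangent: "consensus_direction y i \<in> tangent_space R (y i)"
  unfolding consensus_direction_def by (intro tangent_space_sum tangent_space_scale rlog_tangent y)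

lemma consensus_direction_length:
  "rinner R (y i) (consensus_direction y i) (consensus_direction y i)
    \<le> (\<Sum>j\<in>UNIV. W $ i $ j * (rdist R (y i) (y j))\<^sup>2)"
  using rinner_mean_le[OF X_carrier[OF y], of "\<lambda>j. W $ i $ j" i "\<lambda>j. rlog R (y i) (y j)"]
  by (simp add: W_nonneg W_row_sum consensus_direction_def rinner_rlog_self y)

lemma rnorm_consensus_direction_le: "rnorm R (y i) (consensus_direction y i) \<le> D"
proof (rule power2_le_imp_le)
  have "(rdist R (y i) (y j))\<^sup>2 \<le> D\<^sup>2" for j
    using rdist_le_D[OF y y] rdist_nonneg[OF y y] by (rule power_mono)
  then have "(\<Sum>j\<in>UNIV. W $ i $ j * (rdist R (y i) (y j))\<^sup>2) \<le> (\<Sum>j\<in>UNIV. W $ i $ j * D\<^sup>2)"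
    by (intro sum_mono mult_left_mono W_nonneg)
  also have "\<dots> = D\<^sup>2"
    by (simp add: sum_distrib_right[symmetric] W_row_sum)
  finally show "(rnorm R (y i) (consensus_direction y i))\<^sup>2 \<le> D\<^sup>2"
    using consensus_direction_length[of i] by (simp add: rnorm_power2[OF X_carrier[OF y]])
qed (use D_pos in simp)

text \<open>The step length \<open>C2 / (2 * C1)\<close> maximizes the gain \<open>s * C2 - C1 * s\<^sup>2\<close> produced by the lower
  and upper comparison inequalities; the cross terms cancel because \<open>W\<close> is doubly stochastic.\<close>

lemma consensus_step_decrease:
  assumes x: "\<And>i. x i \<in> X" and z: "z \<in> X" and s: "s = C2 / (2 * C1)"
    and step: "\<And>i. x i = rexp R (y i) (\<lambda>c. s *\<^sub>R consensus_direction y i c)"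
  shows "spread x z \<le> spread y z - C2\<^sup>2 / (4 * C1) * disagreement y"
proof -
  let ?v = "consensus_direction y"
  have s01: "0 \<le> s" "s \<le> 1"
    using C1 C2 by (auto simp: s field_simps)
  have log: "rlog R (y i) (x i) = (\<lambda>c. s *\<^sub>R ?v i c)" for i
  proof -
    have "rnorm R (y i) (\<lambda>c. s *\<^sub>R ?v i c) \<le> 1 * D"
      unfolding rnorm_scale[OF X_carrier[OF y]] using s01 rnorm_consensus_direction_le rnorm_nonneg[OF X_carrier[OF y]]
      by (intro mult_mono) auto
    then have "ereal (rnorm R (y i) (\<lambda>c. s *\<^sub>R ?v i c)) < inj_radius R (y i)"
      using D_less_inj_radius[OF y, of i] by (metis ereal_less_eq(3) mult_1 order_le_less_trans)
    then show ?thesis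
      unfolding step[of i]
      by (rule rlog_rexp[OF X_carrier[OF y] tangent_space_scale[OF consensus_direction_tangent]])
  qed
  have each: "(rdist R (x i) z)\<^sup>2 \<le> (rdist R (y i) z)\<^sup>2 - C2\<^sup>2 / (4 * C1) * (\<Sum>j\<in>UNIV. W $ i $ j * (rdist R (y i) (y j))\<^sup>2)
      - s * ((\<Sum>j\<in>UNIV. W $ i $ j * (rdist R z (y i))\<^sup>2) - (\<Sum>j\<in>UNIV. W $ i $ j * (rdist R z (y j))\<^sup>2))" for i
  proof -
    let ?S = "\<Sum>j\<in>UNIV. W $ i $ j * (rdist R (y i) (y j))\<^sup>2"
    let ?cross = "\<Sum>j\<in>UNIV. W $ i $ j * rinner R (y i) (rlog R (y i) z) (rlog R (y i) (y j))"
    have "(rdist R (y i) (x i))\<^sup>2 = s\<^sup>2 * rinner R (y i) (?v i) (?v i)"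
      using rinner_rlog_self[OF y x, of i i]
      by (simp add: log rinner_scale_left[OF X_carrier[OF y]] rinner_scale_right[OF X_carrier[OF y]] power2_eq_square mult.assoc)
    also have "\<dots> \<le> s\<^sup>2 * ?S"
      by (intro mult_left_mono consensus_direction_length) simp
    finally have len: "C1 * (rdist R (y i) (x i))\<^sup>2 \<le> C1 * (s\<^sup>2 * ?S)"
      using C1 by (intro mult_left_mono) auto
    have cross: "rinner R (y i) (rlog R (y i) z) (rlog R (y i) (x i)) = s * ?cross"
      unfolding log rinner_scale_right[OF X_carrier[OF y]] consensus_direction_def
      using rinner_sum_right[OF X_carrier[OF y], of i "rlog R (y i) z" "\<lambda>j c. W $ i $ j *\<^sub>R rlog R (y i) (y j) c" UNIV]
      by (simp add: rinner_scale_right[OF X_carrier[OF y]])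
    have "(\<Sum>j\<in>UNIV. W $ i $ j * (C2 * (rdist R (y i) (y j))\<^sup>2 + (rdist R z (y i))\<^sup>2 - (rdist R z (y j))\<^sup>2))
        \<le> (\<Sum>j\<in>UNIV. W $ i $ j * (2 * rinner R (y i) (rlog R (y i) z) (rlog R (y i) (y j))))"
    proof (intro sum_mono mult_left_mono W_nonneg)
      fix j
      show "C2 * (rdist R (y i) (y j))\<^sup>2 + (rdist R z (y i))\<^sup>2 - (rdist R z (y j))\<^sup>2
          \<le> 2 * rinner R (y i) (rlog R (y i) z) (rlog R (y i) (y j))"
        using comparison_lower[OF z y y, of i j] by linarith
    qed
    also have "\<dots> = 2 * ?cross"
      by (simp add: sum_distrib_left mult.left_commute)
    also have "(\<Sum>j\<in>UNIV. W $ i $ j * (C2 * (rdist R (y i) (y j))\<^sup>2 + (rdist R z (y i))\<^sup>2 - (rdist R z (y j))\<^sup>2))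
        = C2 * ?S + ((\<Sum>j\<in>UNIV. W $ i $ j * (rdist R z (y i))\<^sup>2) - (\<Sum>j\<in>UNIV. W $ i $ j * (rdist R z (y j))\<^sup>2))"
      by (simp add: distrib_left right_diff_distrib sum.distrib sum_subtractf sum_distrib_left mult.left_commute)
    finally have "s * (C2 * ?S + ((\<Sum>j\<in>UNIV. W $ i $ j * (rdist R z (y i))\<^sup>2) - (\<Sum>j\<in>UNIV. W $ i $ j * (rdist R z (y j))\<^sup>2)))
        \<le> s * (2 * ?cross)"
      using s01 by (intro mult_left_mono) auto
    moreover have "(rdist R z (x i))\<^sup>2 \<le> C1 * (s\<^sup>2 * ?S) + (rdist R z (y i))\<^sup>2 - 2 * (s * ?cross)"
      using comparison_upper[OF z y x, of i i] len unfolding cross by linarith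
    moreover have "C1 * (s\<^sup>2 * ?S) - s * (C2 * ?S) = - (C2\<^sup>2 / (4 * C1) * ?S)"
      using C1 by (simp add: s field_simps power2_eq_square)
    ultimately show ?thesis
      using rdist_sym[OF x z, of i] rdist_sym[OF y z, of i] by (simp add: distrib_left)
  qed
  have "spread x z \<le> (\<Sum>i\<in>UNIV. (rdist R (y i) z)\<^sup>2 - C2\<^sup>2 / (4 * C1) * (\<Sum>j\<in>UNIV. W $ i $ j * (rdist R (y i) (y j))\<^sup>2)
      - s * ((\<Sum>j\<in>UNIV. W $ i $ j * (rdist R z (y i))\<^sup>2) - (\<Sum>j\<in>UNIV. W $ i $ j * (rdist R z (y j))\<^sup>2)))"
    unfolding spread_def by (intro sum_mono each)
  also have "\<dots> = spread y z - C2\<^sup>2 / (4 * C1) * disagreement y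
      - s * ((\<Sum>i\<in>UNIV. \<Sum>j\<in>UNIV. W $ i $ j * (rdist R z (y i))\<^sup>2) - (\<Sum>i\<in>UNIV. \<Sum>j\<in>UNIV. W $ i $ j * (rdist R z (y j))\<^sup>2))"
    unfolding spread_def disagreement_def sum_subtractf sum_distrib_left[symmetric] ..
  also have "\<dots> = spread y z - C2\<^sup>2 / (4 * C1) * disagreement y"
    by (simp only: sum_W_left sum_W_right diff_self mult_zero_right diff_zero)
  finally show ?thesis .
qed

text \<open>Up to a factor, the negative gradient of the spread at \<open>z\<close>.\<close>

definition pull :: "'a \<Rightarrow> ('a, 'e) tangent_vector" where
  "pull z = (\<lambda>c. \<Sum>i\<in>UNIV. rlog R z (y i) c)"

text \<open>A Poincare inequality on the network: in the tangent space at \<open>z\<close> the logarithms of the agents are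
  centred by subtracting their mean, the spectral gap bounds their differences from below, and the
  upper logarithm estimate replaces the differences by distances. The defect \<open>pull z\<close> vanishes at
  a minimizer of the spread.\<close>

lemma disagreement_lower_bound:
  assumes z: "z \<in> X"
  shows "2 * (1 - sigma2 W) * (spread y z - rinner R z (pull z) (pull z) / real CARD('n))
    \<le> (1 + C4 * D\<^sup>2)\<^sup>2 * disagreement y"
proof -
  let ?c = "chart_at R z"
  define g where "g = gram R ?c (chart_map ?c z)"
  note zc = chart_at_props[OF X_carrier[OF z]]
  note g_simps = gram_simps[OF zc(1,3), folded g_def]
  have rg: "rinner R z u v = g (u ?c) (v ?c)" for u v
    by (simp add: rinner_def g_def Let_def)
  define n where "n = real CARD('n)"
  have n: "n > 0"
    by (simp add: n_def)
  define u where "u i = rlog R z (y i) ?c" for i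
  define U where "U = (\<Sum>i\<in>UNIV. u i)"
  define v where "v i = u i - (1 / n) *\<^sub>R U" for i
  have sym: "g a b = g b a" for a b
    unfolding g_def by (rule gram_sym[OF zc(1,3)])
  have gU: "g U b = (\<Sum>i\<in>UNIV. g (u i) b)" for b
    unfolding U_def g_def by (rule linear_sum[OF linear_gram_left[OF zc(1,3)]])
  have "(\<Sum>i\<in>UNIV. v i) = 0"
    using n by (simp add: v_def sum_subtractf U_def n_def sum_constant_scaleR)
  then have gap: "(\<Sum>i\<in>UNIV. \<Sum>j\<in>UNIV. W $ i $ j * g (v i) (v j)) \<le> sigma2 W * (\<Sum>i\<in>UNIV. g (v i) (v i))"
    by (intro spectral_gap_form) (use bilinear_gram[OF zc(1,3)] gram_pos[OF zc(1,3)] sym in \<open>auto simp: g_def\<close>)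
  have "(\<Sum>i\<in>UNIV. g (v i) (v i)) = (\<Sum>i\<in>UNIV. g (u i) (u i) - 2 / n * g (u i) U + g U U / n\<^sup>2)"
  proof (rule sum.cong[OF refl])
    fix i
    show "g (v i) (v i) = g (u i) (u i) - 2 / n * g (u i) U + g U U / n\<^sup>2"
      by (simp add: v_def g_simps sym[of U "u i"] power2_eq_square diff_divide_distrib)
  qed
  also have "\<dots> = (\<Sum>i\<in>UNIV. g (u i) (u i)) - 2 / n * g U U + n * (g U U / n\<^sup>2)"
    by (simp add: sum.distrib sum_subtractf sum_distrib_left[symmetric] sum_divide_distrib[symmetric] gU n_def)
  also have "\<dots> = spread y z - g U U / n"
  proof -
    have "g (u i) (u i) = (rdist R (y i) z)\<^sup>2" for i
      using rinner_rlog_self[OF z y, of i] rdist_sym[OF y z, of i] by (simp add: rg u_def)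
    then show ?thesis
      using n by (simp add: spread_def power2_eq_square)
  qed
  finally have vv: "(\<Sum>i\<in>UNIV. g (v i) (v i)) = spread y z - g U U / n" .
  have "(\<Sum>i\<in>UNIV. \<Sum>j\<in>UNIV. W $ i $ j * g (u i - u j) (u i - u j))
      = (\<Sum>i\<in>UNIV. \<Sum>j\<in>UNIV. W $ i $ j * g (v i) (v i) + W $ i $ j * g (v j) (v j) - 2 * (W $ i $ j * g (v i) (v j)))"
  proof (intro sum.cong refl)
    fix i j
    have diff: "u i - u j = v i - v j"
      by (simp add: v_def)
    show "W $ i $ j * g (u i - u j) (u i - u j)
        = W $ i $ j * g (v i) (v i) + W $ i $ j * g (v j) (v j) - 2 * (W $ i $ j * g (v i) (v j))"
      unfolding diff by (simp add: g_simps sym[of "v j" "v i"] algebra_simps)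
  qed
  also have "\<dots> = 2 * (\<Sum>i\<in>UNIV. g (v i) (v i)) - 2 * (\<Sum>i\<in>UNIV. \<Sum>j\<in>UNIV. W $ i $ j * g (v i) (v j))"
    by (simp add: sum.distrib sum_subtractf sum_distrib_left[symmetric] sum_W_right)
       (simp add: sum_distrib_right[symmetric] W_row_sum)
  finally have "2 * (1 - sigma2 W) * (\<Sum>i\<in>UNIV. g (v i) (v i))
      \<le> (\<Sum>i\<in>UNIV. \<Sum>j\<in>UNIV. W $ i $ j * g (u i - u j) (u i - u j))"
    using gap by (simp add: algebra_simps)
  also have "\<dots> \<le> (\<Sum>i\<in>UNIV. \<Sum>j\<in>UNIV. W $ i $ j * ((1 + C4 * D\<^sup>2)\<^sup>2 * (rdist R (y i) (y j))\<^sup>2))"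
  proof (intro sum_mono mult_left_mono W_nonneg)
    fix i j
    have "g (u i - u j) (u i - u j) = (rnorm R z (\<lambda>k. rlog R z (y i) k - rlog R z (y j) k))\<^sup>2"
      by (simp add: rnorm_power2[OF X_carrier[OF z]] rg u_def)
    also have "\<dots> \<le> ((1 + C4 * D\<^sup>2) * rdist R (y i) (y j))\<^sup>2"
      by (intro power_mono log_upper[OF z y y] rnorm_nonneg[OF X_carrier[OF z]])
    finally show "g (u i - u j) (u i - u j) \<le> (1 + C4 * D\<^sup>2)\<^sup>2 * (rdist R (y i) (y j))\<^sup>2"
      by (simp add: power_mult_distrib)
  qed
  also have "\<dots> = (1 + C4 * D\<^sup>2)\<^sup>2 * disagreement y"
    by (simp add: disagreement_def sum_distrib_left mult.left_commute)
  finally show ?thesis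
    by (simp add: vv rg pull_def u_def[symmetric] U_def[symmetric] n_def)
qed

text \<open>The existence of a minimizer of the spread over \<open>X\<close> would rest on compactness; an approximate
  minimizer, for which the pull is small, serves equally well.\<close>

lemma approximate_mean:
  assumes e: "e > 0"
  obtains z where "z \<in> X" "\<And>q. q \<in> X \<Longrightarrow> spread y z \<le> spread y q + e"
    "rinner R z (pull z) (pull z) / real CARD('n) \<le> e"
proof -
  define n where "n = real CARD('n)"
  have n: "n \<ge> 1"
    by (simp add: n_def Suc_leI)
  define K where "K = n * (C1 * D\<^sup>2)"
  have K: "K > 0"
    using n C1 D_pos by (simp add: K_def)
  define t where "t = min 1 (e / K)"
  have t: "t > 0" "t \<in> {0..1}" "t * K \<le> e"
    using e K by (auto simp: t_def min_def field_simps)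
  \<comment> \<open>The error \<open>d\<close> of the minimizer is divided by \<open>t\<close> in the slope estimate, whence the factor \<open>t\<close>.\<close>
  define d where "d = e * t"
  have d: "d > 0" "d \<le> e"
    using e t by (auto simp: d_def)
  let ?A = "spread y ` X"
  have A: "?A \<noteq> {}" "bdd_below ?A"
    using y by (auto intro!: bdd_belowI2[where m = 0] sum_nonneg simp: spread_def)
  obtain z where z: "z \<in> X" "spread y z < Inf ?A + d"
    using cInf_lessD[OF A(1), of "Inf ?A + d"] d(1) by auto
  have min: "spread y z \<le> spread y q + d" if "q \<in> X" for q
    using z(2) cInf_lower[OF _ A(2), of "spread y q"] that by force
  have disp: "dispersion (\<lambda>i::'n. 1 / n) y q = spread y q / n" for q
    by (simp add: dispersion_def spread_def sum_divide_distrib)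
  have slope: "2 * t * rinner R z (pull z) (rlog R z (y j)) \<le> d + t * e" for j
  proof -
    have "2 * t * (\<Sum>i\<in>UNIV. 1 / n * rinner R z (rlog R z (y i)) (rlog R z (y j))) \<le> d / n + C1 * t\<^sup>2 * D\<^sup>2"
    proof (rule approximate_minimizer_slope[OF _ _ y z(1) _ y t(2)])
      show "dispersion (\<lambda>i::'n. 1 / n) y z \<le> dispersion (\<lambda>i::'n. 1 / n) y q + d / n" if "q \<in> X" for q
        using min[OF that] n by (simp add: disp divide_right_mono flip: add_divide_distrib)
    qed (use n in \<open>auto simp: n_def\<close>)
    then have "n * (2 * t * (\<Sum>i\<in>UNIV. 1 / n * rinner R z (rlog R z (y i)) (rlog R z (y j)))) \<le> n * (d / n + C1 * t\<^sup>2 * D\<^sup>2)"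
      using n by (intro mult_left_mono) auto
    also have "n * (2 * t * (\<Sum>i\<in>UNIV. 1 / n * rinner R z (rlog R z (y i)) (rlog R z (y j))))
        = 2 * t * rinner R z (pull z) (rlog R z (y j))"
      using n unfolding pull_def rinner_sum_left[OF X_carrier[OF z(1)]] by (simp add: sum_divide_distrib[symmetric])
    also have "n * (d / n + C1 * t\<^sup>2 * D\<^sup>2) = d + t * (t * K)"
      using n by (simp add: K_def power2_eq_square algebra_simps)
    also have "\<dots> \<le> d + t * e"
      using t by (intro add_left_mono mult_left_mono) auto
    finally show ?thesis .
  qed
  have "2 * t * rinner R z (pull z) (pull z) = (\<Sum>j\<in>UNIV. 2 * t * rinner R z (pull z) (rlog R z (y j)))"
    using rinner_sum_right[OF X_carrier[OF z(1)], of "pull z" "\<lambda>j. rlog R z (y j)" UNIV]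
    by (simp add: sum_distrib_left pull_def)
  also have "\<dots> \<le> (\<Sum>j\<in>(UNIV::'n set). d + t * e)"
    by (intro sum_mono slope)
  also have "\<dots> = 2 * t * (n * e)"
    by (simp add: n_def d_def)
  finally have "rinner R z (pull z) (pull z) \<le> n * e"
    using t(1) by simp
  then have "rinner R z (pull z) (pull z) / n \<le> e"
    using n by (simp add: field_simps)
  moreover have "spread y z \<le> spread y q + e" if "q \<in> X" for q
    using min[OF that] d(2) by linarith
  ultimately show thesis
    using that z(1) by (simp add: n_def)
qed

end

lemma mixing_rate_pos: "mixing_rate > 0"
  and mixing_rate_le: "mixing_rate \<le> 1 / 4"
proof -
  have q: "1 \<le> (1 + C4 * D\<^sup>2)\<^sup>2"
    using C4 by (intro one_le_power) simp
  have "4 * 1 * 1 \<le> 4 * C1 * (1 + C4 * D\<^sup>2)\<^sup>2"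
    using C1 q by (intro mult_mono) auto
  then have den: "4 \<le> 4 * C1 * (1 + C4 * D\<^sup>2)\<^sup>2"
    by simp
  have num: "C2 ^ 3 * (1 - sigma2 W) \<le> 1 * 1"
    by (intro mult_mono power_le_one) (use C2 sigma2_props(1,2) in auto)
  have num_pos: "0 < C2 ^ 3 * (1 - sigma2 W)"
    using C2 sigma2_props(2) by simp
  show "mixing_rate > 0"
    unfolding mixing_rate_def using num_pos den by (intro divide_pos_pos) auto
  have "mixing_rate \<le> 1 / 4"
    unfolding mixing_rate_def using num den by (intro frac_le) auto
  then show "mixing_rate \<le> 1 / 4" .
qed

text \<open>The decrease of the spread and the Poincare inequality are combined at an approximate minimizer \<open>z\<close> of
  the spread of \<open>y\<close>. The minimal spread of \<open>x\<close> is at most the spread around \<open>z\<close>, and that of \<open>y\<close>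
  around \<open>z\<close> is almost at most that around any competitor \<open>q\<close>, in particular around the mean of the
  previous iterates.\<close>

theorem consensus_contraction:
  assumes y: "\<And>i. y i \<in> X" and x: "\<And>i. x i \<in> X" and s: "s = C2 / (2 * C1)"
    and step: "\<And>i. x i = rexp R (y i) (\<lambda>c. s *\<^sub>R consensus_direction y i c)"
    and m: "\<And>z. z \<in> X \<Longrightarrow> spread x m \<le> spread x z" and q: "q \<in> X"
  shows "spread x m \<le> (1 - mixing_rate) * spread y q"
proof (rule field_le_epsilon)
  fix e :: real assume e: "e > 0"
  have e2: "e / 2 > 0"
    using e by simp
  obtain z where z: "z \<in> X" "\<And>q. q \<in> X \<Longrightarrow> spread y z \<le> spread y q + e / 2"
    "rinner R z (pull y z) (pull y z) / real CARD('n) \<le> e / 2"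
    by (rule approximate_mean[where y = y, OF y e2]) (rule that)
  define \<kappa> where "\<kappa> = (1 + C4 * D\<^sup>2)\<^sup>2"
  have \<kappa>: "\<kappa> \<ge> 1"
    unfolding \<kappa>_def using C4 by (intro one_le_power) simp
  define \<beta> where "\<beta> = C2\<^sup>2 * (1 - sigma2 W) / (2 * C1 * \<kappa>)"
  \<comment> \<open>The available rate \<open>\<beta>\<close> is even \<open>2 / C2\<close> times the claimed one.\<close>
  have rate: "mixing_rate = \<beta> * (C2 / 2)"
    using C1 \<kappa> by (simp add: mixing_rate_def \<beta>_def \<kappa>_def power2_eq_square power3_eq_cube mult_ac)
  have \<beta>0: "\<beta> \<ge> 0"
    using C1 \<kappa> sigma2_props(2) by (simp add: \<beta>_def)
  have "C2\<^sup>2 * (1 - sigma2 W) \<le> 1 * 1"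
    using C2 sigma2_props(1,2) by (intro mult_mono power_le_one) auto
  moreover have "2 * 1 * 1 \<le> 2 * C1 * \<kappa>"
    using C1 \<kappa> by (intro mult_mono) auto
  ultimately have "\<beta> \<le> 1 / 1"
    unfolding \<beta>_def by (intro frac_le) auto
  then have \<beta>1: "\<beta> \<le> 1"
    by simp
  have "mixing_rate \<le> \<beta> * 1"
    unfolding rate using \<beta>0 C2 by (intro mult_left_mono) auto
  then have r\<beta>: "mixing_rate \<le> \<beta>"
    by simp
  have S0: "spread y z \<ge> 0"
    by (simp add: spread_def sum_nonneg)
  have "2 * (1 - sigma2 W) * (spread y z - e / 2) \<le> \<kappa> * disagreement y"
  proof -
    have "2 * (1 - sigma2 W) * (spread y z - e / 2)
        \<le> 2 * (1 - sigma2 W) * (spread y z - rinner R z (pull y z) (pull y z) / real CARD('n))"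
      using z(3) sigma2_props(2) by (intro mult_left_mono) auto
    then show ?thesis
      using disagreement_lower_bound[where y = y, OF y z(1)] unfolding \<kappa>_def by linarith
  qed
  then have "C2\<^sup>2 / (4 * C1 * \<kappa>) * (2 * (1 - sigma2 W) * (spread y z - e / 2)) \<le> C2\<^sup>2 / (4 * C1 * \<kappa>) * (\<kappa> * disagreement y)"
    using C1 \<kappa> by (intro mult_left_mono) auto
  moreover have "C2\<^sup>2 / (4 * C1 * \<kappa>) * (2 * (1 - sigma2 W) * f) = \<beta> * f" for f
  proof -
    have "C2\<^sup>2 / (4 * C1 * \<kappa>) = C2\<^sup>2 / (2 * C1 * \<kappa>) / 2" "\<beta> = C2\<^sup>2 / (2 * C1 * \<kappa>) * (1 - sigma2 W)"
      by (simp_all add: \<beta>_def)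
    then show ?thesis
      by (simp only: mult.assoc[symmetric]) simp
  qed
  moreover have "C2\<^sup>2 / (4 * C1 * \<kappa>) * (\<kappa> * f) = C2\<^sup>2 / (4 * C1) * f" for f
    using \<kappa> by simp
  ultimately have gain: "\<beta> * (spread y z - e / 2) \<le> C2\<^sup>2 / (4 * C1) * disagreement y"
    by simp
  have "spread x m \<le> spread x z"
    by (rule m[OF z(1)])
  also have "\<dots> \<le> spread y z - \<beta> * (spread y z - e / 2)"
    using consensus_step_decrease[where y = y and x = x, OF y x z(1) s step] gain by linarith
  also have "\<dots> = spread y z - \<beta> * spread y z + \<beta> * (e / 2)"
    by (simp add: right_diff_distrib)
  also have "\<dots> \<le> spread y z - mixing_rate * spread y z + 1 * (e / 2)"
    using r\<beta> S0 \<beta>1 e by (intro add_mono diff_left_mono mult_right_mono) auto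
  also have "\<dots> = (1 - mixing_rate) * spread y z + e / 2"
    by (simp add: left_diff_distrib)
  also have "\<dots> \<le> (1 - mixing_rate) * (spread y q + e / 2) + e / 2"
    using z(2)[OF q] mixing_rate_le by (intro add_right_mono mult_left_mono) auto
  also have "\<dots> \<le> (1 - mixing_rate) * spread y q + e"
    using mixing_rate_pos e by (simp add: algebra_simps)
  finally show "spread x m \<le> (1 - mixing_rate) * spread y q + e" .
qed

end

section \<open>The recursion\<close>

text \<open>For small \<open>t\<close> the geometric series bounds \<open>V t\<close> by \<open>K / r\<^sup>2\<close>, which is enough as long as
  \<open>t \<le> (1 + r\<^sup>2) / r\<^sup>2\<close>; from then on the bound \<open>1 / t\<close> decays slowly enough to be reproduced by
  the recursion.\<close>

lemma recursion_bound:
  fixes V :: "nat \<Rightarrow> real"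
  assumes r: "0 < r" "r \<le> 1" and K: "K \<ge> 0" and V1: "V 1 = 0"
    and rec: "\<And>t. t \<in> {1..T} \<Longrightarrow> V (t + 1) \<le> (1 - r\<^sup>2) * V t + K / real t"
    and t: "t \<in> {1..T+1}"
  shows "V t \<le> K * ((1 + r\<^sup>2) / r ^ 4) / real t"
proof -
  have r2: "0 < r\<^sup>2" "r\<^sup>2 \<le> 1"
    using r by (auto intro: power_le_one)
  have geometric: "V t \<le> K / r\<^sup>2" if "1 \<le> t" "t \<le> T + 1" for t
    using that
  proof (induction t rule: dec_induct)
    case base
    then show ?case
      using V1 K r2 by simp
  next
    case (step t)
    have "V (Suc t) \<le> (1 - r\<^sup>2) * V t + K / real t"
      using rec[of t] step by simp
    also have "\<dots> \<le> (1 - r\<^sup>2) * (K / r\<^sup>2) + K / 1"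
      using step r2 K by (intro add_mono mult_left_mono divide_left_mono) auto
    also have "\<dots> = K / r\<^sup>2"
      using r2 by (simp add: field_simps)
    finally show ?case .
  qed
  define c where "c = (1 + r\<^sup>2) / r ^ 4"
  have c: "c > 0" "r\<^sup>2 * c = 1 + 1 / r\<^sup>2"
    using r2 r by (auto simp: c_def add_pos_pos field_simps power2_eq_square power4_eq_xxxx)
  have "V t \<le> K * c / real t" if "1 \<le> t" "t \<le> T + 1" for t
    using that
  proof (induction t rule: dec_induct)
    case base
    then show ?case
      using V1 K c by simp
  next
    case (step t)
    have t0: "real t \<ge> 1"
      using step by simp
    show ?case
    proof (cases "real (Suc t) \<le> r\<^sup>2 * c")
      case True
      have "1 / r\<^sup>2 * real (Suc t) \<le> 1 / r\<^sup>2 * (r\<^sup>2 * c)"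
        using True r2 by (intro mult_left_mono) auto
      then have "1 / r\<^sup>2 \<le> c / real (Suc t)"
        using r2 r by (simp add: field_simps)
      then have "K * (1 / r\<^sup>2) \<le> K * (c / real (Suc t))"
        using K by (rule mult_left_mono)
      then show ?thesis
        using geometric[of "Suc t"] step by simp
    next
      case False
      have "c / real (Suc t) \<le> c / (r\<^sup>2 * c)"
        using False c r2 by (intro divide_left_mono mult_pos_pos) auto
      also have "\<dots> = 1 / r\<^sup>2"
        using c(1) by simp
      also have "\<dots> = r\<^sup>2 * c - 1"
        using c(2) by simp
      finally have key: "1 + c / real (Suc t) \<le> r\<^sup>2 * c"
        by simp
      have "V (Suc t) \<le> (1 - r\<^sup>2) * V t + K / real t"
        using rec[of t] step by simp
      also have "\<dots> \<le> (1 - r\<^sup>2) * (K * c / real t) + K / real t"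
        using step r2 by (intro add_mono mult_left_mono) auto
      also have "\<dots> = K / real t * (c + (1 - r\<^sup>2 * c))"
        by (simp add: algebra_simps add_divide_distrib diff_divide_distrib)
      also have "\<dots> \<le> K / real t * (c - c / real (Suc t))"
        using key K by (intro mult_left_mono) auto
      also have "\<dots> = K * c / real (Suc t)"
        using t0 by (simp add: field_simps)
      finally show ?thesis .
    qed
  qed
  then show ?thesis
    using t by (simp add: c_def)
qed


section \<open>The stochastic gradient step\<close>

text \<open>The upper comparison inequality in the triangle \<open>m\<close>, \<open>x\<close>, \<open>y\<close>, whose side from \<open>x\<close> to \<open>y\<close> has the
  logarithm \<open>- h * v\<close>.\<close>

lemma (in comparison_domain) gradient_step:
  assumes x: "x \<in> X" and m: "m \<in> X" and v: "v \<in> tangent_space R x" and h: "h \<ge> 0"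
    and len: "h * rnorm R x v \<le> D" and y: "y = rexp R x (\<lambda>c. - h *\<^sub>R v c)" and yX: "y \<in> X"
  shows "(rdist R y m)\<^sup>2 \<le> (rdist R x m)\<^sup>2 + C1 * h\<^sup>2 * rinner R x v v + 2 * h * rinner R x v (rlog R x m)"
proof -
  note xc = X_carrier[OF x]
  have "rnorm R x (\<lambda>c. - h *\<^sub>R v c) = h * rnorm R x v"
    using h by (simp only: rnorm_scale[OF xc] abs_minus_cancel abs_of_nonneg)
  then have "ereal (rnorm R x (\<lambda>c. - h *\<^sub>R v c)) < inj_radius R x"
    using len D_less_inj_radius[OF x] by (metis ereal_less_eq(3) order_le_less_trans)
  then have log: "rlog R x y = (\<lambda>c. - h *\<^sub>R v c)"
    unfolding y by (rule rlog_rexp[OF xc tangent_space_scale[OF v]])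
  have "(rdist R x y)\<^sup>2 = (- h) * ((- h) * rinner R x v v)"
    using rinner_rlog_self[OF x yX] unfolding log rinner_scale_left[OF xc] rinner_scale_right[OF xc] by simp
  moreover have "rinner R x (rlog R x m) (rlog R x y) = - h * rinner R x v (rlog R x m)"
    unfolding log rinner_scale_right[OF xc] using rinner_sym[OF xc] by simp
  ultimately have "(rdist R m y)\<^sup>2 \<le> C1 * (h * (h * rinner R x v v)) + (rdist R m x)\<^sup>2 + 2 * (h * rinner R x v (rlog R x m))"
    using comparison_upper[OF m x yX] by simp
  then show ?thesis
    using rdist_sym[OF m yX] rdist_sym[OF m x] by (simp add: power2_eq_square mult_ac)
qed

lemma (in riemannian) rinner_add_self_le:
  assumes x: "x \<in> manifold_carrier R"
  shows "rinner R x u u \<le> 2 * rinner R x (\<lambda>c. u c - v c) (\<lambda>c. u c - v c) + 2 * rinner R x v v"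
    and "rinner R x (\<lambda>c. u c - v c) (\<lambda>c. u c - v c) \<le> 2 * rinner R x u u + 2 * rinner R x v v"
proof -
  have "0 \<le> rinner R x (\<lambda>c. u c - 2 *\<^sub>R v c) (\<lambda>c. u c - 2 *\<^sub>R v c)" "0 \<le> rinner R x (\<lambda>c. u c + v c) (\<lambda>c. u c + v c)"
    by (rule rinner_nonneg[OF x])+
  then show "rinner R x u u \<le> 2 * rinner R x (\<lambda>c. u c - v c) (\<lambda>c. u c - v c) + 2 * rinner R x v v"
    "rinner R x (\<lambda>c. u c - v c) (\<lambda>c. u c - v c) \<le> 2 * rinner R x u u + 2 * rinner R x v v"
    unfolding rinner_diff_left[OF x] rinner_diff_right[OF x] rinner_add_left[OF x] rinner_add_right[OF x]
      rinner_scale_left[OF x] rinner_scale_right[OF x] rinner_sym[OF x, of v u]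
    by simp_all
qed

lemma iterate_filtration_measurable:
  assumes "k \<in> {1..t}" "x i k \<in> borel_measurable P"
  shows "x i k \<in> borel_measurable (iterate_filtration P x t)"
proof (rule measurableI)
  show "x i k -` A \<inter> space (iterate_filtration P x t) \<in> sets (iterate_filtration P x t)" if "A \<in> sets borel" for A
  proof -
    have "{x i k -` A \<inter> space P | i k A. k \<in> {1..t} \<and> A \<in> sets borel} \<subseteq> Pow (space P)"
      by blast
    moreover have "x i k -` A \<inter> space P \<in> {x i k -` A \<inter> space P | i k A. k \<in> {1..t} \<and> A \<in> sets borel}"
      using that assms(1) by blast
    ultimately show ?thesis
      by (simp add: iterate_filtration_def sets_measure_of space_measure_of sigma_sets.Basic)
  qed
qed simp

lemma subalgebra_iterate_filtration:
  assumes "\<And>i k. k \<in> {1..t} \<Longrightarrow> x i k \<in> borel_measurable P"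
  shows "subalgebra P (iterate_filtration P x t)"
proof -
  have "{x i k -` A \<inter> space P | i k A. k \<in> {1..t} \<and> A \<in> sets borel} \<subseteq> sets P"
    using measurable_sets[OF assms] by blast
  then show ?thesis
    unfolding iterate_filtration_def subalgebra_def
    by (simp add: space_measure_of_conv sets.sigma_sets_subset sets_measure_of[OF order_trans[OF _ sets.space_closed]])
qed

locale decentralized_gradient_method =
  decentralized_network R X Kmin Kmax D C1 C2 C3 C4 E W + prob_space P
  for R :: "('a::{second_countable_topology, t2_space}, 'e::euclidean_space) riemannian"
    and X :: "'a set" and Kmin Kmax D C1 C2 C3 C4 :: real
    and E :: "'n::finite \<Rightarrow> 'n \<Rightarrow> bool" and W :: "real ^ 'n ^ 'n" and P :: "'w measure" +
  fixes f :: "'n \<Rightarrow> 'a \<Rightarrow> real" and gradf :: "'n \<Rightarrow> 'a \<Rightarrow> ('a, 'e) tangent_vector"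
    and ghat :: "'n \<Rightarrow> nat \<Rightarrow> 'w \<Rightarrow> ('a, 'e) tangent_vector"
    and x y :: "'n \<Rightarrow> nat \<Rightarrow> 'w \<Rightarrow> 'a" and xbar :: "nat \<Rightarrow> 'w \<Rightarrow> 'a" and x1 :: 'a
    and \<delta> \<sigma> G \<eta>0 s :: real and \<eta> :: "nat \<Rightarrow> real" and T :: nat
  assumes gradients: "bounded_gradient_assumption R X f gradf \<delta>"
    and \<eta>0_def: "\<eta>0 = min 1 (D / G)" and \<eta>_def: "\<And>t. \<eta> t = \<eta>0 / sqrt (real t)" and s_def: "s = C2 / (2 * C1)"
    and estimator: "unbiased_estimator_assumption R P x gradf ghat \<sigma> G T"
    and iterates: "decentralized_iterates R X P W s \<eta> x1 ghat x y T"
    and means: "frechet_means R X P x xbar T"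
begin

lemma gradf_tangent: "p \<in> X \<Longrightarrow> gradf i p \<in> tangent_space R p"
  and gradf_continuous: "c \<in> atlas R \<Longrightarrow> continuous_on (X \<inter> chart_dom c) (\<lambda>p. gradf i p c)"
  and gradf_bound: "p \<in> X \<Longrightarrow> rnorm R p (gradf i p) \<le> \<delta>"
  using gradients unfolding bounded_gradient_assumption_def has_rgradient_def by blast+

lemma G_pos: "G > 0"
  and ghat_tangent: "t \<in> {1..T} \<Longrightarrow> \<omega> \<in> space P \<Longrightarrow> ghat i t \<omega> \<in> tangent_space R (x i t \<omega>)"
  and ghat_measurable: "t \<in> {1..T} \<Longrightarrow> c \<in> atlas R \<Longrightarrow> (\<lambda>\<omega>. ghat i t \<omega> c) \<in> borel_measurable P"
  and ghat_unbiased: "t \<in> {1..T} \<Longrightarrow> c \<in> atlas R \<Longrightarrow> b \<in> Basis \<Longrightarrow> AE \<omega> in P.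
    real_cond_exp P (iterate_filtration P x t) (\<lambda>\<omega>. ghat i t \<omega> c \<bullet> b) \<omega> = gradf i (x i t \<omega>) c \<bullet> b"
  and ghat_variance: "t \<in> {1..T} \<Longrightarrow> AE \<omega> in P.
    real_cond_exp P (iterate_filtration P x t)
      (\<lambda>\<omega>. (rnorm R (x i t \<omega>) (\<lambda>c. ghat i t \<omega> c - gradf i (x i t \<omega>) c))\<^sup>2) \<omega> \<le> \<sigma>\<^sup>2"
  and ghat_bound: "t \<in> {1..T} \<Longrightarrow> AE \<omega> in P. rnorm R (x i t \<omega>) (ghat i t \<omega>) \<le> G"
  using estimator unfolding unbiased_estimator_assumption_def by blast+

lemma x1_in_X: "x1 \<in> X"
  and x_measurable: "t \<in> {1..T+1} \<Longrightarrow> x i t \<in> borel_measurable P"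
  and x_1: "\<omega> \<in> space P \<Longrightarrow> x i 1 \<omega> = x1"
  and y_Suc: "\<omega> \<in> space P \<Longrightarrow> t \<in> {1..T} \<Longrightarrow> y i (t+1) \<omega> = rexp R (x i t \<omega>) (\<lambda>c. - \<eta> t *\<^sub>R ghat i t \<omega> c)"
  and y_in_X: "\<omega> \<in> space P \<Longrightarrow> t \<in> {1..T} \<Longrightarrow> y i (t+1) \<omega> \<in> X"
  and x_Suc_in_X: "\<omega> \<in> space P \<Longrightarrow> t \<in> {1..T} \<Longrightarrow> x i (t+1) \<omega> \<in> X"
  using iterates unfolding decentralized_iterates_def by blast+

lemma x_Suc:
  assumes "\<omega> \<in> space P" "t \<in> {1..T}"
  shows "x i (t+1) \<omega> = rexp R (y i (t+1) \<omega>) (\<lambda>c. s *\<^sub>R consensus_direction (\<lambda>j. y j (t+1) \<omega>) i c)"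
  using iterates assms unfolding decentralized_iterates_def consensus_direction_def by blast

lemma x_in_X:
  assumes \<omega>: "\<omega> \<in> space P" and t: "t \<in> {1..T+1}"
  shows "x i t \<omega> \<in> X"
proof (cases "t = 1")
  case True
  then show ?thesis
    using x_1[OF \<omega>] x1_in_X by simp
next
  case False
  then have "t - 1 \<in> {1..T}" "t - 1 + 1 = t"
    using t by auto
  then show ?thesis
    using x_Suc_in_X[OF \<omega>, of "t - 1" i] by simp
qed

lemma xbar_minimizes:
  assumes \<omega>: "\<omega> \<in> space P" and t: "t \<in> {1..T+1}"
  shows "xbar t \<omega> \<in> X" and "q \<in> X \<Longrightarrow> spread (\<lambda>i. x i t \<omega>) (xbar t \<omega>) \<le> spread (\<lambda>i. x i t \<omega>) q"
proof -
  have fm: "is_frechet_mean R X (\<lambda>i. x i t \<omega>) (xbar t \<omega>)"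
    using means \<omega> t unfolding frechet_means_def by blast
  then show "xbar t \<omega> \<in> X"
    unfolding is_frechet_mean_def is_arg_min_linorder by blast
  show "q \<in> X \<Longrightarrow> spread (\<lambda>i. x i t \<omega>) (xbar t \<omega>) \<le> spread (\<lambda>i. x i t \<omega>) q"
    using fm CARD_pos unfolding is_frechet_mean_def is_arg_min_linorder spread_def
    by (auto simp: divide_le_cancel)
qed

text \<open>The mean is therefore a continuous function of the iterates, so that it is known at time \<open>t\<close>.\<close>

lemma xbar_barycenter:
  assumes \<omega>: "\<omega> \<in> space P" and t: "t \<in> {1..T+1}"
  shows "barycenter (\<lambda>_. 1 / real CARD('n)) (\<lambda>i. x i t \<omega>) (xbar t \<omega>)"
proof (rule minimizer_is_barycenter)
  have "dispersion (\<lambda>_. 1 / real CARD('n)) (\<lambda>i. x i t \<omega>) q = spread (\<lambda>i. x i t \<omega>) q / real CARD('n)" for q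
    by (simp add: dispersion_def spread_def sum_divide_distrib)
  then show "dispersion (\<lambda>_. 1 / real CARD('n)) (\<lambda>i. x i t \<omega>) (xbar t \<omega>)
      \<le> dispersion (\<lambda>_. 1 / real CARD('n)) (\<lambda>i. x i t \<omega>) q" if "q \<in> X" for q
    using xbar_minimizes(2)[OF \<omega> t that] by (simp add: divide_right_mono)
qed (use x_in_X[OF \<omega> t] xbar_minimizes(1)[OF \<omega> t] in auto)

lemma xbar_measurable:
  assumes t: "t \<in> {1..T+1}" and x: "\<And>i. x i t \<in> borel_measurable M" and M: "space M = space P"
  shows "xbar t \<in> borel_measurable M"
  by (rule barycenter_measurable[where w = "\<lambda>_::'n. 1 / real CARD('n)" and p = "\<lambda>\<omega> i. x i t \<omega>"])
     (use x x_in_X[OF _ t] xbar_barycenter[OF _ t] M in auto)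

lemma deviation_integrable:
  assumes t: "t \<in> {1..T+1}"
  shows "integrable P (\<lambda>\<omega>. (rdist R (x i t \<omega>) (xbar t \<omega>))\<^sup>2)"
proof (rule integrable_const_bound)
  show "AE \<omega> in P. norm ((rdist R (x i t \<omega>) (xbar t \<omega>))\<^sup>2) \<le> D\<^sup>2"
    using rdist_le_D rdist_nonneg x_in_X[OF _ t] xbar_minimizes(1)[OF _ t]
    by (intro AE_I2) (simp add: power_mono)
  show "(\<lambda>\<omega>. (rdist R (x i t \<omega>) (xbar t \<omega>))\<^sup>2) \<in> borel_measurable P"
    using rdist_power2_measurable[OF x_measurable[OF t] xbar_measurable[OF t x_measurable[OF t] refl]]
      x_in_X[OF _ t] xbar_minimizes(1)[OF _ t] by blast
qed

definition mean_deviation :: "nat \<Rightarrow> real" where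
  "mean_deviation t = (\<Sum>i\<in>UNIV. \<integral>\<omega>. (rdist R (x i t \<omega>) (xbar t \<omega>))\<^sup>2 \<partial>P)"

lemma mean_deviation_1: "mean_deviation 1 = 0"
proof -
  have t: "1 \<in> {1..T+1}"
    by simp
  have "(rdist R (x i 1 \<omega>) (xbar 1 \<omega>))\<^sup>2 = 0" if \<omega>: "\<omega> \<in> space P" for i \<omega>
  proof -
    have "spread (\<lambda>i. x i 1 \<omega>) (xbar 1 \<omega>) \<le> spread (\<lambda>i. x i 1 \<omega>) x1"
      by (rule xbar_minimizes(2)[OF \<omega> t x1_in_X])
    also have "\<dots> = 0"
      using x_1[OF \<omega>] rdist_self[OF x1_in_X] by (simp add: spread_def)
    finally have "spread (\<lambda>i. x i 1 \<omega>) (xbar 1 \<omega>) = 0"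
      using sum_nonneg[of UNIV "\<lambda>i. (rdist R (x i 1 \<omega>) (xbar 1 \<omega>))\<^sup>2"] by (simp add: spread_def)
    then show ?thesis
      unfolding spread_def by (subst (asm) sum_nonneg_eq_0_iff) auto
  qed
  then have "(\<integral>\<omega>. (rdist R (x i 1 \<omega>) (xbar 1 \<omega>))\<^sup>2 \<partial>P) = (\<integral>\<omega>. 0 \<partial>P)" for i
    by (intro Bochner_Integration.integral_cong) auto
  then show ?thesis
    by (simp add: mean_deviation_def)
qed

lemma \<eta>_bounds:
  assumes "t \<ge> 1"
  shows "\<eta> t \<ge> 0" "\<eta> t * G \<le> D" "(\<eta> t)\<^sup>2 = \<eta>0\<^sup>2 / real t"
proof -
  have \<eta>0: "\<eta>0 \<ge> 0" "\<eta>0 * G \<le> D"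
    using G_pos D_pos by (auto simp: \<eta>0_def min_def field_simps)
  show "\<eta> t \<ge> 0"
    using \<eta>0 by (simp add: \<eta>_def)
  have "\<eta> t \<le> \<eta>0 / 1"
    unfolding \<eta>_def using \<eta>0 assms by (intro divide_left_mono) auto
  then have "\<eta> t * G \<le> \<eta>0 * G"
    using G_pos by simp
  with \<eta>0 show "\<eta> t * G \<le> D"
    by linarith
  show "(\<eta> t)\<^sup>2 = \<eta>0\<^sup>2 / real t"
    by (simp add: \<eta>_def power_divide)
qed

context
  fixes t :: nat
  assumes t: "t \<in> {1..T}"
begin

lemma t_cases: "t \<in> {1..T+1}" "t + 1 \<in> {1..T+1}"
  using t by auto

abbreviation "F \<equiv> iterate_filtration P x t"

lemma F_subalgebra: "subalgebra P F"
  by (rule subalgebra_iterate_filtration) (use t x_measurable in auto)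

lemma F_space: "space F = space P"
  using F_subalgebra by (simp add: subalgebra_def)

lemma x_F: "x i t \<in> borel_measurable F"
  by (rule iterate_filtration_measurable) (use t x_measurable in auto)

lemma log_mean_F: "c \<in> atlas R \<Longrightarrow> (\<lambda>\<omega>. rlog R (x i t \<omega>) (xbar t \<omega>) c) \<in> borel_measurable F"
  by (rule rlog_measurable[OF x_F xbar_measurable[OF t_cases(1) x_F F_space]])
     (use x_in_X[OF _ t_cases(1)] xbar_minimizes(1)[OF _ t_cases(1)] F_space in auto)

lemma gradf_F:
  assumes c: "c \<in> atlas R"
  shows "(\<lambda>\<omega>. gradf i (x i t \<omega>) c) \<in> borel_measurable F"
proof -
  have "(\<lambda>\<omega>. if x i t \<omega> \<in> chart_dom c then gradf i (x i t \<omega>) c else 0) \<in> borel_measurable F"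
    by (rule measurable_continuous_on_open_part[OF x_F _ open_chart_dom[OF c] gradf_continuous[OF c]])
       (use x_in_X[OF _ t_cases(1)] F_space in auto)
  then show ?thesis
  proof (rule measurable_cong[THEN iffD1, rotated])
    fix \<omega> assume "\<omega> \<in> space F"
    then have "x i t \<omega> \<in> X"
      using x_in_X[OF _ t_cases(1)] F_space by simp
    then show "(if x i t \<omega> \<in> chart_dom c then gradf i (x i t \<omega>) c else 0) = gradf i (x i t \<omega>) c"
      using tangent_space_off_chart[OF gradf_tangent, of "x i t \<omega>" c i] by (simp add: charts_at_iff)
  qed
qed

text \<open>The logarithm of the mean is known at time \<open>t\<close>, so the unbiased estimator may be replaced by the
  gradient under the integral.\<close>

lemma gradient_noise_orthogonal:
  defines "h \<equiv> \<lambda>i \<omega>. rlog R (x i t \<omega>) (xbar t \<omega>)"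
  shows "integrable P (\<lambda>\<omega>. rinner R (x i t \<omega>) (ghat i t \<omega>) (h i \<omega>))"
    and "integrable P (\<lambda>\<omega>. rinner R (x i t \<omega>) (gradf i (x i t \<omega>)) (h i \<omega>))"
    and "(\<integral>\<omega>. rinner R (x i t \<omega>) (ghat i t \<omega>) (h i \<omega>) \<partial>P) = (\<integral>\<omega>. rinner R (x i t \<omega>) (gradf i (x i t \<omega>)) (h i \<omega>) \<partial>P)"
proof -
  interpret finite_measure_subalgebra P F
    by unfold_locales (rule F_subalgebra)
  note X = x_in_X[OF _ t_cases(1)] xbar_minimizes(1)[OF _ t_cases(1)]
  note meas = measurable_from_subalg[OF F_subalgebra]
  have hm: "(\<lambda>\<omega>. h i \<omega> c) \<in> borel_measurable F" if "c \<in> atlas R" for c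
    unfolding h_def by (rule log_mean_F[OF that])
  have ht: "h i \<omega> \<in> tangent_space R (x i t \<omega>)" and hD: "rnorm R (x i t \<omega>) (h i \<omega>) \<le> D" if "\<omega> \<in> space P" for \<omega>
    unfolding h_def using rlog_tangent[OF X[OF that]] rnorm_rlog[OF X[OF that]] rdist_le_D[OF X[OF that]] by simp_all
  have gt: "gradf i (x i t \<omega>) \<in> tangent_space R (x i t \<omega>)" if "\<omega> \<in> space P" for \<omega>
    by (rule gradf_tangent[OF X(1)[OF that]])
  note R = real_cond_exp_rinner[OF prob_space_axioms F_subalgebra x_F X_carrier[OF X(1)] ghat_measurable[OF t]
      hm ghat_tangent[OF t] gt ht ghat_unbiased[OF t] ghat_bound[OF t] hD]
  show int: "integrable P (\<lambda>\<omega>. rinner R (x i t \<omega>) (ghat i t \<omega>) (h i \<omega>))"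
    by (rule R(1))
  have m: "(\<lambda>\<omega>. rinner R (x i t \<omega>) (gradf i (x i t \<omega>)) (h i \<omega>)) \<in> borel_measurable P"
    by (rule rinner_measurable[OF x_measurable[OF t_cases(1)] X_carrier[OF X(1)] meas[OF gradf_F] meas[OF hm] gt ht])
  show "integrable P (\<lambda>\<omega>. rinner R (x i t \<omega>) (gradf i (x i t \<omega>)) (h i \<omega>))"
    by (rule Bochner_Integration.integrable_cong_AE_imp[OF real_cond_exp_int(1)[OF int] m]) (use R(2) in auto)
  have "(\<integral>\<omega>. rinner R (x i t \<omega>) (ghat i t \<omega>) (h i \<omega>) \<partial>P)
      = (\<integral>\<omega>. real_cond_exp P F (\<lambda>\<omega>. rinner R (x i t \<omega>) (ghat i t \<omega>) (h i \<omega>)) \<omega> \<partial>P)"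
    by (rule real_cond_exp_int(2)[OF int, symmetric])
  also have "\<dots> = (\<integral>\<omega>. rinner R (x i t \<omega>) (gradf i (x i t \<omega>)) (h i \<omega>) \<partial>P)"
    by (rule integral_cong_AE[OF _ m R(2)]) simp
  finally show "(\<integral>\<omega>. rinner R (x i t \<omega>) (ghat i t \<omega>) (h i \<omega>) \<partial>P) = (\<integral>\<omega>. rinner R (x i t \<omega>) (gradf i (x i t \<omega>)) (h i \<omega>) \<partial>P)" .
qed

text \<open>Splitting into noise and gradient with \<open>(a + b)\<^sup>2 \<le> 2 * a\<^sup>2 + 2 * b\<^sup>2\<close> is the origin of the factor \<open>2\<close>
  in the constant of the final bound.\<close>

lemma ghat_second_moment:
  shows "integrable P (\<lambda>\<omega>. rinner R (x i t \<omega>) (ghat i t \<omega>) (ghat i t \<omega>))"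
    and "(\<integral>\<omega>. rinner R (x i t \<omega>) (ghat i t \<omega>) (ghat i t \<omega>) \<partial>P) \<le> 2 * (\<sigma>\<^sup>2 + \<delta>\<^sup>2)"
proof -
  interpret finite_measure_subalgebra P F
    by unfold_locales (rule F_subalgebra)
  note X = x_in_X[OF _ t_cases(1)]
  note xc = X_carrier[OF X]
  let ?g = "\<lambda>\<omega>. gradf i (x i t \<omega>)" and ?d = "\<lambda>\<omega> c. ghat i t \<omega> c - gradf i (x i t \<omega>) c"
  have gm: "(\<lambda>\<omega>. ?g \<omega> c) \<in> borel_measurable P" if "c \<in> atlas R" for c
    by (rule measurable_from_subalg[OF F_subalgebra gradf_F[OF that]])
  have gt: "?g \<omega> \<in> tangent_space R (x i t \<omega>)" if "\<omega> \<in> space P" for \<omega>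
    by (rule gradf_tangent[OF X[OF that]])
  have g\<delta>: "rinner R (x i t \<omega>) (?g \<omega>) (?g \<omega>) \<le> \<delta>\<^sup>2" if "\<omega> \<in> space P" for \<omega>
    unfolding rnorm_power2[OF xc[OF that], symmetric]
    by (intro power_mono gradf_bound X[OF that] rnorm_nonneg[OF xc[OF that]])
  have uG: "AE \<omega> in P. rinner R (x i t \<omega>) (ghat i t \<omega>) (ghat i t \<omega>) \<le> G\<^sup>2"
    using ghat_bound[OF t, of i] AE_space
  proof eventually_elim
    case (elim \<omega>)
    then show ?case
      unfolding rnorm_power2[OF xc[OF elim(2)], symmetric]
      by (intro power_mono rnorm_nonneg[OF xc[OF elim(2)]])
  qed
  show int_u: "integrable P (\<lambda>\<omega>. rinner R (x i t \<omega>) (ghat i t \<omega>) (ghat i t \<omega>))"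
  proof (rule integrable_const_bound)
    show "AE \<omega> in P. norm (rinner R (x i t \<omega>) (ghat i t \<omega>) (ghat i t \<omega>)) \<le> G\<^sup>2"
      using uG AE_space by eventually_elim (use rinner_nonneg[OF xc] in simp)
    show "(\<lambda>\<omega>. rinner R (x i t \<omega>) (ghat i t \<omega>) (ghat i t \<omega>)) \<in> borel_measurable P"
      by (rule rinner_measurable[OF x_measurable[OF t_cases(1)] xc ghat_measurable[OF t] ghat_measurable[OF t]
            ghat_tangent[OF t] ghat_tangent[OF t]])
  qed
  have dm: "(\<lambda>\<omega>. ?d \<omega> c) \<in> borel_measurable P" if "c \<in> atlas R" for c
    using ghat_measurable[OF t that] gm[OF that] by (rule borel_measurable_diff)
  have dt: "?d \<omega> \<in> tangent_space R (x i t \<omega>)" if "\<omega> \<in> space P" for \<omega>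
    by (rule tangent_space_diff[OF ghat_tangent[OF t that] gt[OF that]])
  have int_d: "integrable P (\<lambda>\<omega>. rinner R (x i t \<omega>) (?d \<omega>) (?d \<omega>))"
  proof (rule integrable_const_bound)
    show "AE \<omega> in P. norm (rinner R (x i t \<omega>) (?d \<omega>) (?d \<omega>)) \<le> 2 * G\<^sup>2 + 2 * \<delta>\<^sup>2"
      using uG AE_space
    proof eventually_elim
      case (elim \<omega>)
      then show ?case
        using rinner_add_self_le(2)[OF xc[OF elim(2), of i], where u = "ghat i t \<omega>" and v = "?g \<omega>"] g\<delta>[OF elim(2)]
          rinner_nonneg[OF xc[OF elim(2), of i], where u = "?d \<omega>"] by simp
    qed
    show "(\<lambda>\<omega>. rinner R (x i t \<omega>) (?d \<omega>) (?d \<omega>)) \<in> borel_measurable P"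
      by (rule rinner_measurable[OF x_measurable[OF t_cases(1)] xc dm dm dt dt])
  qed
  have var: "(\<integral>\<omega>. rinner R (x i t \<omega>) (?d \<omega>) (?d \<omega>) \<partial>P) \<le> \<sigma>\<^sup>2"
  proof -
    have eq: "rinner R (x i t \<omega>) (?d \<omega>) (?d \<omega>) = (rnorm R (x i t \<omega>) (?d \<omega>))\<^sup>2" if "\<omega> \<in> space P" for \<omega>
      using rnorm_power2[OF xc[OF that]] by simp
    have int: "integrable P (\<lambda>\<omega>. (rnorm R (x i t \<omega>) (?d \<omega>))\<^sup>2)"
      using int_d by (rule Bochner_Integration.integrable_cong[OF refl, THEN iffD1, rotated]) (rule eq)
    have "(\<integral>\<omega>. rinner R (x i t \<omega>) (?d \<omega>) (?d \<omega>) \<partial>P) = (\<integral>\<omega>. (rnorm R (x i t \<omega>) (?d \<omega>))\<^sup>2 \<partial>P)"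
      by (rule Bochner_Integration.integral_cong[OF refl eq])
    also have "\<dots> = (\<integral>\<omega>. real_cond_exp P F (\<lambda>\<omega>. (rnorm R (x i t \<omega>) (?d \<omega>))\<^sup>2) \<omega> \<partial>P)"
      by (rule real_cond_exp_int(2)[OF int, symmetric])
    also have "\<dots> \<le> (\<integral>\<omega>. \<sigma>\<^sup>2 \<partial>P)"
      by (rule integral_mono_AE[OF real_cond_exp_int(1)[OF int] _ ghat_variance[OF t]]) simp
    finally show ?thesis
      by (simp add: prob_space)
  qed
  have "(\<integral>\<omega>. rinner R (x i t \<omega>) (ghat i t \<omega>) (ghat i t \<omega>) \<partial>P)
      \<le> (\<integral>\<omega>. 2 * rinner R (x i t \<omega>) (?d \<omega>) (?d \<omega>) + 2 * \<delta>\<^sup>2 \<partial>P)"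
  proof (rule integral_mono[OF int_u])
    show "integrable P (\<lambda>\<omega>. 2 * rinner R (x i t \<omega>) (?d \<omega>) (?d \<omega>) + 2 * \<delta>\<^sup>2)"
      using int_d by simp
    fix \<omega> assume \<omega>: "\<omega> \<in> space P"
    show "rinner R (x i t \<omega>) (ghat i t \<omega>) (ghat i t \<omega>) \<le> 2 * rinner R (x i t \<omega>) (?d \<omega>) (?d \<omega>) + 2 * \<delta>\<^sup>2"
      using rinner_add_self_le(1)[OF xc[OF \<omega>, of i], where u = "ghat i t \<omega>" and v = "?g \<omega>"] g\<delta>[OF \<omega>] by linarith
  qed
  also have "\<dots> = 2 * (\<integral>\<omega>. rinner R (x i t \<omega>) (?d \<omega>) (?d \<omega>) \<partial>P) + 2 * \<delta>\<^sup>2"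
    using int_d by (simp add: prob_space)
  finally show "(\<integral>\<omega>. rinner R (x i t \<omega>) (ghat i t \<omega>) (ghat i t \<omega>) \<partial>P) \<le> 2 * (\<sigma>\<^sup>2 + \<delta>\<^sup>2)"
    using var by simp
qed

text \<open>The consensus contraction around the new iterates is compared with the old mean, the gradient step
  moves from \<open>y\<close> back to the old iterates, and the remaining first order term is split by Young's
  inequality with weight \<open>mixing_rate\<close>. The factors \<open>1 - mixing_rate\<close> and \<open>1 + mixing_rate\<close> combine
  to \<open>1 - mixing_rate\<^sup>2\<close>.\<close>

lemma mean_deviation_step:
  "mean_deviation (t + 1) \<le> (1 - mixing_rate\<^sup>2) * mean_deviation t
    + (\<eta> t)\<^sup>2 * real CARD('n) * ((1 - mixing_rate) * (2 * C1 * (\<sigma>\<^sup>2 + \<delta>\<^sup>2) + inverse mixing_rate * \<delta>\<^sup>2))"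
proof -
  let ?\<xi> = mixing_rate
  let ?h = "\<lambda>i \<omega>. rlog R (x i t \<omega>) (xbar t \<omega>)"
  let ?u2 = "\<lambda>i \<omega>. rinner R (x i t \<omega>) (ghat i t \<omega>) (ghat i t \<omega>)"
  let ?uh = "\<lambda>i \<omega>. rinner R (x i t \<omega>) (ghat i t \<omega>) (?h i \<omega>)"
  let ?gh = "\<lambda>i \<omega>. rinner R (x i t \<omega>) (gradf i (x i t \<omega>)) (?h i \<omega>)"
  let ?d2 = "\<lambda>i \<omega>. (rdist R (x i t \<omega>) (xbar t \<omega>))\<^sup>2"
  let ?q = "\<lambda>i \<omega>. ?d2 i \<omega> + C1 * (\<eta> t)\<^sup>2 * ?u2 i \<omega> + 2 * \<eta> t * ?uh i \<omega>"
  note \<eta> = \<eta>_bounds[of t]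
  have t1: "t \<ge> 1"
    using t by simp
  note X = x_in_X[OF _ t_cases(1)] xbar_minimizes(1)[OF _ t_cases(1)]
  have \<xi>: "0 < ?\<xi>" "?\<xi> \<le> 1"
    using mixing_rate_pos mixing_rate_le by auto
  have int_q: "integrable P (?q i)" for i
    using deviation_integrable[OF t_cases(1), of i] ghat_second_moment(1)[of i] gradient_noise_orthogonal(1)[of i]
    by simp
  have bound_all: "AE \<omega> in P. \<forall>i. rnorm R (x i t \<omega>) (ghat i t \<omega>) \<le> G"
    by (subst AE_all_countable) (use ghat_bound[OF t] in blast)
  have pointwise: "AE \<omega> in P. (\<Sum>i\<in>UNIV. (rdist R (x i (t+1) \<omega>) (xbar (t+1) \<omega>))\<^sup>2) \<le> (1 - ?\<xi>) * (\<Sum>i\<in>UNIV. ?q i \<omega>)"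
    using bound_all AE_space
  proof eventually_elim
    case (elim \<omega>)
    note \<omega> = elim(2)
    have "spread (\<lambda>i. x i (t+1) \<omega>) (xbar (t+1) \<omega>) \<le> (1 - ?\<xi>) * spread (\<lambda>i. y i (t+1) \<omega>) (xbar t \<omega>)"
      by (rule consensus_contraction[where y = "\<lambda>i. y i (t+1) \<omega>" and x = "\<lambda>i. x i (t+1) \<omega>", OF y_in_X[OF \<omega> t]
            x_Suc_in_X[OF \<omega> t] s_def x_Suc[OF \<omega> t] xbar_minimizes(2)[OF \<omega> t_cases(2)] X(2)[OF \<omega>]])
    also have "\<dots> \<le> (1 - ?\<xi>) * (\<Sum>i\<in>UNIV. ?q i \<omega>)"
      unfolding spread_def
    proof (intro mult_left_mono sum_mono)
      fix i
      have "\<eta> t * rnorm R (x i t \<omega>) (ghat i t \<omega>) \<le> \<eta> t * G"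
        using elim(1) \<eta>(1)[OF t1] by (intro mult_left_mono) auto
      then have "\<eta> t * rnorm R (x i t \<omega>) (ghat i t \<omega>) \<le> D"
        using \<eta>(2)[OF t1] by linarith
      then show "(rdist R (y i (t+1) \<omega>) (xbar t \<omega>))\<^sup>2 \<le> ?q i \<omega>"
        by (rule gradient_step[OF X[OF \<omega>] ghat_tangent[OF t \<omega>] \<eta>(1)[OF t1] _ y_Suc[OF \<omega> t] y_in_X[OF \<omega> t]])
    qed (use \<xi> in simp)
    finally show ?case
      by (simp add: spread_def)
  qed
  have "mean_deviation (t + 1) = (\<integral>\<omega>. (\<Sum>i\<in>UNIV. (rdist R (x i (t+1) \<omega>) (xbar (t+1) \<omega>))\<^sup>2) \<partial>P)"
    unfolding mean_deviation_def
    by (rule Bochner_Integration.integral_sum[symmetric]) (rule deviation_integrable[OF t_cases(2)])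
  also have "\<dots> \<le> (\<integral>\<omega>. (1 - ?\<xi>) * (\<Sum>i\<in>UNIV. ?q i \<omega>) \<partial>P)"
    by (rule integral_mono_AE[OF _ _ pointwise])
       (intro Bochner_Integration.integrable_sum integrable_mult_right deviation_integrable[OF t_cases(2)] int_q)+
  also have "\<dots> = (1 - ?\<xi>) * (\<Sum>i\<in>UNIV. \<integral>\<omega>. ?q i \<omega> \<partial>P)"
    by (subst integral_mult_right_zero, subst Bochner_Integration.integral_sum) (rule int_q, rule refl)
  also have "\<dots> \<le> (1 - ?\<xi>) * (\<Sum>i\<in>UNIV. (1 + ?\<xi>) * (\<integral>\<omega>. ?d2 i \<omega> \<partial>P)
      + (\<eta> t)\<^sup>2 * (2 * C1 * (\<sigma>\<^sup>2 + \<delta>\<^sup>2) + inverse ?\<xi> * \<delta>\<^sup>2))"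
  proof (intro mult_left_mono sum_mono)
    fix i
    note ints = deviation_integrable[OF t_cases(1), of i] ghat_second_moment(1)[of i]
      gradient_noise_orthogonal(1)[of i] gradient_noise_orthogonal(2)[of i]
    have "(\<integral>\<omega>. ?q i \<omega> \<partial>P) = (\<integral>\<omega>. ?d2 i \<omega> \<partial>P) + C1 * (\<eta> t)\<^sup>2 * (\<integral>\<omega>. ?u2 i \<omega> \<partial>P) + 2 * \<eta> t * (\<integral>\<omega>. ?uh i \<omega> \<partial>P)"
      using ints by simp
    also have "\<dots> \<le> (\<integral>\<omega>. ?d2 i \<omega> \<partial>P) + C1 * (\<eta> t)\<^sup>2 * (2 * (\<sigma>\<^sup>2 + \<delta>\<^sup>2)) + 2 * \<eta> t * (\<integral>\<omega>. ?gh i \<omega> \<partial>P)"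
      using ghat_second_moment(2)[of i] C1 unfolding gradient_noise_orthogonal(3)
      by (intro add_mono mult_left_mono order_refl) auto
    also have "2 * \<eta> t * (\<integral>\<omega>. ?gh i \<omega> \<partial>P) = (\<integral>\<omega>. 2 * \<eta> t * ?gh i \<omega> \<partial>P)"
      by simp
    also have "\<dots> \<le> (\<integral>\<omega>. ?\<xi> * ?d2 i \<omega> + (\<eta> t)\<^sup>2 * \<delta>\<^sup>2 / ?\<xi> \<partial>P)"
    proof (rule integral_mono)
      fix \<omega> assume \<omega>: "\<omega> \<in> space P"
      let ?d = "rdist R (x i t \<omega>) (xbar t \<omega>)"
      have d0: "?d \<ge> 0"
        by (rule rdist_nonneg[OF X[OF \<omega>]])
      have "?gh i \<omega> \<le> rnorm R (x i t \<omega>) (gradf i (x i t \<omega>)) * rnorm R (x i t \<omega>) (?h i \<omega>)"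
        using rinner_Cauchy_Schwarz[OF X_carrier[OF X(1)[OF \<omega>, of i]], of "gradf i (x i t \<omega>)" "?h i \<omega>"] by linarith
      also have "\<dots> \<le> \<delta> * ?d"
        using gradf_bound[OF X(1)[OF \<omega>]] d0 unfolding rnorm_rlog[OF X[OF \<omega>]] by (intro mult_right_mono)
      finally have "2 * \<eta> t * ?gh i \<omega> \<le> 2 * \<eta> t * (\<delta> * ?d)"
        using \<eta>(1)[OF t1] by (intro mult_left_mono) auto
      also have "\<dots> \<le> ?\<xi> * ?d\<^sup>2 + (\<eta> t)\<^sup>2 * \<delta>\<^sup>2 / ?\<xi>"
      proof -
        have "0 \<le> (?\<xi> * ?d - \<eta> t * \<delta>)\<^sup>2 / ?\<xi>"
          using \<xi> by simp
        also have "\<dots> = ?\<xi> * ?d\<^sup>2 + (\<eta> t)\<^sup>2 * \<delta>\<^sup>2 / ?\<xi> - 2 * \<eta> t * (\<delta> * ?d)"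
          using \<xi>(1) by (simp add: power2_eq_square field_simps)
        finally show ?thesis
          by linarith
      qed
      finally show "2 * \<eta> t * ?gh i \<omega> \<le> ?\<xi> * ?d2 i \<omega> + (\<eta> t)\<^sup>2 * \<delta>\<^sup>2 / ?\<xi>" .
    qed (use ints in simp_all)
    also have "\<dots> = ?\<xi> * (\<integral>\<omega>. ?d2 i \<omega> \<partial>P) + (\<eta> t)\<^sup>2 * \<delta>\<^sup>2 / ?\<xi>"
      using ints(1) by (simp add: prob_space)
    finally show "(\<integral>\<omega>. ?q i \<omega> \<partial>P) \<le> (1 + ?\<xi>) * (\<integral>\<omega>. ?d2 i \<omega> \<partial>P)
        + (\<eta> t)\<^sup>2 * (2 * C1 * (\<sigma>\<^sup>2 + \<delta>\<^sup>2) + inverse ?\<xi> * \<delta>\<^sup>2)"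
      by (simp add: algebra_simps divide_inverse)
  qed (use \<xi> in simp)
  also have "\<dots> = (1 - ?\<xi>) * ((1 + ?\<xi>) * mean_deviation t
      + real CARD('n) * ((\<eta> t)\<^sup>2 * (2 * C1 * (\<sigma>\<^sup>2 + \<delta>\<^sup>2) + inverse ?\<xi> * \<delta>\<^sup>2)))"
    by (simp add: mean_deviation_def sum.distrib sum_distrib_left)
  also have "\<dots> = (1 - ?\<xi>\<^sup>2) * mean_deviation t
      + (\<eta> t)\<^sup>2 * real CARD('n) * ((1 - ?\<xi>) * (2 * C1 * (\<sigma>\<^sup>2 + \<delta>\<^sup>2) + inverse ?\<xi> * \<delta>\<^sup>2))"
    by (simp add: power2_eq_square algebra_simps)
  finally show ?thesis .
qed

end

theorem mean_deviation_bound: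
  assumes t: "t \<in> {1..T+1}"
  defines "B \<equiv> (1 - mixing_rate) * (2 * C1 * (\<sigma>\<^sup>2 + \<delta>\<^sup>2) + inverse mixing_rate * \<delta>\<^sup>2)"
  shows "mean_deviation t \<le> \<eta>0\<^sup>2 * ((1 + mixing_rate\<^sup>2) / mixing_rate ^ 4) * real CARD('n) * B / real t"
proof -
  have \<xi>: "0 < mixing_rate" "mixing_rate \<le> 1"
    using mixing_rate_pos mixing_rate_le by auto
  have B: "B \<ge> 0"
    unfolding B_def using \<xi> C1 by (intro mult_nonneg_nonneg add_nonneg_nonneg) auto
  have "mean_deviation t \<le> (\<eta>0\<^sup>2 * real CARD('n) * B) * ((1 + mixing_rate\<^sup>2) / mixing_rate ^ 4) / real t"
  proof (rule recursion_bound[where V = mean_deviation and T = T, OF \<xi> _ mean_deviation_1 _ t])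
    fix k assume k: "k \<in> {1..T}"
    then show "mean_deviation (k + 1) \<le> (1 - mixing_rate\<^sup>2) * mean_deviation k + \<eta>0\<^sup>2 * real CARD('n) * B / real k"
      using mean_deviation_step[OF k] \<eta>_bounds(3)[of k] by (simp add: B_def)
  qed (use B in simp)
  then show ?thesis
    by (simp add: mult_ac)
qed

end

theorem theorem1:
  fixes R :: "('a::{second_countable_topology, t2_space}, 'e::euclidean_space) riemannian"
    and X :: "'a set" and Kmin Kmax D C1 C2 C3 C4 :: real
    and E :: "'n::finite \<Rightarrow> 'n \<Rightarrow> bool" and W :: "real ^ 'n ^ 'n"
    and Dist :: "'n \<Rightarrow> 'b measure" and F :: "'n \<Rightarrow> 'a \<Rightarrow> 'b \<Rightarrow> real"
    and f :: "'n \<Rightarrow> 'a \<Rightarrow> real" and gradf :: "'n \<Rightarrow> 'a \<Rightarrow> ('a, 'e) tangent_vector"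
    and P :: "'w measure"
    and ghat :: "'n \<Rightarrow> nat \<Rightarrow> 'w \<Rightarrow> ('a, 'e) tangent_vector"
    and x y :: "'n \<Rightarrow> nat \<Rightarrow> 'w \<Rightarrow> 'a" and xbar :: "nat \<Rightarrow> 'w \<Rightarrow> 'a" and x1 :: 'a
    and \<delta> \<sigma> G \<eta>0 s \<xi> C B :: real and \<eta> :: "nat \<Rightarrow> real" and T :: nat
  assumes "riemannian_manifold R"
    and "manifold_assumption R X Kmin Kmax D"
    and "comparison_constants R X D C1 C2 C3 C4"
    and "network_assumption E W"
    and "expected_objective X Dist F f"
    and "bounded_gradient_assumption R X f gradf \<delta>"
    and "prob_space P"
    and "T \<ge> 1"
    and "\<eta>0 = min 1 (D / G)" and "\<And>t. \<eta> t = \<eta>0 / sqrt (real t)" and "s = C2 / (2 * C1)"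
    and "unbiased_estimator_assumption R P x gradf ghat \<sigma> G T"
    and "decentralized_iterates R X P W s \<eta> x1 ghat x y T"
    and "frechet_means R X P x xbar T"
    and "\<xi> = C2 ^ 3 * (1 - sigma2 W) / (4 * C1 * (1 + C4 * D\<^sup>2)\<^sup>2)"
    and "C = (1 + \<xi>\<^sup>2) / \<xi> ^ 4"
    and "B = (1 - \<xi>) * (2 * C1 * (\<sigma>\<^sup>2 + \<delta>\<^sup>2) + inverse \<xi> * \<delta>\<^sup>2)"
  shows "(\<forall>t\<in>{1..T+1}.
            (\<forall>i. integrable P (\<lambda>\<omega>. (rdist R (x i t \<omega>) (xbar t \<omega>))\<^sup>2)) \<and>
            (\<Sum>i\<in>UNIV. \<integral>\<omega>. (rdist R (x i t \<omega>) (xbar t \<omega>))\<^sup>2 \<partial>P)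
              \<le> \<eta>0\<^sup>2 * C * real CARD('n) * B / real t) \<and>
         ((\<forall>T'\<ge>1. unbiased_estimator_assumption R P x gradf ghat \<sigma> G T' \<and>
             decentralized_iterates R X P W s \<eta> x1 ghat x y T' \<and>
             frechet_means R X P x xbar T') \<longrightarrow>
          (\<lambda>t. \<Sum>i\<in>UNIV. \<integral>\<omega>. (rdist R (x i t \<omega>) (xbar t \<omega>))\<^sup>2 \<partial>P) \<in> O(\<lambda>t. 1 / real t))"
proof (intro conjI impI)
  let ?V = "\<lambda>t. \<Sum>i\<in>UNIV. \<integral>\<omega>. (rdist R (x i t \<omega>) (xbar t \<omega>))\<^sup>2 \<partial>P"
  let ?c = "\<eta>0\<^sup>2 * C * real CARD('n) * B"
  have bound: "\<forall>t\<in>{1..T+1}. (\<forall>i. integrable P (\<lambda>\<omega>. (rdist R (x i t \<omega>) (xbar t \<omega>))\<^sup>2)) \<and> ?V t \<le> ?c / real t"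
    if "unbiased_estimator_assumption R P x gradf ghat \<sigma> G T"
      "decentralized_iterates R X P W s \<eta> x1 ghat x y T" "frechet_means R X P x xbar T" for T
  proof -
    interpret decentralized_gradient_method R X Kmin Kmax D C1 C2 C3 C4 E W P f gradf ghat x y xbar x1 \<delta> \<sigma> G \<eta>0 s \<eta> T
      using assms that
      by (intro decentralized_gradient_method.intro decentralized_network.intro comparison_domain.intro
          riemannian.intro comparison_domain_axioms.intro network.intro decentralized_gradient_method_axioms.intro)
    have \<xi>: "\<xi> = mixing_rate"
      using assms(15) by (simp add: mixing_rate_def)
    show ?thesis
      using deviation_integrable mean_deviation_bound assms(16,17) unfolding \<xi> mean_deviation_def by blast
  qed
  show "\<forall>t\<in>{1..T+1}. (\<forall>i. integrable P (\<lambda>\<omega>. (rdist R (x i t \<omega>) (xbar t \<omega>))\<^sup>2)) \<and> ?V t \<le> ?c / real t"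
    by (rule bound) fact+
  assume all: "\<forall>T'\<ge>1. unbiased_estimator_assumption R P x gradf ghat \<sigma> G T' \<and>
      decentralized_iterates R X P W s \<eta> x1 ghat x y T' \<and> frechet_means R X P x xbar T'"
  have "norm (?V t) \<le> \<bar>?c\<bar> * norm (1 / real t)" if t: "t \<ge> 1" for t
  proof -
    have "?V t \<le> ?c / real t"
      using bound[of t] all t by simp
    also have "\<dots> \<le> \<bar>?c\<bar> / real t"
      by (intro divide_right_mono) auto
    finally have "?V t \<le> \<bar>?c\<bar> * norm (1 / real t)"
      by simp
    moreover have "?V t \<ge> 0"
      by (intro sum_nonneg integral_nonneg_AE) auto
    ultimately show ?thesis
      by simp
  qed
  then show "?V \<in> O(\<lambda>t. 1 / real t)"
    by (intro bigoI[where c = "\<bar>?c\<bar>"] eventually_sequentiallyI[of 1])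
qed

end
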